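(* Let $\kappa>0$, let $\mathcal U\subset\mathbb R^3$ be an exterior region, and let $\psi$ be a radiation solution of the Helmholtz equation $-\Delta\psi=\kappa^2\psi$ in $\mathcal U$. Let $X$ be a two-dimensional (affine) plane in $\mathbb R^3$ such that $X\subset\mathcal U$, and let $\mathcal D$ be an arbitrary non-empty open domain of $X$. Then $\psi$ on $X$ is uniquely determined by $\operatorname{Im}\psi$ on $\mathcal D$. That is, if $\psi_1,\psi_2$ are two radiation solutions in $\mathcal U$ (for the same $\kappa$) and $\operatorname{Im}\psi_1=\operatorname{Im}\psi_2$ on $\mathcal D$, then $\psi_1=\psi_2$ on $X$.
   Context: An exterior region $\mathcal U$ in $\mathbb R^3$ is an open unbounded connected set consisting of all points in the exterior of a closed bounded regular surface $S$. A radiation solution in $\mathcal U$ is a complex-valued function $\psi$, of class $C^2$ in the closure of $\mathcal U$, satisfying $-\Delta\psi(x)=\kappa^2\psi(x)$ for $x\in\mathcal U$ and the Sommerfeld radiation condition $|x|\left(\frac{\partial}{\partial|x|}-i\kappa\right)\psi(x)\to0$ as $|x|\to+\infty$, uniformly in $x/|x|$. "Open domain of $X$" means open in the relative topology of $X$. *)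

theory Defs
  imports "HOL-Analysis.Analysis"
begin

text \<open>
  Regular surfaces are embedded surfaces without boundary, given by local parametrizations. Only
  \<open>C\<^sup>1\<close> parametrizations are required, so that surfaces of every smoothness class
  \<open>C\<^sup>k\<close> with \<open>k \<ge> 1\<close>, and smooth surfaces, are covered.
\<close>

definition regular_surface :: "(real^3) set \<Rightarrow> bool" where
  "regular_surface S \<longleftrightarrow>
     (\<forall>p\<in>S. \<exists>V W (\<phi> :: real^2 \<Rightarrow> real^3) \<phi>inv (\<phi>' :: real^2 \<Rightarrow> ((real^2) \<Rightarrow>\<^sub>L (real^3))).
        open V \<and> p \<in> V \<and> open W \<and> homeomorphism W (S \<inter> V) \<phi> \<phi>inv \<and>
        (\<forall>w\<in>W. (\<phi> has_derivative blinfun_apply (\<phi>' w)) (at w) \<and> inj (blinfun_apply (\<phi>' w))) \<and>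
        continuous_on W \<phi>')"

text \<open>
  The surface \<open>S\<close> is not assumed to be connected. The set \<open>outside S\<close> consists of the points
  whose component in the complement of \<open>S\<close> is unbounded.
\<close>

definition exterior_region :: "(real^3) set \<Rightarrow> bool" where
  "exterior_region U \<longleftrightarrow>
     open U \<and> \<not> bounded U \<and> connected U \<and>
     (\<exists>S. S \<noteq> {} \<and> closed S \<and> bounded S \<and> regular_surface S \<and> U = outside S)"

lemma exterior_region_outside:
  assumes "S \<noteq> {}" "closed S" "bounded S" "regular_surface S"
  shows "exterior_region (outside S)"
  unfolding exterior_region_def
  using assms open_outside[of S] unbounded_outside[of S] connected_outside[of S] by auto

text \<open>
  Functions of class \<open>C\<^sup>2\<close> in the closure of an open set \<open>U\<close>: twice continuously
  differentiable in \<open>U\<close>, and the function and its derivatives up to order two extend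
  continuously to the closure. Outside \<open>U\<close>, the witnesses \<open>Df\<close> and \<open>D2f\<close> are these extensions.
\<close>

definition C2_on_closure :: "(real^3) set \<Rightarrow> (real^3 \<Rightarrow> complex) \<Rightarrow> bool" where
  "C2_on_closure U f \<longleftrightarrow>
     continuous_on (closure U) f \<and>
     (\<exists>(Df :: real^3 \<Rightarrow> ((real^3) \<Rightarrow>\<^sub>L complex)) (D2f :: real^3 \<Rightarrow> ((real^3) \<Rightarrow>\<^sub>L ((real^3) \<Rightarrow>\<^sub>L complex))).
        continuous_on (closure U) Df \<and> continuous_on (closure U) D2f \<and>
        (\<forall>x\<in>U. (f has_derivative blinfun_apply (Df x)) (at x) \<and>
               (Df has_derivative blinfun_apply (D2f x)) (at x)))"

definition laplacian :: "(real^3 \<Rightarrow> complex) \<Rightarrow> real^3 \<Rightarrow> complex" where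
  "laplacian f x =
     (\<Sum>b\<in>Basis. frechet_derivative (\<lambda>y. frechet_derivative f (at y) b) (at x) b)"

definition radial_derivative :: "(real^3 \<Rightarrow> complex) \<Rightarrow> real^3 \<Rightarrow> complex" where
  "radial_derivative f x = vector_derivative (\<lambda>r. f (r *\<^sub>R sgn x)) (at (norm x))"

definition sommerfeld_radiation :: "real \<Rightarrow> (real^3 \<Rightarrow> complex) \<Rightarrow> bool" where
  "sommerfeld_radiation \<kappa> \<psi> \<longleftrightarrow>
     uniform_limit (sphere 0 1)
       (\<lambda>r \<theta>. of_real r *
          (radial_derivative \<psi> (r *\<^sub>R \<theta>) - \<i> * of_real \<kappa> * \<psi> (r *\<^sub>R \<theta>)))
       (\<lambda>_. 0) at_top"

text \<open>
  A radiation solution in \<open>U\<close> is represented by a total function; its values off the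
  closure of \<open>U\<close> are irrelevant.
\<close>

definition radiation_solution :: "real \<Rightarrow> (real^3) set \<Rightarrow> (real^3 \<Rightarrow> complex) \<Rightarrow> bool" where
  "radiation_solution \<kappa> U \<psi> \<longleftrightarrow>
     C2_on_closure U \<psi> \<and>
     (\<forall>x\<in>U. - laplacian \<psi> x = of_real (\<kappa>\<^sup>2) * \<psi> x) \<and>
     sommerfeld_radiation \<kappa> \<psi>"

end

theory Submission
  imports Defs "HOL-Complex_Analysis.Complex_Analysis"
begin

text \<open>
  Green's identity against a regularised outgoing fundamental solution represents a solution near a
  point, and a radiation solution far out, as an integral of \<open>exp (\<i> \<kappa> |x - y|) / |x - y|\<close> against a
  continuous function supported in a shell; the contribution of a shell going to infinity vanishes
  by the radiation condition. The first representation makes \<open>\<psi>\<close> real analytic along lines. The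
  second shows that on a line \<open>p + s d\<close> one has \<open>s \<psi> = exp (\<i> \<kappa> s) F(1/s)\<close> for large \<open>s\<close> with \<open>F\<close>
  holomorphic at \<open>0\<close>. If \<open>Im \<psi>\<close> vanishes near one point of a line in \<open>X\<close>, it vanishes on the whole
  line, and the oscillation of \<open>exp (\<i> \<kappa> s)\<close> then forces \<open>F = 0\<close>, hence \<open>\<psi> = 0\<close> on that line. The
  lines through a point of \<open>D\<close> cover \<open>X\<close>.
\<close>

section \<open>Integrals of compactly supported functions\<close>

text \<open>The radiation condition carries the theorem: \<open>sin (\<kappa> |x|) / |x|\<close>
  solves the Helmholtz equation in all of space and is real. What the condition must deliver is an
  expansion along a line in which only exp (i \<kappa> s) occurs, because a sum of an outgoing and
  an incoming part can stay real for all s. Surface integrals never appear. Each boundary term is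
  spread over a shell by a cutoff, and Green's identity rests on the translation invariance of the
  integral. The source of a cut-off solution is then a commutator living in a shell at positive
  distance from the point of evaluation, and this distance is what allows the position on the line
  to become complex. The delicate place is infinity. The radiation condition yields at first only
  \<psi> = o(|y|), far from the true decay 1/|y|, so estimates by absolute values fail on the outer
  shell, and a cancellation of phases to second order is needed there. Treating one line at a time
  keeps all analyticity in a single complex variable.\<close>

lemma continuous_on_UNIV_compact_support:
  fixes f :: "'a::t2_space \<Rightarrow> 'b::real_normed_vector"
  assumes "open S" "compact K" "K \<subseteq> S" "continuous_on S f" "\<And>y. y \<notin> K \<Longrightarrow> f y = 0"
  shows "continuous_on UNIV f"
proof -
  have "continuous_on (- K) f \<longleftrightarrow> continuous_on (- K) (\<lambda>_. 0::'b)"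
    by (intro continuous_on_cong) (use assms in auto)
  then have "continuous_on (S \<union> - K) f"
    using assms by (intro continuous_on_open_Un) (auto simp: compact_imp_closed open_Compl)
  moreover have "S \<union> - K = UNIV" using assms by auto
  ultimately show ?thesis by simp
qed

lemma compact_support_integrable:
  fixes f :: "'a::euclidean_space \<Rightarrow> complex"
  assumes "continuous_on UNIV f" "bounded K" "\<And>y. y \<notin> K \<Longrightarrow> f y = 0"
  shows "f integrable_on UNIV"
proof -
  obtain a where a: "K \<subseteq> cbox (-a) a"
    using bounded_subset_cbox_symmetric[OF assms(2)] by blast
  have "f integrable_on cbox (-a) a"
    using assms(1) by (intro integrable_continuous) (auto intro: continuous_on_subset)
  then show ?thesis
    by (rule integrable_on_superset) (use a assms in auto)
qed

lemma integral_UNIV_support: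
  fixes f :: "'a::euclidean_space \<Rightarrow> complex"
  assumes "\<And>y. y \<notin> K \<Longrightarrow> f y = 0"
  shows "integral UNIV f = integral K f"
proof -
  have "f = (\<lambda>x. if x \<in> K then f x else 0)" using assms by auto
  then have "integral UNIV f = integral UNIV (\<lambda>x. if x \<in> K then f x else 0)" by simp
  then show ?thesis using integral_restrict_UNIV[of K f] by simp
qed

text \<open>Used with \<open>m = 1\<close> as translation invariance and with \<open>m = e\<close>
  to rescale a ball of radius e to the unit ball.\<close>

lemma integral_UNIV_affine:
  fixes f :: "'a::euclidean_space \<Rightarrow> complex"
  assumes "continuous_on UNIV f" "bounded K" "\<And>y. y \<notin> K \<Longrightarrow> f y = 0" and m: "m \<noteq> 0"
  shows "integral UNIV (\<lambda>x. f (m *\<^sub>R x + c)) = integral UNIV f /\<^sub>R \<bar>m\<bar> ^ DIM('a)"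
proof -
  obtain a where a: "K \<subseteq> cbox (-a) a"
    using bounded_subset_cbox_symmetric[OF assms(2)] by blast
  have "f integrable_on cbox (-a) a"
    using assms(1) by (intro integrable_continuous) (auto intro: continuous_on_subset)
  moreover have e: "integral UNIV f = integral (cbox (-a) a) f"
    by (rule integral_UNIV_support) (use a assms in auto)
  ultimately have "(f has_integral integral UNIV f) (cbox (-a) a)"
    by (simp add: has_integral_integral)
  from has_integral_affinity[OF this m, of c]
  have 1: "((\<lambda>x. f (m *\<^sub>R x + c)) has_integral (1 / \<bar>m\<bar> ^ DIM('a)) *\<^sub>R integral UNIV f)
     ((\<lambda>x. (1 / m) *\<^sub>R x + - ((1 / m) *\<^sub>R c)) ` cbox (-a) a)" .
  have "((\<lambda>x. f (m *\<^sub>R x + c)) has_integral (1 / \<bar>m\<bar> ^ DIM('a)) *\<^sub>R integral UNIV f) UNIV"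
  proof (rule has_integral_on_superset[OF 1])
    fix x assume x: "x \<notin> (\<lambda>x. (1 / m) *\<^sub>R x + - ((1 / m) *\<^sub>R c)) ` cbox (-a) a"
    have "m *\<^sub>R x + c \<notin> cbox (-a) a"
    proof
      assume "m *\<^sub>R x + c \<in> cbox (-a) a"
      then have "(1 / m) *\<^sub>R (m *\<^sub>R x + c) + - ((1 / m) *\<^sub>R c) \<in> (\<lambda>x. (1 / m) *\<^sub>R x + - ((1 / m) *\<^sub>R c)) ` cbox (-a) a"
        by (rule imageI)
      moreover have "(1 / m) *\<^sub>R (m *\<^sub>R x + c) + - ((1 / m) *\<^sub>R c) = x"
        using m by (simp add: algebra_simps)
      ultimately show False using x by simp
    qed
    then show "f (m *\<^sub>R x + c) = 0" using a assms(3) by blast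
  qed auto
  then show ?thesis by (simp add: integral_unique divide_inverse_commute)
qed

text \<open>By translation invariance the integral of w (y + t b) over y does not depend on t, and
  differentiating under the integral sign at t = 0 produces the integral of \<open>w'\<close>. This
  stands in for the divergence theorem.\<close>

lemma integral_directional_derivative_eq_0:
  fixes w :: "'a::euclidean_space \<Rightarrow> complex"
  assumes S: "open S" "compact K" "K \<subseteq> S"
    and d: "\<And>y. y \<in> S \<Longrightarrow> ((\<lambda>t. w (y + t *\<^sub>R b)) has_vector_derivative w' y) (at 0)"
    and c: "continuous_on S w" "continuous_on S w'"
    and z: "\<And>y. y \<notin> K \<Longrightarrow> w y = 0" "\<And>y. y \<notin> K \<Longrightarrow> w' y = 0"
  shows "integral UNIV w' = 0"
proof -
  have cw: "continuous_on UNIV w" and cw': "continuous_on UNIV w'"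
    using continuous_on_UNIV_compact_support[OF S] c z by blast+
  have d0: "((\<lambda>t. w (y + t *\<^sub>R b)) has_vector_derivative w' y) (at 0)" for y
  proof (cases "y \<in> S")
    case False
    then have y: "y \<in> - K" using S by auto
    have "((\<lambda>t. w (y + t *\<^sub>R b)) has_vector_derivative 0) (at 0)"
    proof (rule has_vector_derivative_transform_within_open[OF has_vector_derivative_const[of 0]])
      show "open ((\<lambda>t. y + t *\<^sub>R b) -` (- K))"
        using S(2) by (intro open_vimage continuous_intros) (auto simp: compact_imp_closed open_Compl)
    qed (use y z in auto)
    then show ?thesis using z y by simp
  qed (use d in auto)
  have dt: "((\<lambda>t. w (y + t *\<^sub>R b)) has_vector_derivative w' (y + t *\<^sub>R b)) (at t)" for y t
  proof -
    have "((\<lambda>h. w ((y + t *\<^sub>R b) + h *\<^sub>R b)) has_vector_derivative w' (y + t *\<^sub>R b)) (at (t - t))"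
      using d0[of "y + t *\<^sub>R b"] by simp
    moreover have "((\<lambda>s. s - t) has_vector_derivative 1) (at t)"
      by (auto intro!: derivative_eq_intros)
    ultimately have "((\<lambda>h. w ((y + t *\<^sub>R b) + h *\<^sub>R b)) \<circ> (\<lambda>s. s - t) has_vector_derivative
        1 *\<^sub>R w' (y + t *\<^sub>R b)) (at t)"
      by (intro vector_diff_chain_at)
    then show ?thesis by (simp add: o_def algebra_simps)
  qed
  obtain r where r: "\<And>x. x \<in> K \<Longrightarrow> norm x \<le> r"
    using compact_imp_bounded[OF S(2)] by (auto simp: bounded_iff)
  \<comment> \<open>A box that contains every translate of \<open>K\<close> by t b with |t| at most
    1, so that the Leibniz rule works over one fixed domain.\<close>
  obtain a where a: "cball 0 (r + norm b) \<subseteq> cbox (-a) (a::'a)"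
    using bounded_subset_cbox_symmetric[OF bounded_cball] by blast
  have sup: "w (y + t *\<^sub>R b) = 0" "w' (y + t *\<^sub>R b) = 0" if "y \<notin> cbox (-a) a" "\<bar>t\<bar> \<le> 1" for y t
  proof -
    have "r + norm b < norm y" using a that(1) by (auto simp: not_le)
    moreover have "norm y \<le> norm (y + t *\<^sub>R b) + norm (t *\<^sub>R b)"
      by (metis add_diff_cancel norm_triangle_ineq4)
    moreover have "norm (t *\<^sub>R b) \<le> norm b" using that(2) by (simp add: mult_left_le_one_le)
    ultimately have "y + t *\<^sub>R b \<notin> K" using r by fastforce
    then show "w (y + t *\<^sub>R b) = 0" "w' (y + t *\<^sub>R b) = 0" using z by auto
  qed
  have 1: "integral (cbox (-a) a) (\<lambda>y. w (y + t *\<^sub>R b)) = integral UNIV w" if "\<bar>t\<bar> \<le> 1" for t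
  proof -
    have "integral (cbox (-a) a) (\<lambda>y. w (y + t *\<^sub>R b)) = integral UNIV (\<lambda>y. w (1 *\<^sub>R y + t *\<^sub>R b))"
      using sup(1) that by (subst integral_UNIV_support[where K = "cbox (-a) a"]) auto
    also have "\<dots> = integral UNIV w"
      using integral_UNIV_affine[OF cw compact_imp_bounded[OF S(2)] z(1), of 1 "t *\<^sub>R b"] by simp
    finally show ?thesis .
  qed
  have "((\<lambda>t. integral (cbox (-a) a) (\<lambda>y. w (y + t *\<^sub>R b))) has_vector_derivative
      integral (cbox (-a) a) (\<lambda>y. w' (y + 0 *\<^sub>R b))) (at 0 within {-1..1})"
  proof (rule leibniz_rule_vector_derivative)
    show "((\<lambda>t. w (y + t *\<^sub>R b)) has_vector_derivative w' (y + t *\<^sub>R b)) (at t within {-1..1})" for t y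
      using dt has_vector_derivative_at_within by blast
    show "(\<lambda>y. w (y + t *\<^sub>R b)) integrable_on cbox (-a) a" for t
      by (intro integrable_continuous continuous_on_compose2[OF cw] continuous_intros) auto
    show "continuous_on ({-1..1} \<times> cbox (-a) a) (\<lambda>(t, y). w' (y + t *\<^sub>R b))"
      unfolding split_def
      by (intro continuous_on_compose2[OF cw'] continuous_intros) auto
  qed auto
  moreover have "((\<lambda>t. integral (cbox (-a) a) (\<lambda>y. w (y + t *\<^sub>R b))) has_vector_derivative 0)
      (at 0 within {-1..1})"
    by (rule has_vector_derivative_transform[OF _ _ has_vector_derivative_const[of "integral UNIV w"]])
      (use 1 in auto)
  ultimately have "integral (cbox (-a) a) (\<lambda>y. w' (y + 0 *\<^sub>R b)) = 0"
    using vector_derivative_unique_within_closed_interval[of "-1" 1 0] by force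
  then show ?thesis
    using sup(2)[of _ 0] by (subst integral_UNIV_support[where K = "cbox (-a) a"]) auto
qed

section \<open>Directional \<open>C\<^sup>2\<close> data and Green's identity\<close>

text \<open>
  \<open>f1 b\<close> and \<open>f2 b\<close> are the first and second derivatives in the coordinate direction \<open>b\<close>;
  no mixed derivatives are recorded, since only the Laplacian is needed.
\<close>

definition C2_data ::
  "'a::euclidean_space set \<Rightarrow> ('a \<Rightarrow> complex) \<Rightarrow> ('a \<Rightarrow> 'a \<Rightarrow> complex) \<Rightarrow> ('a \<Rightarrow> 'a \<Rightarrow> complex) \<Rightarrow> bool"
  where "C2_data S f f1 f2 \<longleftrightarrow> continuous_on S f \<and>
    (\<forall>b\<in>Basis. continuous_on S (f1 b) \<and> continuous_on S (f2 b) \<and>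
      (\<forall>y\<in>S. ((\<lambda>t. f (y + t *\<^sub>R b)) has_vector_derivative f1 b y) (at 0) \<and>
             ((\<lambda>t. f1 b (y + t *\<^sub>R b)) has_vector_derivative f2 b y) (at 0)))"

lemma C2_dataD:
  assumes "C2_data S f f1 f2"
  shows "continuous_on S f"
    and "b \<in> Basis \<Longrightarrow> continuous_on S (f1 b)" and "b \<in> Basis \<Longrightarrow> continuous_on S (f2 b)"
    and "b \<in> Basis \<Longrightarrow> y \<in> S \<Longrightarrow> ((\<lambda>t. f (y + t *\<^sub>R b)) has_vector_derivative f1 b y) (at 0)"
    and "b \<in> Basis \<Longrightarrow> y \<in> S \<Longrightarrow> ((\<lambda>t. f1 b (y + t *\<^sub>R b)) has_vector_derivative f2 b y) (at 0)"
  using assms by (auto simp: C2_data_def)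

lemma C2_data_subset: "C2_data S f f1 f2 \<Longrightarrow> T \<subseteq> S \<Longrightarrow> C2_data T f f1 f2"
  unfolding C2_data_def by (meson continuous_on_subset subsetD)

lemma C2_data_mult:
  assumes "C2_data S f f1 f2" "C2_data S g g1 g2"
  shows "C2_data S (\<lambda>y. f y * g y) (\<lambda>b y. f1 b y * g y + f y * g1 b y)
    (\<lambda>b y. f2 b y * g y + 2 * f1 b y * g1 b y + f y * g2 b y)"
  unfolding C2_data_def
proof (intro conjI ballI)
  note D = C2_dataD[OF assms(1)] C2_dataD[OF assms(2)]
  fix b y :: 'a assume [simp]: "b \<in> Basis" and y [simp]: "y \<in> S"
  have "((\<lambda>t. f (y + t *\<^sub>R b) * g (y + t *\<^sub>R b)) has_vector_derivative
      f (y + 0 *\<^sub>R b) * g1 b y + f1 b y * g (y + 0 *\<^sub>R b)) (at 0)"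
    by (rule has_vector_derivative_mult) (use D in auto)
  then show "((\<lambda>t. f (y + t *\<^sub>R b) * g (y + t *\<^sub>R b)) has_vector_derivative
      f1 b y * g y + f y * g1 b y) (at 0)" by (simp add: add.commute)
  have "((\<lambda>t. f1 b (y + t *\<^sub>R b) * g (y + t *\<^sub>R b) + f (y + t *\<^sub>R b) * g1 b (y + t *\<^sub>R b)) has_vector_derivative
      (f1 b (y + 0 *\<^sub>R b) * g1 b y + f2 b y * g (y + 0 *\<^sub>R b)) +
      (f (y + 0 *\<^sub>R b) * g2 b y + f1 b y * g1 b (y + 0 *\<^sub>R b))) (at 0)"
    by (intro has_vector_derivative_add has_vector_derivative_mult) (use D in auto)
  then show "((\<lambda>t. f1 b (y + t *\<^sub>R b) * g (y + t *\<^sub>R b) + f (y + t *\<^sub>R b) * g1 b (y + t *\<^sub>R b)) has_vector_derivative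
      f2 b y * g y + 2 * f1 b y * g1 b y + f y * g2 b y) (at 0)" by (simp add: algebra_simps)
qed (use C2_dataD[OF assms(1)] C2_dataD[OF assms(2)] in \<open>auto intro!: continuous_intros\<close>)

lemma has_vector_derivative_norm_sq_line:
  assumes "b \<in> Basis"
  shows "((\<lambda>t. (norm (y + t *\<^sub>R b - x))\<^sup>2) has_vector_derivative 2 * ((y - x) \<bullet> b)) (at (0::real))"
proof -
  have "((\<lambda>t. (norm (y - x))\<^sup>2 + 2 * t * ((y - x) \<bullet> b) + t\<^sup>2) has_vector_derivative 2 * ((y - x) \<bullet> b)) (at 0)"
    unfolding has_real_derivative_iff_has_vector_derivative[symmetric]
    by (auto intro!: derivative_eq_intros)
  moreover have "(norm (y + t *\<^sub>R b - x))\<^sup>2 = (norm (y - x))\<^sup>2 + 2 * t * ((y - x) \<bullet> b) + t\<^sup>2" for t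
    unfolding power2_norm_eq_inner using assms
    by (simp add: algebra_simps inner_commute power2_eq_square)
  ultimately show ?thesis by simp
qed

lemma has_vector_derivative_radial:
  fixes h :: "real \<Rightarrow> complex"
  assumes "b \<in> Basis" "(h has_vector_derivative h') (at ((norm (y - x))\<^sup>2))"
  shows "((\<lambda>t. h ((norm (y + t *\<^sub>R b - x))\<^sup>2)) has_vector_derivative
      h' * of_real (2 * ((y - x) \<bullet> b))) (at 0)"
proof -
  have "(h has_vector_derivative h') (at ((norm (y + 0 *\<^sub>R b - x))\<^sup>2))"
    using assms(2) by simp
  from vector_diff_chain_at[OF has_vector_derivative_norm_sq_line[OF assms(1)] this]
  show ?thesis by (simp add: o_def scaleR_conv_of_real mult.commute)
qed

text \<open>Radial functions are fed with the squared distance, which is polynomial in y, so the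
  centre x needs no special treatment.\<close>

lemma C2_data_radial:
  fixes h h' h'' :: "real \<Rightarrow> complex"
  assumes h: "\<And>s. s \<in> T \<Longrightarrow> (h has_vector_derivative h' s) (at s)"
    and h': "\<And>s. s \<in> T \<Longrightarrow> (h' has_vector_derivative h'' s) (at s)"
    and c: "continuous_on T h''"
    and S: "\<And>y. y \<in> S \<Longrightarrow> (norm (y - x))\<^sup>2 \<in> T"
  shows "C2_data S (\<lambda>y. h ((norm (y - x))\<^sup>2))
    (\<lambda>b y. h' ((norm (y - x))\<^sup>2) * of_real (2 * ((y - x) \<bullet> b)))
    (\<lambda>b y. h'' ((norm (y - x))\<^sup>2) * of_real ((2 * ((y - x) \<bullet> b))\<^sup>2) + 2 * h' ((norm (y - x))\<^sup>2))"
  unfolding C2_data_def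
proof (intro conjI ballI)
  have "continuous_on T h" "continuous_on T h'"
    using h h' by (meson continuous_at_imp_continuous_on has_vector_derivative_continuous)+
  then have *: "continuous_on S (\<lambda>y. h ((norm (y - x))\<^sup>2))" "continuous_on S (\<lambda>y. h' ((norm (y - x))\<^sup>2))"
    "continuous_on S (\<lambda>y. h'' ((norm (y - x))\<^sup>2))"
    using c S by (auto intro!: continuous_on_compose2[where f = "\<lambda>y. (norm (y - x))\<^sup>2"] continuous_intros)
  then show "continuous_on S (\<lambda>y. h ((norm (y - x))\<^sup>2))" by simp
  fix b :: 'a assume b: "b \<in> Basis"
  show "continuous_on S (\<lambda>y. h' ((norm (y - x))\<^sup>2) * of_real (2 * ((y - x) \<bullet> b)))"
    "continuous_on S (\<lambda>y. h'' ((norm (y - x))\<^sup>2) * of_real ((2 * ((y - x) \<bullet> b))\<^sup>2) + 2 * h' ((norm (y - x))\<^sup>2))"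
    by (intro continuous_intros *)+
  fix y assume y: "y \<in> S"
  note chain = has_vector_derivative_radial[OF b]
  show "((\<lambda>t. h ((norm (y + t *\<^sub>R b - x))\<^sup>2)) has_vector_derivative
      h' ((norm (y - x))\<^sup>2) * of_real (2 * ((y - x) \<bullet> b))) (at 0)"
    by (rule chain[OF h[OF S[OF y]]])
  have 2: "((\<lambda>t. of_real (2 * ((y + t *\<^sub>R b - x) \<bullet> b)) :: complex) has_vector_derivative 2) (at 0)"
    using b by (auto intro!: derivative_eq_intros simp: has_vector_derivative_def algebra_simps
        scaleR_conv_of_real inner_Basis)
  from has_vector_derivative_mult[OF chain[OF h'[OF S[OF y]]] this]
  show "((\<lambda>t. h' ((norm (y + t *\<^sub>R b - x))\<^sup>2) * of_real (2 * ((y + t *\<^sub>R b - x) \<bullet> b))) has_vector_derivative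
      h'' ((norm (y - x))\<^sup>2) * of_real ((2 * ((y - x) \<bullet> b))\<^sup>2) + 2 * h' ((norm (y - x))\<^sup>2)) (at 0)"
    by (simp add: algebra_simps power2_eq_square)
qed

text \<open>In each direction b, \<open>k y * v2 b y - v y * k2 b y\<close> is the derivative of
  \<open>k y * v1 b y - v y * k1 b y\<close>, since the products of first derivatives cancel.
  Compact support is asked of \<open>v\<close> alone, because \<open>k\<close> will be a
  kernel.\<close>

lemma green_identity:
  fixes v k :: "'a::euclidean_space \<Rightarrow> complex"
  assumes S: "open S" "compact K" "K \<subseteq> S"
    and v: "C2_data S v v1 v2" and k: "C2_data S k k1 k2"
    and z: "\<And>y. y \<notin> K \<Longrightarrow> v y = 0" "\<And>b y. y \<notin> K \<Longrightarrow> v1 b y = 0" "\<And>b y. y \<notin> K \<Longrightarrow> v2 b y = 0"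
  shows "integral UNIV (\<lambda>y. k y * (\<Sum>b\<in>Basis. v2 b y)) = integral UNIV (\<lambda>y. v y * (\<Sum>b\<in>Basis. k2 b y))"
proof -
  note D = C2_dataD[OF v] C2_dataD[OF k]
  note int = compact_support_integrable[OF continuous_on_UNIV_compact_support[OF S] compact_imp_bounded[OF S(2)]]
  have eq0: "integral UNIV (\<lambda>y. k y * v2 b y - v y * k2 b y) = 0" if b [simp]: "b \<in> Basis" for b
  proof (rule integral_directional_derivative_eq_0[OF S, where w = "\<lambda>y. k y * v1 b y - v y * k1 b y"])
    fix y assume [simp]: "y \<in> S"
    have "((\<lambda>t. k (y + t *\<^sub>R b) * v1 b (y + t *\<^sub>R b) - v (y + t *\<^sub>R b) * k1 b (y + t *\<^sub>R b)) has_vector_derivative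
       (k (y + 0 *\<^sub>R b) * v2 b y + k1 b y * v1 b (y + 0 *\<^sub>R b)) -
       (v (y + 0 *\<^sub>R b) * k2 b y + v1 b y * k1 b (y + 0 *\<^sub>R b))) (at 0)"
      by (intro has_vector_derivative_diff has_vector_derivative_mult) (use D in auto)
    then show "((\<lambda>t. k (y + t *\<^sub>R b) * v1 b (y + t *\<^sub>R b) - v (y + t *\<^sub>R b) * k1 b (y + t *\<^sub>R b)) has_vector_derivative
       k y * v2 b y - v y * k2 b y) (at 0)" by (simp add: algebra_simps)
  qed (use D z in \<open>auto intro!: continuous_intros\<close>)
  have i: "(\<lambda>y. k y * v2 b y - v y * k2 b y) integrable_on UNIV" if "b \<in> Basis" for b
    by (rule int) (use that D z in \<open>auto intro!: continuous_intros\<close>)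
  have "integral UNIV (\<lambda>y. k y * (\<Sum>b\<in>Basis. v2 b y)) - integral UNIV (\<lambda>y. v y * (\<Sum>b\<in>Basis. k2 b y)) =
    integral UNIV (\<lambda>y. k y * (\<Sum>b\<in>Basis. v2 b y) - v y * (\<Sum>b\<in>Basis. k2 b y))"
    by (intro integral_diff[symmetric] int) (use D z in \<open>auto intro!: continuous_intros\<close>)
  also have "\<dots> = integral UNIV (\<lambda>y. \<Sum>b\<in>Basis. k y * v2 b y - v y * k2 b y)"
    by (simp add: sum_distrib_left sum_subtractf)
  also have "\<dots> = 0" using i eq0 by (simp add: integral_sum)
  finally show ?thesis by simp
qed

section \<open>The outgoing kernel and its representation formula\<close>

text \<open>Up to the factor 4 pi, the outgoing fundamental solution of minus the Laplacian minus
  the square of \<kappa>.\<close>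

definition out_wave :: "real \<Rightarrow> 'a::real_normed_vector \<Rightarrow> complex" where
  "out_wave \<kappa> z = exp (\<i> * of_real \<kappa> * of_real (norm z)) / of_real (norm z)"

text \<open>The kernel as a function of s = |z|^2; \<open>wave1\<close> and \<open>wave2\<close> are
  its first two derivatives in s.\<close>

definition wave0 :: "real \<Rightarrow> real \<Rightarrow> complex" where
  "wave0 \<kappa> s = exp (\<i> * of_real \<kappa> * of_real (sqrt s)) / of_real (sqrt s)"

definition wave1 :: "real \<Rightarrow> real \<Rightarrow> complex" where
  "wave1 \<kappa> s = (\<i> * of_real \<kappa> / of_real (sqrt s) - 1 / of_real (sqrt s) ^ 2) / 2 * wave0 \<kappa> s"

definition wave2 :: "real \<Rightarrow> real \<Rightarrow> complex" where
  "wave2 \<kappa> s = (3 / of_real (sqrt s) ^ 3 - 3 * \<i> * of_real \<kappa> / of_real (sqrt s) ^ 2 - of_real \<kappa> ^ 2 / of_real (sqrt s))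
     / (4 * of_real (sqrt s)) * wave0 \<kappa> s"

lemma out_wave_eq: "out_wave \<kappa> z = wave0 \<kappa> ((norm z)\<^sup>2)"
  by (simp add: out_wave_def wave0_def)

lemma wave0_deriv:
  assumes "s > 0"
  shows "(wave0 \<kappa> has_vector_derivative wave1 \<kappa> s) (at s)"
proof -
  define r :: complex where "r = of_real (sqrt s)"
  have r: "r \<noteq> 0" using assms by (simp add: r_def)
  have 1: "((\<lambda>s. complex_of_real (sqrt s)) has_vector_derivative 1 / (2 * r)) (at s)"
    using assms by (auto intro!: derivative_eq_intros simp: r_def field_simps
      simp flip: has_real_derivative_iff_has_vector_derivative)
  have 2: "((\<lambda>z. exp (\<i> * of_real \<kappa> * z) / z) has_field_derivative
      (\<i> * of_real \<kappa> / r - 1 / r ^ 2) * exp (\<i> * of_real \<kappa> * r) * 1) (at (of_real (sqrt s)))"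
    unfolding r_def[symmetric] using r
    by (auto intro!: derivative_eq_intros simp: field_simps power2_eq_square)
  have "wave1 \<kappa> s = 1 / (2 * r) * ((\<i> * of_real \<kappa> / r - 1 / r ^ 2) * exp (\<i> * of_real \<kappa> * r) * 1)"
    using r by (simp add: wave1_def wave0_def r_def[symmetric] field_simps)
  with field_vector_diff_chain_at[OF 1 2] show ?thesis
    by (simp add: o_def wave0_def[abs_def])
qed

lemma wave1_deriv:
  assumes "s > 0"
  shows "(wave1 \<kappa> has_vector_derivative wave2 \<kappa> s) (at s)"
proof -
  define r :: complex where "r = of_real (sqrt s)"
  have r: "r \<noteq> 0" using assms by (simp add: r_def)
  have 1: "((\<lambda>s. complex_of_real (sqrt s)) has_vector_derivative 1 / (2 * r)) (at s)"
    using assms by (auto intro!: derivative_eq_intros simp: r_def field_simps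
      simp flip: has_real_derivative_iff_has_vector_derivative)
  have 2: "((\<lambda>z. (\<i> * of_real \<kappa> / z - 1 / z ^ 2) / 2) has_field_derivative
      (- \<i> * of_real \<kappa> / r ^ 2 + 2 / r ^ 3) / 2) (at (of_real (sqrt s)))"
    unfolding r_def[symmetric] using r
    by (auto intro!: derivative_eq_intros simp: field_simps power2_eq_square power3_eq_cube)
  have 3: "((\<lambda>s. (\<i> * of_real \<kappa> / of_real (sqrt s) - 1 / of_real (sqrt s) ^ 2) / 2) has_vector_derivative
     1 / (2 * r) * ((- \<i> * of_real \<kappa> / r ^ 2 + 2 / r ^ 3) / 2)) (at s)"
    using field_vector_diff_chain_at[OF 1 2] by (simp add: o_def)
  have "wave2 \<kappa> s = (\<i> * of_real \<kappa> / of_real (sqrt s) - 1 / of_real (sqrt s) ^ 2) / 2 * wave1 \<kappa> s +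
      1 / (2 * r) * ((- \<i> * of_real \<kappa> / r ^ 2 + 2 / r ^ 3) / 2) * wave0 \<kappa> s"
    unfolding wave1_def wave2_def r_def[symmetric] using r
    by (simp add: divide_simps power2_eq_square power3_eq_cube) (simp add: algebra_simps)
  with has_vector_derivative_mult[OF 3 wave0_deriv[OF assms, of \<kappa>]] show ?thesis
    by (simp add: wave1_def[abs_def])
qed

lemma continuous_on_wave2: "continuous_on {0<..} (wave2 \<kappa>)"
  unfolding wave2_def[abs_def] wave0_def by (auto intro!: continuous_intros)

text \<open>In dimension three the Laplacian of a function h of the squared distance s is 4 s h'' +
  6 h', so this is the Helmholtz equation for the kernel away from its singularity.\<close>

lemma wave_helmholtz:
  assumes "s > 0"
  shows "4 * of_real s * wave2 \<kappa> s + 6 * wave1 \<kappa> s + of_real \<kappa> ^ 2 * wave0 \<kappa> s = 0"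
proof -
  define r :: complex where "r = of_real (sqrt s)"
  have r: "r \<noteq> 0" "of_real s = r ^ 2"
    using assms by (auto simp: r_def simp flip: of_real_power)
  show ?thesis
    unfolding wave1_def wave2_def r_def[symmetric] r(2) using r(1)
    by (simp add: divide_simps power2_eq_square power3_eq_cube) (simp add: algebra_simps)
qed

section \<open>Regularising the kernel near its singularity\<close>

lemma has_vector_derivative_If_ge:
  fixes f g :: "real \<Rightarrow> 'a::real_normed_vector"
  assumes "x \<ge> a \<Longrightarrow> (f has_vector_derivative f' x) (at x)"
    and "x \<le> a \<Longrightarrow> (g has_vector_derivative g' x) (at x)"
    and "f a = g a" "f' a = g' a"
  shows "((\<lambda>s. if a \<le> s then f s else g s) has_vector_derivative (if a \<le> x then f' x else g' x)) (at x)"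
proof -
  have "((\<lambda>s. if s \<in> {a..} then f s else g s) has_vector_derivative (if x \<in> {a..} then f' x else g' x))
     (at x within UNIV)"
    by (rule has_vector_derivative_If_within_closures[where T = "{..<a}"])
      (use assms in \<open>auto intro: has_vector_derivative_at_within\<close>)
  then show ?thesis by simp
qed

text \<open>Continuing \<open>wave0\<close> below \<open>e\<^sup>2\<close> by its second Taylor polynomial keeps the radial kernel \<open>C\<^sup>2\<close>.\<close>

definition reg0 :: "real \<Rightarrow> real \<Rightarrow> real \<Rightarrow> complex" where
  "reg0 \<kappa> e s = (if e\<^sup>2 \<le> s then wave0 \<kappa> s else wave0 \<kappa> (e\<^sup>2) + wave1 \<kappa> (e\<^sup>2) * of_real (s - e\<^sup>2)
     + wave2 \<kappa> (e\<^sup>2) / 2 * of_real (s - e\<^sup>2) ^ 2)"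

definition reg1 :: "real \<Rightarrow> real \<Rightarrow> real \<Rightarrow> complex" where
  "reg1 \<kappa> e s = (if e\<^sup>2 \<le> s then wave1 \<kappa> s else wave1 \<kappa> (e\<^sup>2) + wave2 \<kappa> (e\<^sup>2) * of_real (s - e\<^sup>2))"

definition reg2 :: "real \<Rightarrow> real \<Rightarrow> real \<Rightarrow> complex" where
  "reg2 \<kappa> e s = (if e\<^sup>2 \<le> s then wave2 \<kappa> s else wave2 \<kappa> (e\<^sup>2))"

lemma reg_deriv:
  assumes "e > 0"
  shows "(reg0 \<kappa> e has_vector_derivative reg1 \<kappa> e s) (at s)"
    and "(reg1 \<kappa> e has_vector_derivative reg2 \<kappa> e s) (at s)"
    and "continuous_on UNIV (reg2 \<kappa> e)"
proof -
  have pos: "s > 0" if "e\<^sup>2 \<le> s" for s using that assms by (meson order_less_le_trans zero_less_power)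
  have poly: "((\<lambda>s. A + B * of_real (s - c) + D / 2 * of_real (s - c) ^ 2) has_vector_derivative
      B + D * of_real (s - c)) (at s)" for A B D :: complex and c s :: real
    unfolding of_real_diff
    by (rule has_vector_derivative_real_field[where f = "\<lambda>z. A + B * (z - of_real c) + D / 2 * (z - of_real c) ^ 2"])
      (auto intro!: derivative_eq_intros)
  show "(reg0 \<kappa> e has_vector_derivative reg1 \<kappa> e s) (at s)"
    unfolding reg0_def[abs_def] reg1_def
    by (rule has_vector_derivative_If_ge)
      (use pos poly[of "wave0 \<kappa> (e\<^sup>2)" "wave1 \<kappa> (e\<^sup>2)" "e\<^sup>2" "wave2 \<kappa> (e\<^sup>2)" s] wave0_deriv in auto)
  show "(reg1 \<kappa> e has_vector_derivative reg2 \<kappa> e s) (at s)"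
    unfolding reg1_def[abs_def] reg2_def
    by (rule has_vector_derivative_If_ge)
      (use pos poly[of "wave1 \<kappa> (e\<^sup>2)" "wave2 \<kappa> (e\<^sup>2)" "e\<^sup>2" 0 s] wave1_deriv in auto)
  have "reg2 \<kappa> e = (\<lambda>s. wave2 \<kappa> (max (e\<^sup>2) s))" by (auto simp: reg2_def[abs_def] max_def)
  then show "continuous_on UNIV (reg2 \<kappa> e)"
    using pos by (auto intro!: continuous_on_compose2[OF continuous_on_wave2] continuous_intros)
qed

text \<open>At s = e^2 the defect is zero by \<open>wave_helmholtz\<close>, so the polynomial below
  e^2 has the factor s - e^2; the 10 is the 4 of the factor 4 s plus the 6. The \<open>min\<close>
  makes the defect zero above e^2, where the kernel is unchanged.\<close>

lemma reg_helmholtz: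
  assumes "e > 0"
  shows "4 * of_real s * reg2 \<kappa> e s + 6 * reg1 \<kappa> e s + of_real \<kappa> ^ 2 * reg0 \<kappa> e s =
    of_real (min 0 (s - e\<^sup>2)) * (10 * wave2 \<kappa> (e\<^sup>2) + of_real \<kappa> ^ 2 * wave1 \<kappa> (e\<^sup>2)
      + of_real \<kappa> ^ 2 * wave2 \<kappa> (e\<^sup>2) / 2 * of_real (min 0 (s - e\<^sup>2)))"
proof (cases "e\<^sup>2 \<le> s")
  case True
  then have "s > 0" using assms by (meson order_less_le_trans zero_less_power)
  then show ?thesis using wave_helmholtz True by (simp add: reg0_def reg1_def reg2_def)
next
  case False
  have "4 * of_real (e\<^sup>2) * wave2 \<kappa> (e\<^sup>2) + 6 * wave1 \<kappa> (e\<^sup>2) + of_real \<kappa> ^ 2 * wave0 \<kappa> (e\<^sup>2) = 0"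
    using assms by (intro wave_helmholtz) auto
  then have h: "of_real \<kappa> ^ 2 * wave0 \<kappa> (e\<^sup>2) = - 4 * of_real (e\<^sup>2) * wave2 \<kappa> (e\<^sup>2) - 6 * wave1 \<kappa> (e\<^sup>2)"
    by algebra
  have m: "min 0 (s - e\<^sup>2) = s - e\<^sup>2" using False by simp
  show ?thesis unfolding m using False
    by (simp add: reg0_def reg1_def reg2_def distrib_left h del: of_real_power)
      (simp add: algebra_simps power2_eq_square)
qed

lemma radial_laplacian:
  fixes x y :: "real^3" and p q :: complex
  shows "(\<Sum>b\<in>Basis. p * of_real ((2 * ((y - x) \<bullet> b))\<^sup>2) + 2 * q) = 4 * of_real ((norm (y - x))\<^sup>2) * p + 6 * q"
proof -
  have n: "(norm (y - x))\<^sup>2 = (\<Sum>b\<in>Basis. ((y - x) \<bullet> b)\<^sup>2)"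
    unfolding power2_norm_eq_inner by (subst euclidean_inner) (simp add: power2_eq_square)
  show ?thesis
    unfolding n by (simp add: sum.distrib power_mult_distrib sum_distrib_left sum_distrib_right mult_ac)
qed

text \<open>
  The Helmholtz operator applied to the regularised kernel is concentrated in a ball of radius \<open>e\<close>;
  rescaled to the unit ball, it tends to \<open>-(15/2) (1 - |w|\<^sup>2)\<close> as \<open>e\<close> tends to \<open>0\<close>. Only the fact
  that its mass is nonzero matters (the value is \<open>-4\<pi>\<close>).
\<close>

definition bump_mass :: complex where
  "bump_mass = integral (cbox (- One) (One::real^3)) (\<lambda>w. of_real (min 0 ((norm w)\<^sup>2 - 1)) * (15/2))"

text \<open>A continuous nonnegative function with integral zero vanishes identically, whereas this
  one equals 1 at the origin.\<close>

lemma bump_mass_nonzero: "bump_mass \<noteq> 0"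
proof -
  let ?f = "\<lambda>w::real^3. max 0 (1 - (norm w)\<^sup>2)"
  have c: "continuous_on (cbox (- One) (One::real^3)) ?f" by (intro continuous_intros)
  have ne: "box (- One) (One::real^3) \<noteq> {}" by (auto simp: box_ne_empty)
  have nz: "integral (cbox (- One) One) ?f \<noteq> 0"
    using integral_cbox_eq_0_iff[OF c ne] by (auto simp: mem_box intro!: bexI[of _ 0])
  have "((\<lambda>w. of_real (- ?f w * (15/2))) has_integral
      complex_of_real (- integral (cbox (- One) One) ?f * (15/2))) (cbox (- One) One)"
    by (intro has_integral_of_real has_integral_mult_left has_integral_neg integrable_integral
        integrable_continuous c)
  also have "(\<lambda>w. complex_of_real (- ?f w * (15/2))) = (\<lambda>w. of_real (min 0 ((norm w)\<^sup>2 - 1)) * (15/2))"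
  proof
    fix w :: "real^3"
    have "- ?f w = min 0 ((norm w)\<^sup>2 - 1)" by (simp add: max_def min_def)
    then show "complex_of_real (- ?f w * (15/2)) = of_real (min 0 ((norm w)\<^sup>2 - 1)) * (15/2)"
      by (metis of_real_divide of_real_mult of_real_numeral)
  qed
  finally have eq: "bump_mass = complex_of_real (- integral (cbox (- One) One) ?f * (15/2))"
    unfolding bump_mass_def by (rule integral_unique)
  show ?thesis unfolding eq of_real_eq_0_iff using nz by simp
qed

text \<open>The source vanishes on \<open>ball x a\<close>, so for every e < a the kernel may be
  exchanged for its regularisation there without changing the integral. Green's identity moves the
  Helmholtz operator onto the regularised kernel, where only a defect in the ball of radius e
  survives. After rescaling, the integral is independent of e, and its limit as e tends to 0 can be
  read off.\<close>

lemma representation: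
  fixes v :: "real^3 \<Rightarrow> complex"
  assumes S: "open S" "compact K" "K \<subseteq> S"
    and v: "C2_data S v v1 v2"
    and z: "\<And>y. y \<notin> K \<Longrightarrow> v y = 0" "\<And>b y. y \<notin> K \<Longrightarrow> v1 b y = 0" "\<And>b y. y \<notin> K \<Longrightarrow> v2 b y = 0"
    and a: "a > 0" and f: "\<And>y. y \<in> ball x a \<Longrightarrow> (\<Sum>b\<in>Basis. v2 b y) + of_real \<kappa> ^ 2 * v y = 0"
  shows "integral UNIV (\<lambda>y. out_wave \<kappa> (y - x) * ((\<Sum>b\<in>Basis. v2 b y) + of_real \<kappa> ^ 2 * v y)) =
    bump_mass * v x"
proof -
  define J where "J = integral UNIV (\<lambda>y. out_wave \<kappa> (y - x) * ((\<Sum>b\<in>Basis. v2 b y) + of_real \<kappa> ^ 2 * v y))"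
  define E where "E e = exp (\<i> * of_real \<kappa> * of_real e)" for e
  \<comment> \<open>\<open>q e\<close> is e^3, the Jacobian of the rescaling, times the defect of
    \<open>reg_helmholtz\<close> at distance e |w|. The defect brings another factor e^2, and e^5
    absorbs the poles of \<open>wave1\<close> and \<open>wave2\<close>, so \<open>q\<close> is
    continuous down to e = 0, where its coefficient is 10 * 3/4 = 15/2.\<close>
  define q where "q e w = of_real (min 0 ((norm w)\<^sup>2 - 1)) * (10 * ((3 - 3 * \<i> * of_real \<kappa> * of_real e - of_real (\<kappa>\<^sup>2 * e\<^sup>2)) / 4 * E e)
      + of_real (\<kappa>\<^sup>2) * ((\<i> * of_real \<kappa> * of_real e - 1) * of_real (e\<^sup>2) / 2 * E e)
      + of_real (\<kappa>\<^sup>2 * e\<^sup>2) * ((3 - 3 * \<i> * of_real \<kappa> * of_real e - of_real (\<kappa>\<^sup>2 * e\<^sup>2)) / 4 * E e) / 2 * of_real (min 0 ((norm w)\<^sup>2 - 1)))"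
    for e and w :: "real^3"
  have scale2: "of_real (e ^ 5) * wave2 \<kappa> (e\<^sup>2) =
      (3 - 3 * \<i> * of_real \<kappa> * of_real e - of_real (\<kappa>\<^sup>2 * e\<^sup>2)) / 4 * E e"
    and scale1: "of_real (e ^ 5) * wave1 \<kappa> (e\<^sup>2) = (\<i> * of_real \<kappa> * of_real e - 1) * of_real (e\<^sup>2) / 2 * E e"
    if "e > 0" for e
    using that unfolding wave2_def wave1_def wave0_def
    by (simp_all add: E_def[symmetric] divide_simps) (simp_all add: algebra_simps eval_nat_numeral)
  have cv: "continuous_on UNIV v"
    using continuous_on_UNIV_compact_support[OF S C2_dataD(1)[OF v] z(1)] .
  have J: "J = integral (cbox (- One) One) (\<lambda>w. v (e *\<^sub>R w + x) * q e w)" if e: "0 < e" "e < a" for e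
  proof -
    let ?r = "\<lambda>y. (norm (y - x))\<^sup>2"
    define \<rho> where "\<rho> s = of_real (min 0 (s - e\<^sup>2)) * (10 * wave2 \<kappa> (e\<^sup>2) + of_real \<kappa> ^ 2 * wave1 \<kappa> (e\<^sup>2)
      + of_real \<kappa> ^ 2 * wave2 \<kappa> (e\<^sup>2) / 2 * of_real (min 0 (s - e\<^sup>2)))" for s
    have k: "C2_data S (\<lambda>y. reg0 \<kappa> e (?r y))
      (\<lambda>b y. reg1 \<kappa> e (?r y) * of_real (2 * ((y - x) \<bullet> b)))
      (\<lambda>b y. reg2 \<kappa> e (?r y) * of_real ((2 * ((y - x) \<bullet> b))\<^sup>2) + 2 * reg1 \<kappa> e (?r y))"
      by (rule C2_data_radial[where T = UNIV]) (use reg_deriv e in auto)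
    have "continuous_on UNIV (reg1 \<kappa> e)"
      by (rule continuous_at_imp_continuous_on)
        (use reg_deriv(2)[OF e(1)] has_vector_derivative_continuous in blast)
    then have kc12: "continuous_on S (\<lambda>y. reg1 \<kappa> e (?r y))" "continuous_on S (\<lambda>y. reg2 \<kappa> e (?r y))"
      using reg_deriv(3)[OF e(1)]
      by (auto intro!: continuous_on_compose2[where f = ?r and t = UNIV] continuous_intros)
    note kc = C2_dataD(1)[OF k] and vc = C2_dataD[OF v]
    note int = compact_support_integrable[OF continuous_on_UNIV_compact_support[OF S] compact_imp_bounded[OF S(2)]]
    have green: "integral UNIV (\<lambda>y. reg0 \<kappa> e (?r y) * (\<Sum>b\<in>Basis. v2 b y)) = integral UNIV (\<lambda>y. v y *
        (\<Sum>b\<in>Basis. reg2 \<kappa> e (?r y) * of_real ((2 * ((y - x) \<bullet> b))\<^sup>2) + 2 * reg1 \<kappa> e (?r y)))"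
      by (rule green_identity[OF S v k]) (use z in auto)
    \<comment> \<open>Inside \<open>ball x a\<close> both sides are zero because the source is;
      outside, the distance exceeds e and the two kernels agree.\<close>
    have kf: "out_wave \<kappa> (y - x) * ((\<Sum>b\<in>Basis. v2 b y) + of_real \<kappa> ^ 2 * v y)
       = reg0 \<kappa> e (?r y) * ((\<Sum>b\<in>Basis. v2 b y) + of_real \<kappa> ^ 2 * v y)" for y
    proof (cases "y \<in> ball x a")
      case True
      then show ?thesis using f by simp
    next
      case False
      then have "e \<le> norm (y - x)" using e by (simp add: dist_norm norm_minus_commute)
      then have "e\<^sup>2 \<le> ?r y" using e by (intro power_mono) auto
      then show ?thesis by (simp add: reg0_def out_wave_eq)
    qed
    have "J = integral UNIV (\<lambda>y. reg0 \<kappa> e (?r y) * (\<Sum>b\<in>Basis. v2 b y) + reg0 \<kappa> e (?r y) * (of_real \<kappa> ^ 2 * v y))"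
      unfolding J_def kf by (simp add: distrib_left)
    also have "\<dots> = integral UNIV (\<lambda>y. reg0 \<kappa> e (?r y) * (\<Sum>b\<in>Basis. v2 b y)) +
        integral UNIV (\<lambda>y. reg0 \<kappa> e (?r y) * (of_real \<kappa> ^ 2 * v y))"
      by (intro integral_add int) (use kc vc z in \<open>auto intro!: continuous_intros\<close>)
    also have "integral UNIV (\<lambda>y. reg0 \<kappa> e (?r y) * (\<Sum>b\<in>Basis. v2 b y)) =
      integral UNIV (\<lambda>y. v y * (4 * of_real (?r y) * reg2 \<kappa> e (?r y) + 6 * reg1 \<kappa> e (?r y)))"
      using green by (simp only: radial_laplacian)
    also have "\<dots> + integral UNIV (\<lambda>y. reg0 \<kappa> e (?r y) * (of_real \<kappa> ^ 2 * v y)) =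
      integral UNIV (\<lambda>y. v y * (4 * of_real (?r y) * reg2 \<kappa> e (?r y) + 6 * reg1 \<kappa> e (?r y)) +
         reg0 \<kappa> e (?r y) * (of_real \<kappa> ^ 2 * v y))"
      by (intro integral_add[symmetric] int) (use kc vc z kc12 in \<open>auto intro!: continuous_intros\<close>)
    also have "\<dots> = integral UNIV (\<lambda>y. v y * \<rho> (?r y))"
      unfolding \<rho>_def reg_helmholtz[OF e(1), symmetric] by (simp add: algebra_simps)
    finally have 1: "J = integral UNIV (\<lambda>y. v y * \<rho> (?r y))" .
    have "integral UNIV (\<lambda>w. v (e *\<^sub>R w + x) * \<rho> (?r (e *\<^sub>R w + x))) =
      integral UNIV (\<lambda>y. v y * \<rho> (?r y)) /\<^sub>R \<bar>e\<bar> ^ DIM(real^3)"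
      by (rule integral_UNIV_affine[where K = K])
       (use z S e cv in \<open>auto simp: compact_imp_bounded \<rho>_def intro!: continuous_intros\<close>)
    then have "J = of_real (e ^ 3) * integral UNIV (\<lambda>w. v (e *\<^sub>R w + x) * \<rho> (?r (e *\<^sub>R w + x)))"
      using e by (simp add: 1 scaleR_conv_of_real)
    also have "\<dots> = integral UNIV (\<lambda>w. of_real (e ^ 3) * (v (e *\<^sub>R w + x) * \<rho> (?r (e *\<^sub>R w + x))))"
      by simp
    also have "(\<lambda>w. of_real (e ^ 3) * (v (e *\<^sub>R w + x) * \<rho> (?r (e *\<^sub>R w + x)))) = (\<lambda>w. v (e *\<^sub>R w + x) * q e w)"
    proof
      fix w :: "real^3"
      define u where "u = min 0 ((norm w)\<^sup>2 - 1)"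
      have u: "min 0 (?r (e *\<^sub>R w + x) - e\<^sup>2) = e\<^sup>2 * u"
        using e by (simp add: u_def min_def power_mult_distrib mult_le_0_iff algebra_simps)
      have "of_real (e ^ 3) * \<rho> (?r (e *\<^sub>R w + x)) = q e w"
        unfolding \<rho>_def u q_def u_def[symmetric] scale1[OF e(1), symmetric] scale2[OF e(1), symmetric]
        by (simp add: algebra_simps eval_nat_numeral)
      then show "of_real (e ^ 3) * (v (e *\<^sub>R w + x) * \<rho> (?r (e *\<^sub>R w + x))) = v (e *\<^sub>R w + x) * q e w"
        by (metis mult.left_commute)
    qed
    also have "integral UNIV (\<lambda>w. v (e *\<^sub>R w + x) * q e w) = integral (cbox (- One) One) (\<lambda>w. v (e *\<^sub>R w + x) * q e w)"
    proof (rule integral_UNIV_support)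
      fix w :: "real^3" assume "w \<notin> cbox (- One) One"
      then obtain b :: "real^3" where b: "b \<in> Basis" "\<bar>w \<bullet> b\<bar> > 1"
        by (fastforce simp: mem_box)
      then have "1 \<le> norm w" using Basis_le_norm[OF b(1), of w] by linarith
      then show "v (e *\<^sub>R w + x) * q e w = 0" by (simp add: q_def)
    qed
    finally show ?thesis .
  qed
  have cont: "continuous_on {0..a/2} (\<lambda>e. integral (cbox (- One) One) (\<lambda>w. v (e *\<^sub>R w + x) * q e w))"
  proof (rule integral_continuous_on_param)
    have 1: "continuous_on ({0..a/2} \<times> cbox (- One) One) (\<lambda>p. v (fst p *\<^sub>R snd p + x))"
      by (rule continuous_on_compose2[OF cv]) (auto intro!: continuous_intros)
    have 2: "continuous_on ({0..a/2} \<times> cbox (- One) One) (\<lambda>p. q (fst p) (snd p))"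
      unfolding q_def E_def by (intro continuous_intros) simp_all
    show "continuous_on ({0..a/2} \<times> cbox (- One) One) (\<lambda>(e, w). v (e *\<^sub>R w + x) * q e w)"
      unfolding split_def by (intro continuous_on_mult 1 2)
  qed
  have "J = integral (cbox (- One) One) (\<lambda>w. v (0 *\<^sub>R w + x) * q 0 w)"
  \<comment> \<open>The integral equals J for all small positive e and is continuous up to e = 0, so
    its value at 0 is J as well.\<close>
  proof (rule continuous_constant_on_closure[OF _ _, where S = "{0<..<a/2}" and x = 0, symmetric])
    show "continuous_on (closure {0<..<a/2}) (\<lambda>e. integral (cbox (- One) One) (\<lambda>w. v (e *\<^sub>R w + x) * q e w))"
      using cont a by simp
  qed (use a in \<open>auto simp: J\<close>)
  also have "\<dots> = v x * bump_mass"
    unfolding bump_mass_def q_def E_def by simp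
  finally show ?thesis by (simp add: J_def mult.commute)
qed

section \<open>Cutoff functions\<close>

lemma max_0_power_deriv:
  "((\<lambda>u::real. max 0 u ^ Suc (Suc n)) has_real_derivative real (Suc (Suc n)) * max 0 u ^ Suc n) (at u)"
proof -
  have "((\<lambda>u::real. if 0 \<le> u then u ^ Suc (Suc n) else 0) has_vector_derivative
     (if 0 \<le> u then real (Suc (Suc n)) * u ^ Suc n else 0)) (at u)"
    by (rule has_vector_derivative_If_ge)
      (auto intro!: derivative_eq_intros simp del: power_Suc simp flip: has_real_derivative_iff_has_vector_derivative)
  moreover have "(\<lambda>u::real. if 0 \<le> u then u ^ Suc (Suc n) else 0) = (\<lambda>u. max 0 u ^ Suc (Suc n))"
    by (auto simp: max_def)
  moreover have "(if 0 \<le> u then real (Suc (Suc n)) * u ^ Suc n else 0) = real (Suc (Suc n)) * max 0 u ^ Suc n"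
    by (auto simp: max_def)
  ultimately show ?thesis by (simp only: has_real_derivative_iff_has_vector_derivative)
qed

text \<open>A cutoff in the squared radius, equal to 1 up to s = 1 and to 0 from s = 2 on. Cubes of
  positive parts are just smooth enough for two continuous derivatives, which \<open>cut1\<close>
  and \<open>cut2\<close> give in closed form.\<close>

definition cut0 :: "real \<Rightarrow> real" where
  "cut0 s = max 0 (1 - max 0 (s - 1) ^ 3) ^ 3"

definition cut1 :: "real \<Rightarrow> real" where
  "cut1 s = - 9 * (max 0 (1 - max 0 (s - 1) ^ 3) ^ 2 * max 0 (s - 1) ^ 2)"

definition cut2 :: "real \<Rightarrow> real" where
  "cut2 s = 54 * (max 0 (1 - max 0 (s - 1) ^ 3) * max 0 (s - 1) ^ 4)
     - 18 * (max 0 (1 - max 0 (s - 1) ^ 3) ^ 2 * max 0 (s - 1))"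

lemma cut_deriv:
  "(cut0 has_real_derivative cut1 s) (at s)" "(cut1 has_real_derivative cut2 s) (at s)"
  "continuous_on A cut2"
proof -
  have sq: "((\<lambda>u::real. max 0 u ^ 2) has_real_derivative 2 * max 0 u) (at u)"
    and cube: "((\<lambda>u::real. max 0 u ^ 3) has_real_derivative 3 * max 0 u ^ 2) (at u)" for u
    using max_0_power_deriv[of 0 u] max_0_power_deriv[of 1 u] by (simp_all add: eval_nat_numeral)
  have s1: "((\<lambda>s. s - 1) has_real_derivative 1) (at s)"
    by (auto intro!: derivative_eq_intros)
  have i: "((\<lambda>s. 1 - max 0 (s - 1) ^ 3) has_real_derivative - 3 * max 0 (s - 1) ^ 2) (at s)"
    using DERIV_diff[OF DERIV_const[of 1] DERIV_chain2[OF cube s1]] by simp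
  have j: "((\<lambda>s. max 0 (s - 1) ^ 2) has_real_derivative 2 * max 0 (s - 1)) (at s)"
    using DERIV_chain2[OF sq s1] by simp
  have k: "((\<lambda>s. max 0 (1 - max 0 (s - 1) ^ 3) ^ 2) has_real_derivative
     (2 * max 0 (1 - max 0 (s - 1) ^ 3)) * (- 3 * max 0 (s - 1) ^ 2)) (at s)"
    by (rule DERIV_chain2[OF sq i])
  have "((\<lambda>s. max 0 (1 - max 0 (s - 1) ^ 3) ^ 3) has_real_derivative
     (3 * max 0 (1 - max 0 (s - 1) ^ 3) ^ 2) * (- 3 * max 0 (s - 1) ^ 2)) (at s)"
    by (rule DERIV_chain2[OF cube i])
  then show "(cut0 has_real_derivative cut1 s) (at s)"
    by (simp add: cut0_def[abs_def] cut1_def)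
  from DERIV_cmult[OF DERIV_mult[OF k j], of "- 9"]
  show "(cut1 has_real_derivative cut2 s) (at s)"
    unfolding cut1_def[abs_def] cut2_def by (rule DERIV_cong) (simp add: algebra_simps eval_nat_numeral)
  show "continuous_on A cut2" unfolding cut2_def by (intro continuous_intros)
qed

lemma cut_le_1: "s \<le> 1 \<Longrightarrow> cut0 s = 1" "s \<le> 1 \<Longrightarrow> cut1 s = 0" "s \<le> 1 \<Longrightarrow> cut2 s = 0"
  by (simp_all add: cut0_def cut1_def cut2_def)

lemma cut_ge_2:
  assumes "s \<ge> 2"
  shows "cut0 s = 0" "cut1 s = 0" "cut2 s = 0"
proof -
  have "1 \<le> max 0 (s - 1) ^ 3" using assms by (intro one_le_power) simp
  then have *: "max 0 (1 - max 0 (s - 1) ^ 3) = 0" by simp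
  show "cut0 s = 0" "cut1 s = 0" "cut2 s = 0"
    unfolding cut0_def cut1_def cut2_def * by simp_all
qed

text \<open>Below s = 2 every positive part occurring here lies in [0, 1], so the coefficients
  decide: 54 + 18 = 72 for \<open>cut2\<close>, and 9 for \<open>cut1\<close>.\<close>

lemma cut_bound: "\<bar>cut1 s\<bar> \<le> 72" "\<bar>cut2 s\<bar> \<le> 72"
proof -
  have "\<bar>cut1 s\<bar> \<le> 72 \<and> \<bar>cut2 s\<bar> \<le> 72"
  proof (cases "s \<ge> 2")
    case True
    then show ?thesis by (simp add: cut_ge_2)
  next
    case False
    define a b where "a = max 0 (s - 1)" and "b = max 0 (1 - a ^ 3)"
    have a: "0 \<le> a" "a \<le> 1" and b: "0 \<le> b" "b \<le> 1" using False by (auto simp: a_def b_def)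
    have p: "0 \<le> b ^ m * a ^ n \<and> b ^ m * a ^ n \<le> 1" for m n
      using a b by (simp add: mult_le_one power_le_one)
    show ?thesis
      using p[of 2 2] p[of 1 4] p[of 2 1] unfolding cut1_def cut2_def a_def[symmetric] b_def[symmetric]
      by (auto simp: abs_le_iff mult.commute)
  qed
  then show "\<bar>cut1 s\<bar> \<le> 72" "\<bar>cut2 s\<bar> \<le> 72" by auto
qed

text \<open>The transition takes place between the radii r and sqrt 2 * r about x. Below,
  \<open>cutoff1\<close> and \<open>cutoff2\<close> are derivatives in the squared distance, while
  \<open>cutoff_d1\<close> and \<open>cutoff_d2\<close> are derivatives in a coordinate
  direction.\<close>

definition cutoff :: "real^3 \<Rightarrow> real \<Rightarrow> real^3 \<Rightarrow> complex" where
  "cutoff x r y = of_real (cut0 ((norm (y - x))\<^sup>2 / r\<^sup>2))"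

definition cutoff1 :: "real \<Rightarrow> real \<Rightarrow> real" where
  "cutoff1 r s = cut1 (s / r\<^sup>2) / r\<^sup>2"

definition cutoff2 :: "real \<Rightarrow> real \<Rightarrow> real" where
  "cutoff2 r s = cut2 (s / r\<^sup>2) / r ^ 4"

lemma cutoff_scaled_deriv:
  assumes "r > 0"
  shows "((\<lambda>s. cut0 (s / r\<^sup>2)) has_real_derivative cutoff1 r s) (at s)"
    and "(cutoff1 r has_real_derivative cutoff2 r s) (at s)"
    and "continuous_on A (cutoff2 r)"
proof -
  have d: "((\<lambda>s. s / r\<^sup>2) has_real_derivative 1 / r\<^sup>2) (at s)"
    by (rule DERIV_cdivide[OF DERIV_ident])
  show "((\<lambda>s. cut0 (s / r\<^sup>2)) has_real_derivative cutoff1 r s) (at s)"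
    using DERIV_chain2[OF cut_deriv(1) d] by (simp add: cutoff1_def)
  show "(cutoff1 r has_real_derivative cutoff2 r s) (at s)"
    using DERIV_cdivide[OF DERIV_chain2[OF cut_deriv(2) d], of "r\<^sup>2"]
    by (simp add: cutoff2_def cutoff1_def[abs_def] eval_nat_numeral mult.assoc)
  show "continuous_on A (cutoff2 r)"
    unfolding cutoff2_def[abs_def] using assms
    by (intro continuous_intros continuous_on_compose2[OF cut_deriv(3)]) auto
qed

definition cutoff_d1 :: "real^3 \<Rightarrow> real \<Rightarrow> real^3 \<Rightarrow> real^3 \<Rightarrow> complex" where
  "cutoff_d1 x r b y = of_real (cutoff1 r ((norm (y - x))\<^sup>2)) * of_real (2 * ((y - x) \<bullet> b))"

definition cutoff_d2 :: "real^3 \<Rightarrow> real \<Rightarrow> real^3 \<Rightarrow> real^3 \<Rightarrow> complex" where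
  "cutoff_d2 x r b y = of_real (cutoff2 r ((norm (y - x))\<^sup>2)) * of_real ((2 * ((y - x) \<bullet> b))\<^sup>2)
     + 2 * of_real (cutoff1 r ((norm (y - x))\<^sup>2))"

lemma C2_data_cutoff:
  assumes "r > 0"
  shows "C2_data S (cutoff x r) (cutoff_d1 x r) (cutoff_d2 x r)"
  unfolding cutoff_def[abs_def] cutoff_d1_def[abs_def] cutoff_d2_def[abs_def]
proof (rule C2_data_radial[where T = UNIV])
  show "((\<lambda>s. complex_of_real (cut0 (s / r\<^sup>2))) has_vector_derivative of_real (cutoff1 r s)) (at s)" for s
    using cutoff_scaled_deriv(1)[OF assms]
    by (intro has_vector_derivative_of_real) (simp add: has_real_derivative_iff_has_vector_derivative)
  show "((\<lambda>s. complex_of_real (cutoff1 r s)) has_vector_derivative of_real (cutoff2 r s)) (at s)" for s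
    using cutoff_scaled_deriv(2)[OF assms]
    by (intro has_vector_derivative_of_real) (simp add: has_real_derivative_iff_has_vector_derivative)
qed (use cutoff_scaled_deriv(3)[OF assms] in \<open>auto intro!: continuous_intros\<close>)

lemma cutoff_inside:
  assumes "r > 0" "norm (y - x) \<le> r"
  shows "cutoff x r y = 1" "cutoff_d1 x r b y = 0" "cutoff_d2 x r b y = 0"
proof -
  have "(norm (y - x))\<^sup>2 / r\<^sup>2 \<le> 1" using assms by (simp add: divide_le_eq power_mono)
  then show "cutoff x r y = 1" "cutoff_d1 x r b y = 0" "cutoff_d2 x r b y = 0"
    by (simp_all add: cutoff_def cutoff_d1_def cutoff_d2_def cutoff1_def cutoff2_def cut_le_1)
qed

lemma cutoff_outside:
  assumes "r > 0" "2 * r\<^sup>2 \<le> (norm (y - x))\<^sup>2"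
  shows "cutoff x r y = 0" "cutoff_d1 x r b y = 0" "cutoff_d2 x r b y = 0"
proof -
  have "2 \<le> (norm (y - x))\<^sup>2 / r\<^sup>2" using assms by (simp add: le_divide_eq)
  then show "cutoff x r y = 0" "cutoff_d1 x r b y = 0" "cutoff_d2 x r b y = 0"
    by (simp_all add: cutoff_def cutoff_d1_def cutoff_d2_def cutoff1_def cutoff2_def cut_ge_2)
qed

text \<open>The commutator of the Laplacian with multiplication by the cutoff, applied to \<open>f\<close>.\<close>

definition comm :: "real^3 \<Rightarrow> real \<Rightarrow> (real^3 \<Rightarrow> complex) \<Rightarrow> (real^3 \<Rightarrow> real^3 \<Rightarrow> complex) \<Rightarrow> real^3 \<Rightarrow> complex" where
  "comm x r f f1 y = (\<Sum>b\<in>Basis. cutoff_d2 x r b y * f y + 2 * cutoff_d1 x r b y * f1 b y)"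

lemma comm_eq_0:
  assumes "r > 0" "norm (y - x) \<le> r \<or> 2 * r\<^sup>2 \<le> (norm (y - x))\<^sup>2"
  shows "comm x r f f1 y = 0"
  using assms cutoff_inside cutoff_outside by (auto simp: comm_def)

lemma continuous_on_comm:
  assumes "r > 0" "C2_data S f f1 f2"
  shows "continuous_on S (comm x r f f1)"
  unfolding comm_def using C2_dataD[OF assms(2)] C2_dataD[OF C2_data_cutoff[OF assms(1)]]
  by (auto intro!: continuous_intros)

section \<open>Representation of Helmholtz solutions\<close>

locale helmholtz_solution =
  fixes \<kappa> :: real and W :: "(real^3) set" and \<psi> :: "real^3 \<Rightarrow> complex"
    and p1 p2 :: "real^3 \<Rightarrow> real^3 \<Rightarrow> complex"
  assumes open_W: "open W"
    and data: "C2_data W \<psi> p1 p2"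
    and helmholtz: "\<And>y. y \<in> W \<Longrightarrow> (\<Sum>b\<in>Basis. p2 b y) + of_real \<kappa> ^ 2 * \<psi> y = 0"
begin

text \<open>Since \<psi> solves the equation, applying the Helmholtz operator to the cut-off
  solution leaves exactly the commutator. It vanishes on the ball of radius r about
  \<open>x0\<close>, so \<open>representation\<close> applies on the largest ball about x that this
  one contains.\<close>

lemma local_representation:
  assumes r: "r > 0" and W: "cball x0 (2 * r) \<subseteq> W" and x: "x \<in> ball x0 r"
  shows "bump_mass * \<psi> x = integral UNIV (\<lambda>y. out_wave \<kappa> (y - x) * comm x0 r \<psi> p1 y)"
proof -
  let ?v2 = "\<lambda>b y. cutoff_d2 x0 r b y * \<psi> y + 2 * cutoff_d1 x0 r b y * p1 b y + cutoff x0 r y * p2 b y"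
  have out: "2 * r\<^sup>2 \<le> (norm (y - x0))\<^sup>2" if "y \<notin> cball x0 (2 * r)" for y
  proof -
    have "2 * r \<le> norm (y - x0)" using that by (simp add: dist_norm norm_minus_commute)
    then have "(2 * r)\<^sup>2 \<le> (norm (y - x0))\<^sup>2" using r by (intro power_mono) auto
    moreover have "(2 * r)\<^sup>2 = 4 * r\<^sup>2" by (simp add: power_mult_distrib)
    ultimately show ?thesis using zero_le_power2[of r] by linarith
  qed
  have eq: "(\<Sum>b\<in>Basis. ?v2 b y) + of_real \<kappa> ^ 2 * (cutoff x0 r y * \<psi> y) = comm x0 r \<psi> p1 y" for y
  proof (cases "y \<in> W")
    case True
    have "(\<Sum>b\<in>Basis. ?v2 b y) + of_real \<kappa> ^ 2 * (cutoff x0 r y * \<psi> y) =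
        comm x0 r \<psi> p1 y + cutoff x0 r y * ((\<Sum>b\<in>Basis. p2 b y) + of_real \<kappa> ^ 2 * \<psi> y)"
      by (simp add: comm_def sum.distrib sum_distrib_left algebra_simps)
    then show ?thesis by (simp add: helmholtz[OF True])
  next
    case False
    then have "y \<notin> cball x0 (2 * r)" using W by auto
    then show ?thesis using cutoff_outside[OF r out] by (simp add: comm_def)
  qed
  have "integral UNIV (\<lambda>y. out_wave \<kappa> (y - x) * ((\<Sum>b\<in>Basis. ?v2 b y) + of_real \<kappa> ^ 2 * (cutoff x0 r y * \<psi> y)))
      = bump_mass * (cutoff x0 r x * \<psi> x)"
  proof (rule representation[OF open_W compact_cball W C2_data_mult[OF C2_data_cutoff[OF r] data]])
    show "r - dist x0 x > 0" using x by simp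
    fix y assume y: "y \<in> ball x (r - dist x0 x)"
    have "dist x0 y \<le> r" using dist_triangle[of x0 y x] y by simp
    then show "(\<Sum>b\<in>Basis. ?v2 b y) + of_real \<kappa> ^ 2 * (cutoff x0 r y * \<psi> y) = 0"
      unfolding eq using r by (intro comm_eq_0) (auto simp: dist_norm norm_minus_commute)
  qed (use cutoff_outside[OF r out] in auto)
  moreover have "cutoff x0 r x = 1"
    using x r by (intro cutoff_inside) (auto simp: dist_norm norm_minus_commute)
  ultimately show ?thesis unfolding eq by simp
qed

text \<open>The difference of the cutoffs of radii T and R is 1 where sqrt 2 * R <= |y| <= T and 0
  where |y| <= R, so it removes the unknown interior. Its commutator splits into a fixed inner term
  and an outer term that depends on T.\<close>

lemma annulus_representation:
  assumes R: "R > 0" "2 * R\<^sup>2 \<le> T\<^sup>2" "T > 0" and W: "{y. R \<le> norm y} \<subseteq> W"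
    and x: "2 * R\<^sup>2 < (norm x)\<^sup>2" "norm x < T"
  shows "bump_mass * \<psi> x = integral UNIV (\<lambda>y. out_wave \<kappa> (y - x) * (comm 0 T \<psi> p1 y - comm 0 R \<psi> p1 y))"
proof -
  let ?h = "\<lambda>y. cutoff 0 T y - cutoff 0 R y"
  let ?h1 = "\<lambda>b y. cutoff_d1 0 T b y - cutoff_d1 0 R b y"
  let ?h2 = "\<lambda>b y. cutoff_d2 0 T b y - cutoff_d2 0 R b y"
  let ?v2 = "\<lambda>b y. ?h2 b y * \<psi> y + 2 * ?h1 b y * p1 b y + ?h y * p2 b y"
  let ?K = "{y. R \<le> norm y} \<inter> cball (0::real^3) (2 * T)"
  have h: "C2_data W ?h ?h1 ?h2"
    using C2_dataD[OF C2_data_cutoff[OF R(1)]] C2_dataD[OF C2_data_cutoff[OF R(3)]]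
    unfolding C2_data_def by (auto intro!: continuous_intros has_vector_derivative_diff)
  have "R\<^sup>2 \<le> T\<^sup>2" using R(2) zero_le_power2[of R] by linarith
  then have RT: "R \<le> T" using R(3) by (auto intro: power2_le_imp_le)
  have z: "?h y = 0 \<and> ?h1 b y = 0 \<and> ?h2 b y = 0" if "y \<notin> ?K" for y b
  proof (cases "norm y < R")
    case True
    then show ?thesis using cutoff_inside[of R y 0] cutoff_inside[of T y 0] R RT by auto
  next
    case False
    then have "2 * T \<le> norm y" using that by auto
    then have "(2 * T)\<^sup>2 \<le> (norm y)\<^sup>2" using R by (intro power_mono) auto
    moreover have "(2 * T)\<^sup>2 = 4 * T\<^sup>2" by (simp add: power_mult_distrib)
    ultimately have "2 * T\<^sup>2 \<le> (norm y)\<^sup>2" "2 * R\<^sup>2 \<le> (norm y)\<^sup>2"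
      using zero_le_power2[of T] R(2) by linarith+
    then show ?thesis using cutoff_outside[of R y 0] cutoff_outside[of T y 0] R by auto
  qed
  have eq: "(\<Sum>b\<in>Basis. ?v2 b y) + of_real \<kappa> ^ 2 * (?h y * \<psi> y) = comm 0 T \<psi> p1 y - comm 0 R \<psi> p1 y" for y
  proof (cases "y \<in> W")
    case True
    have "(\<Sum>b\<in>Basis. ?v2 b y) + of_real \<kappa> ^ 2 * (?h y * \<psi> y) =
        comm 0 T \<psi> p1 y - comm 0 R \<psi> p1 y + ?h y * ((\<Sum>b\<in>Basis. p2 b y) + of_real \<kappa> ^ 2 * \<psi> y)"
      by (simp add: comm_def sum.distrib sum_subtractf sum_distrib_left algebra_simps)
    then show ?thesis by (simp add: helmholtz[OF True])
  next
    case False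
    then have "\<not> R \<le> norm y" using W by blast
    then have "norm y \<le> R" "norm y \<le> T" using RT by auto
    then show ?thesis using cutoff_inside[of R y 0] cutoff_inside[of T y 0] R by (simp add: comm_def)
  qed
  have K: "compact ?K"
    by (intro closed_Int_compact closed_Collect_le continuous_intros) auto
  obtain a where a: "a > 0" "ball x a \<subseteq> {y. 2 * R\<^sup>2 < (norm y)\<^sup>2} \<inter> {y. norm y < T}"
  proof -
    have "open ({y::real^3. 2 * R\<^sup>2 < (norm y)\<^sup>2} \<inter> {y. norm y < T})"
      by (intro open_Int open_Collect_less continuous_intros)
    then show ?thesis using that x unfolding open_contains_ball by blast
  qed
  have "integral UNIV (\<lambda>y. out_wave \<kappa> (y - x) * ((\<Sum>b\<in>Basis. ?v2 b y) + of_real \<kappa> ^ 2 * (?h y * \<psi> y)))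
      = bump_mass * (?h x * \<psi> x)"
  proof (rule representation[OF open_W K _ C2_data_mult[OF h data] _ _ _ a(1)])
    show "(\<Sum>b\<in>Basis. ?v2 b y) + of_real \<kappa> ^ 2 * (?h y * \<psi> y) = 0" if "y \<in> ball x a" for y
    proof -
      have "2 * R\<^sup>2 \<le> (norm y)\<^sup>2" "norm y \<le> T" using a(2) that by fastforce+
      then show ?thesis unfolding eq using R by (simp add: comm_eq_0)
    qed
  qed (use z W in auto)
  moreover have "?h x = 1"
    using cutoff_inside(1)[of T x 0] cutoff_outside(1)[of R x 0] x R by simp
  ultimately show ?thesis unfolding eq by simp
qed

end

section \<open>The exterior representation\<close>

lemma vector_derivative_bound:
  fixes f :: "real \<Rightarrow> 'b::real_normed_vector"
  assumes "a \<le> b" "\<And>t. t \<in> {a..b} \<Longrightarrow> (f has_vector_derivative f' t) (at t)"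
    and "\<And>t. t \<in> {a..b} \<Longrightarrow> norm (f' t) \<le> B"
  shows "norm (f b - f a) \<le> B * (b - a)"
proof -
  have "norm (f b - f a) \<le> B * norm (b - a)"
  proof (rule differentiable_bound[where S = "{a..b}" and f' = "\<lambda>t h. h *\<^sub>R f' t"])
    show "onorm (\<lambda>h. h *\<^sub>R f' t) \<le> B" if "t \<in> {a..b}" for t
      by (rule onorm_le) (use assms(3)[OF that] in \<open>simp add: mult.commute[of B] mult_left_mono\<close>)
  qed (use assms in \<open>auto simp: has_vector_derivative_def intro: has_derivative_at_withinI\<close>)
  then show ?thesis using assms(1) by simp
qed

text \<open>The operator y . grad, that is, |y| times the radial derivative; the factor |y| of the
  Sommerfeld condition is absorbed by it, as in the assumption \<open>radiation\<close>
  below.\<close>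

definition euler :: "(real^3 \<Rightarrow> real^3 \<Rightarrow> complex) \<Rightarrow> real^3 \<Rightarrow> complex" where
  "euler f1 y = (\<Sum>b\<in>Basis. of_real (y \<bullet> b) * f1 b y)"

locale radiating_solution = helmholtz_solution +
  fixes R0 :: real
  assumes kappa_pos: "\<kappa> > 0" and R0_pos: "R0 > 0"
    and far: "{y. R0 \<le> norm y} \<subseteq> W"
    and euler: "\<And>y. y \<in> W \<Longrightarrow> ((\<lambda>r. \<psi> (r *\<^sub>R y)) has_vector_derivative euler p1 y) (at 1)"
    and radiation: "\<And>d. d > 0 \<Longrightarrow>
      \<exists>T. \<forall>y. T \<le> norm y \<longrightarrow> norm (euler p1 y - \<i> * of_real \<kappa> * of_real (norm y) * \<psi> y) < d"
begin

lemma euler_ray: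
  assumes "s > 0" "s *\<^sub>R y \<in> W"
  shows "((\<lambda>r. \<psi> (r *\<^sub>R y)) has_vector_derivative euler p1 (s *\<^sub>R y) /\<^sub>R s) (at s)"
proof -
  have d: "((\<lambda>r. r / s) has_vector_derivative 1 / s) (at s)"
    using DERIV_cdivide[OF DERIV_ident] by (simp flip: has_real_derivative_iff_has_vector_derivative)
  have "((\<lambda>r. \<psi> (r *\<^sub>R s *\<^sub>R y)) has_vector_derivative euler p1 (s *\<^sub>R y)) (at (s / s))"
    using euler[OF assms(2)] assms(1) by simp
  from vector_diff_chain_at[OF d this]
  have "((\<lambda>r. \<psi> ((r / s) *\<^sub>R s *\<^sub>R y)) has_vector_derivative (1 / s) *\<^sub>R euler p1 (s *\<^sub>R y)) (at s)"
    by (simp only: o_def)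
  moreover have "(r / s) *\<^sub>R s *\<^sub>R y = r *\<^sub>R y" for r using assms(1) by simp
  ultimately show ?thesis by (simp only: inverse_eq_divide)
qed

text \<open>Along a ray the derivative of exp (- i \<kappa> s) \<psi> (s \<theta>) has modulus 1/s
  times that of the expression in the radiation condition. It is therefore small far out, and
  integrating it from a fixed sphere gives the bound.\<close>

lemma sublinear_growth:
  assumes "d > 0"
  shows "\<exists>T. \<forall>y. T \<le> norm y \<longrightarrow> norm (\<psi> y) \<le> d * norm y"
proof -
  obtain T1 where T1: "\<And>y. T1 \<le> norm y \<Longrightarrow> norm (euler p1 y - \<i> * of_real \<kappa> * of_real (norm y) * \<psi> y) < 1"
    using radiation[of 1] by auto
  \<comment> \<open>The entry \<open>2 / d\<close> makes 1/s at most d/2 along the rest of the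
    ray.\<close>
  define r0 where "r0 = max (max T1 R0) (2 / d)"
  have r0: "r0 > 0" "T1 \<le> r0" "R0 \<le> r0" "1 / r0 \<le> d / 2"
  proof -
    have "2 / d \<le> r0" by (simp add: r0_def)
    moreover show r0: "r0 > 0" "T1 \<le> r0" "R0 \<le> r0" using R0_pos by (auto simp: r0_def)
    ultimately show "1 / r0 \<le> d / 2" using assms by (simp add: field_simps)
  qed
  have "continuous_on (sphere 0 r0) \<psi>"
    using C2_dataD(1)[OF data] by (rule continuous_on_subset) (use far r0 in auto)
  then have "bounded (\<psi> ` sphere 0 r0)"
    using compact_continuous_image compact_sphere compact_imp_bounded by blast
  then obtain M where "\<forall>z\<in>\<psi> ` sphere 0 r0. norm z \<le> M" unfolding bounded_iff by blast
  then have M: "\<And>y. norm y = r0 \<Longrightarrow> norm (\<psi> y) \<le> M" by auto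
  show ?thesis
  \<comment> \<open>Beyond \<open>2 * M / d\<close> the value at the start of the ray, at most M,
    costs no more than d/2 times |y|; the derivative bound uses the other half.\<close>
  proof (intro exI[of _ "max r0 (2 * M / d)"] allI impI)
    fix y :: "real^3" assume y: "max r0 (2 * M / d) \<le> norm y"
    define r where "r = norm y"
    define \<theta> where "\<theta> = sgn y"
    have r: "r0 \<le> r" "M \<le> d / 2 * r" using y assms by (auto simp: r_def field_simps)
    have y0: "y \<noteq> 0" using r r0 r_def by auto
    have n: "norm (s *\<^sub>R \<theta>) = s" if "s \<ge> 0" for s
      using that y0 by (simp add: \<theta>_def norm_sgn)
    let ?E = "\<lambda>s. exp (- (\<i> * of_real \<kappa> * of_real s))"
    let ?h = "\<lambda>s. ?E s * \<psi> (s *\<^sub>R \<theta>)"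
    have nE: "norm (?E s) = 1" for s by (simp add: norm_exp_eq_Re)
    have "norm (?h r - ?h r0) \<le> d / 2 * (r - r0)"
    proof (rule vector_derivative_bound[OF r(1)])
      fix s assume s: "s \<in> {r0..r}"
      then have s0: "s > 0" using r0 by auto
      have sW: "s *\<^sub>R \<theta> \<in> W" using far n[of s] s r0 by auto
      have 1: "(?E has_vector_derivative - (\<i> * of_real \<kappa>) * ?E s) (at s)"
        by (rule has_vector_derivative_real_field[where f = "\<lambda>z. exp (- (\<i> * of_real \<kappa> * z))"])
          (auto intro!: derivative_eq_intros)
      show "(?h has_vector_derivative ?E s * (euler p1 (s *\<^sub>R \<theta>) /\<^sub>R s) + - (\<i> * of_real \<kappa>) * ?E s * \<psi> (s *\<^sub>R \<theta>)) (at s)"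
        by (rule has_vector_derivative_mult[OF 1 euler_ray[OF s0 sW]])
      have "?E s * (euler p1 (s *\<^sub>R \<theta>) /\<^sub>R s) + - (\<i> * of_real \<kappa>) * ?E s * \<psi> (s *\<^sub>R \<theta>) =
         ?E s * (euler p1 (s *\<^sub>R \<theta>) - \<i> * of_real \<kappa> * of_real (norm (s *\<^sub>R \<theta>)) * \<psi> (s *\<^sub>R \<theta>)) / of_real s"
        using s0 n[of s] by (simp add: scaleR_conv_of_real field_simps)
      also have "norm \<dots> \<le> 1 / s"
        using T1[of "s *\<^sub>R \<theta>"] n[of s] s s0 r0 by (simp add: norm_mult norm_divide nE divide_right_mono less_imp_le)
      also have "\<dots> \<le> 1 / r0" using s r0 by (simp add: frac_le)
      also have "\<dots> \<le> d / 2" by (rule r0)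
      finally show "norm (?E s * (euler p1 (s *\<^sub>R \<theta>) /\<^sub>R s) + - (\<i> * of_real \<kappa>) * ?E s * \<psi> (s *\<^sub>R \<theta>)) \<le> d / 2" .
    qed
    then have "norm (?h r) \<le> norm (?h r0) + d / 2 * (r - r0)"
      using norm_triangle_ineq2[of "?h r" "?h r0"] by linarith
    also have "norm (?h r0) = norm (\<psi> (r0 *\<^sub>R \<theta>))" by (simp add: norm_mult nE)
    also have "\<dots> \<le> M" using n[of r0] r0 by (intro M) auto
    also have "norm (?h r) = norm (\<psi> y)"
      using y0 by (simp add: norm_mult nE r_def \<theta>_def sgn_div_norm)
    finally have "norm (\<psi> y) \<le> M + d / 2 * (r - r0)" by simp
    moreover have "d / 2 * (r - r0) \<le> d / 2 * r" using r0 assms by (intro mult_left_mono) auto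
    ultimately show "norm (\<psi> y) \<le> d * norm y" using r by (simp add: r_def)
  qed
qed

end

text \<open>With \<open>q = 1 / r\<close> and \<open>k = \<i> \<kappa>\<close>: the choice \<open>2 k \<alpha> = 1\<close> cancels the only term of order \<open>m f g\<close>.\<close>

lemma divergence_correction_identity:
  fixes m m' \<alpha> q r k f g e c :: complex
  assumes "q * r = 1" "2 * k * \<alpha> = 1"
  shows "((2 * r ^ 2 * m' + 3 * m) * f + 2 * m * (k * r * f + e)) * g -
    (3 * (m * (1 + \<alpha> * q)) * (f * g) + 2 * r ^ 2 * (m' * (1 + \<alpha> * q) - m * \<alpha> * q ^ 3 / 2) * (f * g) +
     m * (1 + \<alpha> * q) * ((k * r * f + e) * g + f * ((k * r + c) * g))) =
    g * (m * e - \<alpha> * q * (2 * m + 2 * r ^ 2 * m') * f - m * (c + 1) * f - m * \<alpha> * q * (e + c * f))"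
  using assms by algebra

text \<open>Here i \<kappa> |y| + c is the factor by which y . grad multiplies the kernel centred at
  x. For x = 0 it is i \<kappa> |y| - 1, so c = -1 exactly; moving the centre to x changes c only by
  O(1/|y|).\<close>

lemma outgoing_error_bound:
  fixes x y :: "'a::real_inner"
  assumes y: "1 \<le> norm y" "2 * norm x \<le> norm y" and \<kappa>: "\<kappa> > 0"
  defines "\<rho> \<equiv> norm (y - x)"
  defines "c \<equiv> (\<i> * of_real \<kappa> / of_real \<rho> - 1 / of_real \<rho> ^ 2) * of_real (y \<bullet> (y - x)) - \<i> * of_real \<kappa> * of_real (norm y)"
  shows "norm (c + 1) \<le> (\<kappa> * (norm x)\<^sup>2 + 6 * norm x + 2 * (norm x)\<^sup>2) / norm y"
    and "norm y / 2 \<le> \<rho>"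
proof -
  define r a where "r = norm y" and "a = norm x"
  have a: "0 \<le> a" "1 \<le> r" "2 * a \<le> r" using y by (auto simp: a_def r_def)
  have d: "\<bar>r - \<rho>\<bar> \<le> a"
    using norm_triangle_ineq3[of y "y - x"] by (simp add: r_def \<rho>_def a_def)
  then show \<rho>2: "norm y / 2 \<le> \<rho>" using a unfolding r_def[symmetric] by linarith
  then have \<rho>0: "\<rho> > 0" and \<rho>r: "r / 2 \<le> \<rho>" using a by (auto simp: r_def)
  define \<tau> where "\<tau> = y \<bullet> (y - x)"
  \<comment> \<open>The polarisation identity expresses the inner product by the three side lengths,
    so the rest is an estimate in real numbers resting on |r - \<rho>| <= a.\<close>
  have \<tau>: "\<tau> = (r\<^sup>2 + \<rho>\<^sup>2 - a\<^sup>2) / 2"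
    unfolding \<tau>_def r_def \<rho>_def a_def power2_norm_eq_inner by (simp add: algebra_simps inner_commute)
  have "c + 1 = \<i> * of_real (\<kappa> * (\<tau> / \<rho> - r)) - of_real (\<tau> / \<rho>\<^sup>2 - 1)"
    using \<rho>0 unfolding c_def \<tau>_def[symmetric] r_def[symmetric] by (simp add: field_simps)
  then have "norm (c + 1) \<le> norm (\<i> * complex_of_real (\<kappa> * (\<tau> / \<rho> - r))) + norm (complex_of_real (\<tau> / \<rho>\<^sup>2 - 1))"
    using norm_triangle_ineq4 by metis
  also have "\<dots> = \<kappa> * \<bar>\<tau> / \<rho> - r\<bar> + \<bar>\<tau> / \<rho>\<^sup>2 - 1\<bar>"
    using \<kappa> by (simp only: norm_mult norm_of_real norm_ii abs_mult)
  also have "\<bar>\<tau> / \<rho> - r\<bar> \<le> a\<^sup>2 / r"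
  proof -
    have "\<tau> / \<rho> - r = ((r - \<rho>)\<^sup>2 - a\<^sup>2) / (2 * \<rho>)"
      unfolding \<tau> using \<rho>0 by (simp add: field_simps power2_eq_square)
    also have "\<bar>\<dots>\<bar> = (a\<^sup>2 - (r - \<rho>)\<^sup>2) / (2 * \<rho>)"
    proof -
      have "(r - \<rho>)\<^sup>2 \<le> a\<^sup>2" using abs_le_square_iff[of "r - \<rho>" a] d a by simp
      then have "((r - \<rho>)\<^sup>2 - a\<^sup>2) / (2 * \<rho>) \<le> 0" using \<rho>0 by (intro divide_nonpos_pos) auto
      then show ?thesis by (simp only: abs_of_nonpos minus_divide_left minus_diff_eq)
    qed
    also have "\<dots> \<le> a\<^sup>2 / (2 * \<rho>)" using \<rho>0 by (intro divide_right_mono) auto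
    also have "\<dots> \<le> a\<^sup>2 / r" using \<rho>r \<rho>0 a by (intro divide_left_mono) auto
    finally show ?thesis .
  qed
  also have "\<bar>\<tau> / \<rho>\<^sup>2 - 1\<bar> \<le> (6 * a + 2 * a\<^sup>2) / r"
  proof -
    have "\<tau> / \<rho>\<^sup>2 - 1 = ((r - \<rho>) * (r + \<rho>) - a\<^sup>2) / (2 * \<rho>\<^sup>2)"
      unfolding \<tau> using \<rho>0 by (simp add: field_simps power2_eq_square)
    also have "\<bar>\<dots>\<bar> = \<bar>(r - \<rho>) * (r + \<rho>) - a\<^sup>2\<bar> / (2 * \<rho>\<^sup>2)"
      by (simp add: abs_divide)
    also have "\<dots> \<le> (a * (3 * r) + a\<^sup>2) / (2 * (r / 2)\<^sup>2)"
    proof (rule frac_le)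
      have "\<bar>(r - \<rho>) * (r + \<rho>)\<bar> \<le> a * (3 * r)"
        unfolding abs_mult using d a \<rho>0 by (intro mult_mono) auto
      then show "\<bar>(r - \<rho>) * (r + \<rho>) - a\<^sup>2\<bar> \<le> a * (3 * r) + a\<^sup>2"
        using abs_triangle_ineq4[of "(r - \<rho>) * (r + \<rho>)" "a\<^sup>2"] by simp
      show "2 * (r / 2)\<^sup>2 \<le> 2 * \<rho>\<^sup>2" using \<rho>r a by (intro mult_left_mono power_mono) auto
    qed (use a in auto)
    also have "\<dots> = (6 * a + 2 * a\<^sup>2 / r) / r" using a by (simp add: field_simps power2_eq_square)
    also have "\<dots> \<le> (6 * a + 2 * a\<^sup>2) / r"
    proof (intro divide_right_mono add_left_mono)
      show "2 * a\<^sup>2 / r \<le> 2 * a\<^sup>2" using a by (simp add: divide_le_eq mult_le_cancel_left1)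
    qed (use a in auto)
    finally show ?thesis .
  qed
  finally show "norm (c + 1) \<le> (\<kappa> * (norm x)\<^sup>2 + 6 * norm x + 2 * (norm x)\<^sup>2) / norm y"
    unfolding a_def[symmetric] r_def[symmetric] using \<kappa> by (simp add: add_divide_distrib)
qed

lemma cutoff_correction_deriv:
  fixes \<alpha> :: complex
  assumes "T > 0" "s > 0"
  shows "((\<lambda>s. of_real (2 * cutoff1 T s) * (1 + \<alpha> * of_real (1 / sqrt s))) has_vector_derivative
     of_real (2 * cutoff2 T s) * (1 + \<alpha> * of_real (1 / sqrt s))
     - of_real (2 * cutoff1 T s) * \<alpha> * of_real (1 / sqrt s) ^ 3 / 2) (at s)"
proof -
  have 1: "((\<lambda>s. complex_of_real (2 * cutoff1 T s)) has_vector_derivative of_real (2 * cutoff2 T s)) (at s)"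
    using DERIV_cmult[OF cutoff_scaled_deriv(2)[OF assms(1)]]
    by (intro has_vector_derivative_of_real) (simp add: has_real_derivative_iff_has_vector_derivative)
  have "((\<lambda>s. 1 / sqrt s) has_real_derivative - ((1 / sqrt s) ^ 3 / 2)) (at s)"
    using assms(2) by (auto intro!: derivative_eq_intros simp: field_simps eval_nat_numeral)
  then have "((\<lambda>s. complex_of_real (1 / sqrt s)) has_vector_derivative of_real (- ((1 / sqrt s) ^ 3 / 2))) (at s)"
    by (intro has_vector_derivative_of_real) (simp add: has_real_derivative_iff_has_vector_derivative)
  then have "((\<lambda>s. 1 + \<alpha> * complex_of_real (1 / sqrt s)) has_vector_derivative
      0 + \<alpha> * of_real (- ((1 / sqrt s) ^ 3 / 2))) (at s)"
    by (intro has_vector_derivative_add has_vector_derivative_const has_vector_derivative_mult_right)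
  from has_vector_derivative_mult[OF 1 this] show ?thesis
    by (simp add: algebra_simps)
qed

section \<open>Vanishing of the shell contribution at infinity\<close>

context radiating_solution
begin

text \<open>
  For large \<open>T\<close> the integrand is only of size \<open>T\<^sup>-\<^sup>3 |\<psi>|\<close> times the volume \<open>T\<^sup>3\<close>, and \<open>\<psi>\<close> is not yet known to
  decay. The phase \<open>exp (2 \<i> \<kappa> r)\<close> of \<open>\<psi>\<close> times the kernel is exploited by subtracting the divergence of the
  compactly supported field \<open>y \<phi>(|y|\<^sup>2) \<psi>(y) G(y)\<close>, whose integral vanishes.
\<close>

lemma comm_integral_bound:
  assumes T: "T \<ge> 1" "T \<ge> R0" "T > 2 * norm x" and \<epsilon>: "\<epsilon> \<ge> 0"
    and e: "\<And>y. T \<le> norm y \<Longrightarrow> norm (euler p1 y - \<i> * of_real \<kappa> * of_real (norm y) * \<psi> y) \<le> \<epsilon>"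
    and g: "\<And>y. T \<le> norm y \<Longrightarrow> norm (\<psi> y) \<le> \<epsilon> * norm y"
  defines "A \<equiv> 1 / (2 * \<kappa>)"
  defines "C1 \<equiv> \<kappa> * (norm x)\<^sup>2 + 6 * norm x + 2 * (norm x)\<^sup>2"
  shows "norm (integral UNIV (\<lambda>y. out_wave \<kappa> (y - x) * comm 0 T \<psi> p1 y)) \<le>
    128 * (1440 * A + 144 + 144 * C1 + 144 * A * (2 + C1)) * \<epsilon>"
proof -
  let ?C = "1440 * A + 144 + 144 * C1 + 144 * A * (2 + C1)"
  define \<alpha> :: complex where "\<alpha> = 1 / (2 * \<i> * of_real \<kappa>)"
  have \<alpha>: "2 * (\<i> * of_real \<kappa>) * \<alpha> = 1" "norm \<alpha> = A"
    using kappa_pos by (auto simp: \<alpha>_def A_def norm_divide norm_mult)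
  have A0: "A \<ge> 0" and C10: "C1 \<ge> 0" using kappa_pos by (auto simp: A_def C1_def)
  have C0: "?C \<ge> 0" using A0 C10 by simp
  have T0: "T > 0" using T by simp
  \<comment> \<open>Removing |y| <= |x| takes out both singular points: x for the kernel and 0 for
    1/|y|.\<close>
  define S where "S = W \<inter> {y. norm x < norm y}"
  define K where "K = {y. T \<le> norm y} \<inter> cball (0::real^3) (2 * T)"
  have S: "open S" unfolding S_def by (intro open_Int open_W open_Collect_less continuous_intros)
  have K: "compact K" unfolding K_def
    by (intro closed_Int_compact closed_Collect_le continuous_intros) auto
  have KS: "K \<subseteq> S" using far T T0 by (auto simp: K_def S_def)
  have Spos: "(norm y)\<^sup>2 \<in> {0<..}" "(norm (y - x))\<^sup>2 \<in> {0<..}" if "y \<in> S" for y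
    using that norm_ge_zero[of x] by (auto simp: S_def simp del: norm_ge_zero)
  define G where "G y = out_wave \<kappa> (y - x)" for y
  define G1 where "G1 b y = wave1 \<kappa> ((norm (y - x))\<^sup>2) * of_real (2 * ((y - x) \<bullet> b))" for b y
  define G2 where "G2 b y = wave2 \<kappa> ((norm (y - x))\<^sup>2) * of_real ((2 * ((y - x) \<bullet> b))\<^sup>2) + 2 * wave1 \<kappa> ((norm (y - x))\<^sup>2)" for b y
  have G: "C2_data S G G1 G2"
    unfolding G_def[abs_def] G1_def[abs_def] G2_def[abs_def] out_wave_eq
    by (rule C2_data_radial[where T = "{0<..}"])
      (use Spos wave0_deriv wave1_deriv continuous_on_wave2 in auto)
  have \<psi>S: "C2_data S \<psi> p1 p2" using C2_data_subset[OF data] by (simp add: S_def)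
  note F = C2_dataD[OF C2_data_mult[OF \<psi>S G]]
  \<comment> \<open>The vector \<open>2 * cutoff1\<close> times y is the gradient of the cutoff.
    Subtracting the divergence of this gradient times \<open>\<psi> * G\<close> turns the commutator
    into the Green boundary term, in which the leading parts of the two outgoing waves cancel. The
    -1 in \<open>outgoing_error_bound\<close> leaves a multiple of \<open>\<psi> * G\<close>, and
    the summand \<alpha> / |y| is there to remove it.\<close>
  define \<phi> where "\<phi> s = of_real (2 * cutoff1 T s) * (1 + \<alpha> * of_real (1 / sqrt s))" for s
  define \<phi>' where "\<phi>' s = of_real (2 * cutoff2 T s) * (1 + \<alpha> * of_real (1 / sqrt s))
     - of_real (2 * cutoff1 T s) * \<alpha> * of_real (1 / sqrt s) ^ 3 / 2" for s
  have \<phi>: "(\<phi> has_vector_derivative \<phi>' s) (at s)" if "s > 0" for s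
    unfolding \<phi>_def[abs_def] \<phi>'_def by (rule cutoff_correction_deriv[OF T0 that])
  have c\<phi>: "continuous_on {0<..} \<phi>"
    using \<phi> by (intro continuous_at_imp_continuous_on) (auto intro: has_vector_derivative_continuous)
  have c1: "continuous_on {0<..} (cutoff1 T)"
    using cutoff_scaled_deriv(2)[OF T0] by (meson DERIV_isCont continuous_at_imp_continuous_on)
  have c\<phi>': "continuous_on {0<..} \<phi>'"
    unfolding \<phi>'_def[abs_def] using c1 cutoff_scaled_deriv(3)[OF T0] by (auto intro!: continuous_intros)
  have c\<phi>S: "continuous_on S (\<lambda>y. \<phi> ((norm y)\<^sup>2))" "continuous_on S (\<lambda>y. \<phi>' ((norm y)\<^sup>2))"
    using Spos by (auto intro!: continuous_on_compose2[OF c\<phi>] continuous_on_compose2[OF c\<phi>'] continuous_intros)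
  have zero: "cutoff1 T ((norm y)\<^sup>2) = 0 \<and> cutoff2 T ((norm y)\<^sup>2) = 0" if "y \<notin> K" for y
  proof (cases "norm y < T")
    case True
    then have "(norm y)\<^sup>2 / T\<^sup>2 \<le> 1" using T0 by (simp add: divide_le_eq power_mono)
    then show ?thesis by (simp add: cutoff1_def cutoff2_def cut_le_1)
  next
    case False
    then have "2 * T \<le> norm y" using that by (auto simp: K_def)
    then have "(2 * T)\<^sup>2 \<le> (norm y)\<^sup>2" using T0 by (intro power_mono) auto
    moreover have "(2 * T)\<^sup>2 = 4 * T\<^sup>2" by (simp add: power_mult_distrib)
    ultimately have "2 * T\<^sup>2 \<le> (norm y)\<^sup>2" using zero_le_power2[of T] by linarith
    then have "2 \<le> (norm y)\<^sup>2 / T\<^sup>2" using T0 by (simp add: le_divide_eq)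
    then show ?thesis by (simp add: cutoff1_def cutoff2_def cut_ge_2)
  qed
  then have zero\<phi>: "\<phi> ((norm y)\<^sup>2) = 0" "\<phi>' ((norm y)\<^sup>2) = 0" if "y \<notin> K" for y
    using that by (auto simp: \<phi>_def \<phi>'_def)
  define w' where "w' b y = \<phi> ((norm y)\<^sup>2) * (\<psi> y * G y)
      + of_real (y \<bullet> b) * (\<phi>' ((norm y)\<^sup>2) * of_real (2 * (y \<bullet> b))) * (\<psi> y * G y)
      + of_real (y \<bullet> b) * \<phi> ((norm y)\<^sup>2) * (p1 b y * G y + \<psi> y * G1 b y)" for b y
  note int = compact_support_integrable[OF continuous_on_UNIV_compact_support[OF S K KS] compact_imp_bounded[OF K]]
  have cw': "continuous_on S (w' b)" if "b \<in> Basis" for b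
    unfolding w'_def using c\<phi>S C2_dataD(1,2)[OF \<psi>S] C2_dataD(1,2)[OF G] that
    by (auto intro!: continuous_intros)
  have eq0: "integral UNIV (w' b) = 0" if b: "b \<in> Basis" for b
  proof (rule integral_directional_derivative_eq_0[OF S K KS,
        where b = b and w = "\<lambda>y. of_real (y \<bullet> b) * \<phi> ((norm y)\<^sup>2) * (\<psi> y * G y)"])
    fix y assume y: "y \<in> S"
    have 1: "((\<lambda>t. complex_of_real ((y + t *\<^sub>R b) \<bullet> b)) has_vector_derivative 1) (at 0)"
    proof -
      have "((\<lambda>t. y \<bullet> b + t) has_real_derivative 1) (at 0)" by (auto intro!: derivative_eq_intros)
      then have "((\<lambda>t. complex_of_real (y \<bullet> b + t)) has_vector_derivative of_real 1) (at 0)"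
        by (intro has_vector_derivative_of_real) (simp add: has_real_derivative_iff_has_vector_derivative)
      moreover have "(y + t *\<^sub>R b) \<bullet> b = y \<bullet> b + t" for t using b by (simp add: inner_left_distrib)
      ultimately show ?thesis by simp
    qed
    have 2: "((\<lambda>t. \<phi> ((norm (y + t *\<^sub>R b))\<^sup>2)) has_vector_derivative \<phi>' ((norm y)\<^sup>2) * of_real (2 * (y \<bullet> b))) (at 0)"
      using has_vector_derivative_radial[OF b, of \<phi> _ y 0] \<phi> Spos[OF y] by simp
    from has_vector_derivative_mult[OF has_vector_derivative_mult[OF 1 2] F(4)[OF b y]]
    show "((\<lambda>t. of_real ((y + t *\<^sub>R b) \<bullet> b) * \<phi> ((norm (y + t *\<^sub>R b))\<^sup>2) * (\<psi> (y + t *\<^sub>R b) * G (y + t *\<^sub>R b)))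
      has_vector_derivative w' b y) (at 0)"
      by (simp add: w'_def algebra_simps)
  next
    show "continuous_on S (\<lambda>y. of_real (y \<bullet> b) * \<phi> ((norm y)\<^sup>2) * (\<psi> y * G y))"
      using c\<phi>S C2_dataD(1)[OF \<psi>S] C2_dataD(1)[OF G] by (auto intro!: continuous_intros)
  qed (use zero\<phi> cw'[OF b] in \<open>auto simp: w'_def\<close>)
  have comm: "comm 0 T \<psi> p1 y =
     (2 * of_real (norm y) ^ 2 * of_real (2 * cutoff2 T ((norm y)\<^sup>2)) + 3 * of_real (2 * cutoff1 T ((norm y)\<^sup>2))) * \<psi> y
     + 2 * of_real (2 * cutoff1 T ((norm y)\<^sup>2)) * euler p1 y" for y
  proof -
    have 1: "(\<Sum>b\<in>Basis. cutoff_d2 0 T b y) =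
        4 * of_real ((norm y)\<^sup>2) * of_real (cutoff2 T ((norm y)\<^sup>2)) + 6 * of_real (cutoff1 T ((norm y)\<^sup>2))"
      unfolding cutoff_d2_def radial_laplacian by simp
    have 2: "(\<Sum>b\<in>Basis. 2 * cutoff_d1 0 T b y * p1 b y) = 4 * of_real (cutoff1 T ((norm y)\<^sup>2)) * euler p1 y"
      by (simp add: euler_def sum_distrib_left cutoff_d1_def mult_ac)
    have "comm 0 T \<psi> p1 y = (\<Sum>b\<in>Basis. cutoff_d2 0 T b y) * \<psi> y + (\<Sum>b\<in>Basis. 2 * cutoff_d1 0 T b y * p1 b y)"
      by (simp add: comm_def sum.distrib sum_distrib_right)
    then show ?thesis unfolding 1 2 by (simp add: algebra_simps)
  qed
  have czero: "comm 0 T \<psi> p1 y = 0" if "y \<notin> K" for y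
    using zero[OF that] by (simp add: comm)
  define \<Theta> where "\<Theta> y = out_wave \<kappa> (y - x) * comm 0 T \<psi> p1 y - (\<Sum>b\<in>Basis. w' b y)" for y
  have cc: "continuous_on S (\<lambda>y. out_wave \<kappa> (y - x) * comm 0 T \<psi> p1 y)"
    using C2_dataD(1)[OF G] continuous_on_comm[OF T0 \<psi>S] unfolding G_def by (intro continuous_intros)
  have w'0: "w' b y = 0" if "y \<notin> K" for b y using zero\<phi>[OF that] by (simp add: w'_def)
  have "integral UNIV \<Theta> = integral UNIV (\<lambda>y. out_wave \<kappa> (y - x) * comm 0 T \<psi> p1 y) - integral UNIV (\<lambda>y. \<Sum>b\<in>Basis. w' b y)"
    unfolding \<Theta>_def
    by (intro integral_diff int) (use cc cw' w'0 czero in \<open>auto intro!: continuous_intros\<close>)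
  also have "integral UNIV (\<lambda>y. \<Sum>b\<in>Basis. w' b y) = 0"
    using eq0 int[OF cw'] w'0 by (subst integral_sum) auto
  finally have I: "integral UNIV (\<lambda>y. out_wave \<kappa> (y - x) * comm 0 T \<psi> p1 y) = integral UNIV \<Theta>" by simp
  have \<Theta>0: "\<Theta> y = 0" if "y \<notin> K" for y using that by (simp add: \<Theta>_def w'0 czero)
  \<comment> \<open>The kernel is at most 2/T, and each of the four terms left by the identity is at
    most 144/T^2 times a constant times \<epsilon>. Here 144 = 2 * 72 comes from
    \<open>cut_bound\<close>, 576 = 4 * 144 from |y| <= 2 T, and 1440 = 2 * 144 + 2 * 576.\<close>
  have \<Theta>b: "norm (\<Theta> y) \<le> 2 * ?C * \<epsilon> / T ^ 3" if y: "y \<in> K" for y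
  proof -
    define r q m m' where "r = complex_of_real (norm y)" and "q = complex_of_real (1 / norm y)"
      and "m = complex_of_real (2 * cutoff1 T ((norm y)\<^sup>2))" and "m' = complex_of_real (2 * cutoff2 T ((norm y)\<^sup>2))"
    define c where "c = (\<i> * of_real \<kappa> / of_real (norm (y - x)) - 1 / of_real (norm (y - x)) ^ 2) * of_real (y \<bullet> (y - x))
        - \<i> * of_real \<kappa> * of_real (norm y)"
    define er where "er = euler p1 y - \<i> * of_real \<kappa> * of_real (norm y) * \<psi> y"
    have Ty: "T \<le> norm y" "norm y \<le> 2 * T" using y by (auto simp: K_def)
    have y0: "norm y > 0" using Ty T0 by linarith
    have qr: "q * r = 1" using y0 by (simp add: q_def r_def)
    have E: "euler p1 y = \<i> * of_real \<kappa> * r * \<psi> y + er" by (simp add: er_def r_def)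
    have EG: "euler G1 y = (\<i> * of_real \<kappa> * r + c) * G y"
    proof -
      have "euler G1 y = wave1 \<kappa> ((norm (y - x))\<^sup>2) * of_real (2 * (y \<bullet> (y - x)))"
        unfolding euler_def G1_def by (subst (3) euclidean_inner) (simp add: sum_distrib_left mult_ac)
      then show ?thesis by (simp add: wave1_def G_def out_wave_eq c_def r_def)
    qed
    have "(\<Sum>b\<in>Basis. w' b y) = 3 * \<phi> ((norm y)\<^sup>2) * (\<psi> y * G y) + 2 * r ^ 2 * \<phi>' ((norm y)\<^sup>2) * (\<psi> y * G y)
        + \<phi> ((norm y)\<^sup>2) * (euler p1 y * G y + \<psi> y * euler G1 y)"
    proof -
      have "r ^ 2 = (\<Sum>b\<in>Basis. of_real (y \<bullet> b) * of_real (y \<bullet> b))"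
        unfolding r_def of_real_power[symmetric] power2_norm_eq_inner by (subst euclidean_inner) simp
      then show ?thesis
        by (simp add: w'_def euler_def sum.distrib sum_distrib_left sum_distrib_right algebra_simps)
    qed
    also have "\<phi> ((norm y)\<^sup>2) = m * (1 + \<alpha> * q)" using y0 by (simp add: \<phi>_def m_def q_def)
    also have "\<phi>' ((norm y)\<^sup>2) = m' * (1 + \<alpha> * q) - m * \<alpha> * q ^ 3 / 2" using y0 by (simp add: \<phi>'_def m_def m'_def q_def)
    finally have "\<Theta> y = ((2 * r ^ 2 * m' + 3 * m) * \<psi> y + 2 * m * (\<i> * of_real \<kappa> * r * \<psi> y + er)) * G y -
      (3 * (m * (1 + \<alpha> * q)) * (\<psi> y * G y) + 2 * r ^ 2 * (m' * (1 + \<alpha> * q) - m * \<alpha> * q ^ 3 / 2) * (\<psi> y * G y) +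
       m * (1 + \<alpha> * q) * ((\<i> * of_real \<kappa> * r * \<psi> y + er) * G y + \<psi> y * ((\<i> * of_real \<kappa> * r + c) * G y)))"
      unfolding \<Theta>_def comm G_def[symmetric] E EG by (simp add: m_def m'_def r_def mult.commute)
    also have "\<dots> = G y * (m * er - \<alpha> * q * (2 * m + 2 * r ^ 2 * m') * \<psi> y - m * (c + 1) * \<psi> y - m * \<alpha> * q * (er + c * \<psi> y))"
      by (rule divergence_correction_identity[OF qr \<alpha>(1)])
    finally have \<Theta>: "\<Theta> y = \<dots>" .
    have nq: "norm q = 1 / norm y" by (simp add: q_def norm_divide)
    have nm: "norm m \<le> 144 / T\<^sup>2"
    proof -
      have "norm m = \<bar>2 * cutoff1 T ((norm y)\<^sup>2)\<bar>" by (simp only: m_def norm_of_real)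
      also have "\<dots> = 2 * \<bar>cut1 ((norm y)\<^sup>2 / T\<^sup>2)\<bar> / T\<^sup>2" by (simp add: cutoff1_def abs_mult)
      also have "\<dots> \<le> 2 * 72 / T\<^sup>2" by (intro divide_right_mono mult_left_mono cut_bound) auto
      finally show ?thesis by simp
    qed
    have nm': "norm (r ^ 2 * m') \<le> 576 / T\<^sup>2"
    proof -
      have "norm (r ^ 2 * m') = (norm y)\<^sup>2 * (2 * \<bar>cut2 ((norm y)\<^sup>2 / T\<^sup>2)\<bar> / T ^ 4)"
      proof -
        have "norm m' = \<bar>2 * cutoff2 T ((norm y)\<^sup>2)\<bar>" by (simp only: m'_def norm_of_real)
        also have "\<dots> = 2 * \<bar>cut2 ((norm y)\<^sup>2 / T\<^sup>2)\<bar> / T ^ 4" by (simp add: cutoff2_def abs_mult)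
        finally show ?thesis by (simp add: norm_mult norm_power r_def)
      qed
      also have "\<dots> \<le> (2 * T)\<^sup>2 * (2 * 72 / T ^ 4)"
        using cut_bound(2) Ty T0 by (intro mult_mono power_mono divide_right_mono) auto
      also have "\<dots> = 576 / T\<^sup>2" using T0 by (simp add: field_simps eval_nat_numeral)
      finally show ?thesis .
    qed
    have y1: "1 \<le> norm y" "2 * norm x \<le> norm y" using T Ty by auto
    note oe = outgoing_error_bound[OF y1 kappa_pos, folded c_def C1_def]
    have nG: "norm (G y) \<le> 2 / T"
    proof -
      have "norm (G y) = 1 / norm (y - x)" by (simp add: G_def out_wave_def norm_divide)
      also have "\<dots> \<le> 1 / (T / 2)" using oe(2) Ty T0 by (intro frac_le) auto
      finally show ?thesis by simp
    qed
    have ne: "norm er \<le> \<epsilon>" using e[OF Ty(1)] by (simp add: er_def)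
    have n\<psi>: "norm (\<psi> y) \<le> \<epsilon> * norm y" by (rule g[OF Ty(1)])
    have nc1: "norm (c + 1) * norm (\<psi> y) \<le> C1 * \<epsilon>"
    proof -
      have "norm (c + 1) * norm (\<psi> y) \<le> (C1 / norm y) * (\<epsilon> * norm y)"
        using oe(1) n\<psi> C10 y0 by (intro mult_mono) auto
      then show ?thesis using y0 by simp
    qed
    have nqp: "norm q * norm (\<psi> y) \<le> \<epsilon>"
      unfolding nq using n\<psi> y0 by (simp add: field_simps)
    have nc: "norm c \<le> 1 + C1"
    proof -
      have "norm c \<le> norm (c + 1) + 1" using norm_triangle_ineq4[of "c + 1" 1] by simp
      also have "norm (c + 1) \<le> C1 / 1" using oe(1) C10 y1 by (meson frac_le order_refl order_trans zero_less_one)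
      finally show ?thesis by simp
    qed
    have q1: "norm q \<le> 1" unfolding nq using y1 y0 by (simp add: divide_le_eq)
    have t1: "norm (m * er) \<le> 144 / T\<^sup>2 * \<epsilon>"
      unfolding norm_mult using nm ne T0 by (intro mult_mono) auto
    have t2: "norm (\<alpha> * q * (2 * m + 2 * r ^ 2 * m') * \<psi> y) \<le> 144 / T\<^sup>2 * (10 * A * \<epsilon>)"
    proof -
      have "norm (2 * m + 2 * r ^ 2 * m') \<le> 2 * norm m + 2 * norm (r ^ 2 * m')"
        using norm_triangle_ineq[of "2 * m" "2 * r ^ 2 * m'"] by (simp add: norm_mult mult.assoc)
      also have "\<dots> \<le> 1440 / T\<^sup>2" using nm nm' by simp
      finally have b: "norm (2 * m + 2 * r ^ 2 * m') \<le> 1440 / T\<^sup>2" .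
      have "norm (\<alpha> * q * (2 * m + 2 * r ^ 2 * m') * \<psi> y) = A * (norm (2 * m + 2 * r ^ 2 * m') * (norm q * norm (\<psi> y)))"
        by (simp add: norm_mult \<alpha>(2))
      also have "\<dots> \<le> A * (1440 / T\<^sup>2 * \<epsilon>)"
        using T0 by (intro mult_left_mono[OF mult_mono[OF b nqp] A0]) auto
      finally show ?thesis by (simp add: field_simps)
    qed
    have t3: "norm (m * (c + 1) * \<psi> y) \<le> 144 / T\<^sup>2 * (C1 * \<epsilon>)"
      unfolding norm_mult mult.assoc using T0 by (intro mult_mono[OF nm nc1]) auto
    have t4: "norm (m * \<alpha> * q * (er + c * \<psi> y)) \<le> 144 / T\<^sup>2 * (A * (2 + C1) * \<epsilon>)"
    proof -
      have "norm (q * (er + c * \<psi> y)) \<le> norm q * norm er + norm c * (norm q * norm (\<psi> y))"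
        using norm_triangle_ineq[of "q * er" "q * (c * \<psi> y)"] by (simp add: norm_mult distrib_left mult_ac)
      also have "\<dots> \<le> 1 * \<epsilon> + (1 + C1) * \<epsilon>"
        using C10 by (intro add_mono[OF mult_mono[OF q1 ne] mult_mono[OF nc nqp]]) auto
      finally have b: "norm (q * (er + c * \<psi> y)) \<le> (2 + C1) * \<epsilon>" by (simp add: algebra_simps)
      have "norm (m * \<alpha> * q * (er + c * \<psi> y)) = norm m * (A * norm (q * (er + c * \<psi> y)))"
        by (simp add: norm_mult \<alpha>(2))
      also have "\<dots> \<le> 144 / T\<^sup>2 * (A * ((2 + C1) * \<epsilon>))"
        using A0 T0 by (intro mult_mono[OF nm mult_left_mono[OF b A0]]) auto
      finally show ?thesis by (simp add: mult.assoc)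
    qed
    have "norm (m * er - \<alpha> * q * (2 * m + 2 * r ^ 2 * m') * \<psi> y - m * (c + 1) * \<psi> y - m * \<alpha> * q * (er + c * \<psi> y))
       \<le> 144 / T\<^sup>2 * \<epsilon> + 144 / T\<^sup>2 * (10 * A * \<epsilon>) + 144 / T\<^sup>2 * (C1 * \<epsilon>) + 144 / T\<^sup>2 * (A * (2 + C1) * \<epsilon>)"
      by (intro order_trans[OF norm_triangle_ineq4] add_mono t1 t2 t3 t4)
    also have "\<dots> = (1440 * A + 144 + 144 * C1 + 144 * A * (2 + C1)) * \<epsilon> / T\<^sup>2"
      using T0 by (simp add: field_simps)
    finally have "norm (\<Theta> y) \<le> 2 / T * ((1440 * A + 144 + 144 * C1 + 144 * A * (2 + C1)) * \<epsilon> / T\<^sup>2)"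
      unfolding \<Theta> norm_mult[of "G y"] using nG T0 by (intro mult_mono) auto
    moreover have "2 / T * (X * \<epsilon> / T\<^sup>2) = 2 * X * \<epsilon> / T ^ 3" for X
      using T0 by (simp add: field_simps power2_eq_square power3_eq_cube)
    ultimately show ?thesis by (simp only:)
  qed
  have "integral UNIV \<Theta> = integral (cbox ((- 2 * T) *\<^sub>R One) ((2 * T) *\<^sub>R One)) \<Theta>"
  proof (rule integral_UNIV_support)
    fix y :: "real^3" assume y: "y \<notin> cbox ((- 2 * T) *\<^sub>R One) ((2 * T) *\<^sub>R One)"
    then obtain b :: "real^3" where b: "b \<in> Basis" "\<bar>y \<bullet> b\<bar> > 2 * T"
      by (fastforce simp: mem_box)
    then have "2 * T < norm y" using Basis_le_norm[OF b(1), of y] by linarith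
    then show "\<Theta> y = 0" by (intro \<Theta>0) (auto simp: K_def)
  qed
  also have "norm \<dots> \<le> 2 * ?C * \<epsilon> / T ^ 3 * measure lborel (cbox ((- 2 * T) *\<^sub>R One) ((2 * T) *\<^sub>R One :: real^3))"
  proof (rule has_integral_bound)
    have "continuous_on UNIV \<Theta>"
      using cc cw' \<Theta>0 unfolding \<Theta>_def
      by (intro continuous_on_UNIV_compact_support[OF S K KS]) (auto intro!: continuous_intros)
    then show "(\<Theta> has_integral integral (cbox ((- 2 * T) *\<^sub>R One) ((2 * T) *\<^sub>R One)) \<Theta>) (cbox ((- 2 * T) *\<^sub>R One) ((2 * T) *\<^sub>R One))"
      by (intro integrable_integral integrable_continuous) (auto intro: continuous_on_subset)
    show "norm (\<Theta> y) \<le> 2 * ?C * \<epsilon> / T ^ 3" for y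
      using \<Theta>b[of y] \<Theta>0[of y] C0 \<epsilon> T0 by (cases "y \<in> K") auto
  qed (use C0 \<epsilon> T0 in auto)
  \<comment> \<open>The box has side 4 T, so its volume cancels the T^3 in the pointwise bound, and
    2 * 64 gives the constant 128.\<close>
  also have "measure lborel (cbox ((- 2 * T) *\<^sub>R One) ((2 * T) *\<^sub>R One :: real^3)) = 64 * T ^ 3"
    using T0 by (subst content_cbox) (simp_all add: inner_sum_left_Basis power3_eq_cube)
  finally have "norm (integral UNIV \<Theta>) \<le> 2 * ?C * \<epsilon> / T ^ 3 * (64 * T ^ 3)" .
  moreover have "2 * X * \<epsilon> / T ^ 3 * (64 * T ^ 3) = 128 * X * \<epsilon>" for X
    using T0 by simp
  ultimately show ?thesis unfolding I by (simp only:)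
qed

text \<open>The constant of \<open>comm_integral_bound\<close> depends on \<kappa> and x but not on
  T, and both of its hypotheses on \<psi> hold for any given \<epsilon> far enough out.\<close>

lemma comm_integral_tendsto_0:
  "((\<lambda>T. integral UNIV (\<lambda>y. out_wave \<kappa> (y - x) * comm 0 T \<psi> p1 y)) \<longlongrightarrow> 0) at_top"
proof (rule tendstoI)
  fix d :: real assume d: "d > 0"
  define C where "C = 128 * (1440 * (1 / (2 * \<kappa>)) + 144 + 144 * (\<kappa> * (norm x)\<^sup>2 + 6 * norm x + 2 * (norm x)\<^sup>2)
     + 144 * (1 / (2 * \<kappa>)) * (2 + (\<kappa> * (norm x)\<^sup>2 + 6 * norm x + 2 * (norm x)\<^sup>2)))"
  have C: "C > 0" unfolding C_def using kappa_pos by (intro mult_pos_pos add_pos_nonneg add_nonneg_pos) auto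
  define \<epsilon> where "\<epsilon> = d / (2 * C)"
  have \<epsilon>: "\<epsilon> > 0" "C * \<epsilon> < d" using d C by (auto simp: \<epsilon>_def)
  obtain T1 where T1: "\<And>y. T1 \<le> norm y \<Longrightarrow> norm (euler p1 y - \<i> * of_real \<kappa> * of_real (norm y) * \<psi> y) < \<epsilon>"
    using radiation[OF \<epsilon>(1)] by auto
  obtain T2 where T2: "\<And>y. T2 \<le> norm y \<Longrightarrow> norm (\<psi> y) \<le> \<epsilon> * norm y"
    using sublinear_growth[OF \<epsilon>(1)] by auto
  show "\<forall>\<^sub>F T in at_top. dist (integral UNIV (\<lambda>y. out_wave \<kappa> (y - x) * comm 0 T \<psi> p1 y)) 0 < d"
    using eventually_ge_at_top[of "max (max T1 T2) (max R0 (2 * norm x + 1))"]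
  proof eventually_elim
    case (elim T)
    have "norm (integral UNIV (\<lambda>y. out_wave \<kappa> (y - x) * comm 0 T \<psi> p1 y)) \<le> C * \<epsilon>"
      unfolding C_def
    proof (rule comm_integral_bound)
      show "T \<ge> 1" using elim norm_ge_zero[of x] by linarith
      show "norm (euler p1 y - \<i> * of_real \<kappa> * of_real (norm y) * \<psi> y) \<le> \<epsilon>" if "T \<le> norm y" for y
        using T1[of y] elim that by simp
      show "norm (\<psi> y) \<le> \<epsilon> * norm y" if "T \<le> norm y" for y
        using T2[of y] elim that by simp
    qed (use elim \<epsilon> in auto)
    then show ?case using \<epsilon> by simp
  qed
qed

text \<open>By \<open>annulus_representation\<close> the outer integral does not depend on T once T
  is large, yet it tends to zero; so it is zero, and only the inner shell remains.\<close>

lemma exterior_representation: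
  assumes x: "2 * R0\<^sup>2 < (norm x)\<^sup>2"
  shows "bump_mass * \<psi> x = - integral UNIV (\<lambda>y. out_wave \<kappa> (y - x) * comm 0 R0 \<psi> p1 y)"
proof -
  let ?I = "\<lambda>T. integral UNIV (\<lambda>y. out_wave \<kappa> (y - x) * comm 0 T \<psi> p1 y)"
  \<comment> \<open>The alternative places x strictly inside or strictly outside the shell that
    carries the commutator, so the singularity of the kernel does no harm.\<close>
  have int: "(\<lambda>y. out_wave \<kappa> (y - x) * comm 0 T \<psi> p1 y) integrable_on UNIV"
    if T: "R0 \<le> T" "T > norm x \<or> 2 * T\<^sup>2 < (norm x)\<^sup>2" for T
  proof -
    have T0: "T > 0" using T(1) R0_pos by simp
    let ?K = "{y. T \<le> norm y} \<inter> {y::real^3. (norm y)\<^sup>2 \<le> 2 * T\<^sup>2}"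
    have "?K \<subseteq> cball 0 (2 * T)"
    proof
      fix y :: "real^3" assume "y \<in> ?K"
      then have "(norm y)\<^sup>2 \<le> 2 * T\<^sup>2" by simp
      also have "\<dots> \<le> 4 * T\<^sup>2" by (intro mult_right_mono) auto
      also have "\<dots> = (2 * T)\<^sup>2" by (simp add: power_mult_distrib)
      finally have "(norm y)\<^sup>2 \<le> (2 * T)\<^sup>2" .
      then have "norm y \<le> 2 * T" using T0 by (auto intro: power2_le_imp_le)
      then show "y \<in> cball 0 (2 * T)" by simp
    qed
    then have b: "bounded ?K" by (rule bounded_subset[OF bounded_cball])
    moreover have "closed ?K" by (intro closed_Int closed_Collect_le continuous_intros)
    ultimately have K: "compact ?K" by (simp add: compact_eq_bounded_closed)
    have S: "open (W - {x})" using open_W by auto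
    have KS: "?K \<subseteq> W - {x}" using far T by auto
    have c: "continuous_on (W - {x}) (\<lambda>y. out_wave \<kappa> (y - x) * comm 0 T \<psi> p1 y)"
      unfolding out_wave_def
      by (intro continuous_intros continuous_on_subset[OF continuous_on_comm[OF T0 data]]) auto
    show ?thesis
    proof (rule compact_support_integrable[OF continuous_on_UNIV_compact_support[OF S K KS c] b])
      show "out_wave \<kappa> (y - x) * comm 0 T \<psi> p1 y = 0" if "y \<notin> ?K" for y
        using that T0 by (subst comm_eq_0) auto
      then show "out_wave \<kappa> (y - x) * comm 0 T \<psi> p1 y = 0" if "y \<notin> ?K" for y
        using that by simp
    qed
  qed
  have "\<forall>\<^sub>F T in at_top. ?I T = bump_mass * \<psi> x + ?I R0"
    using eventually_ge_at_top[of "max (2 * R0) (norm x + 1)"]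
  proof eventually_elim
    case (elim T)
    have "2 * R0\<^sup>2 \<le> 4 * R0\<^sup>2" by (intro mult_right_mono) auto
    also have "\<dots> = (2 * R0)\<^sup>2" by (simp add: power_mult_distrib)
    also have "\<dots> \<le> T\<^sup>2" using elim R0_pos by (intro power_mono) auto
    finally have RT: "2 * R0\<^sup>2 \<le> T\<^sup>2" .
    have "bump_mass * \<psi> x = integral UNIV (\<lambda>y. out_wave \<kappa> (y - x) * (comm 0 T \<psi> p1 y - comm 0 R0 \<psi> p1 y))"
      using elim R0_pos x far RT by (intro annulus_representation) auto
    also have "\<dots> = ?I T - ?I R0"
      unfolding right_diff_distrib using elim x R0_pos by (intro integral_diff int) auto
    finally show ?case by simp
  qed
  then have "((\<lambda>T. ?I T) \<longlongrightarrow> bump_mass * \<psi> x + ?I R0) at_top"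
    by (rule tendsto_eventually)
  with comm_integral_tendsto_0[of x] have "bump_mass * \<psi> x + ?I R0 = 0"
    using tendsto_unique trivial_limit_at_top_linorder by blast
  then show ?thesis by (simp add: add_eq_0_iff)
qed

end

section \<open>Analyticity along lines\<close>

text \<open>Differentiation under the integral over a box. The kernel has to be holomorphic only for
  y near the support of \<open>g\<close>; elsewhere the factor \<open>g\<close> is zero and hides
  whatever the branch of the square root does.\<close>

lemma holomorphic_integral_kernel:
  fixes g :: "'a::euclidean_space \<Rightarrow> complex" and H H' :: "complex \<Rightarrow> 'a \<Rightarrow> complex"
  assumes U: "open U" "convex U"
    and g: "continuous_on UNIV g" "bounded C" "closed C" "\<And>y. y \<notin> C \<Longrightarrow> g y = 0"
    and N: "open N" "C \<subseteq> N"
    and H: "\<And>z y. z \<in> U \<Longrightarrow> y \<in> N \<Longrightarrow> ((\<lambda>z. H z y) has_field_derivative H' z y) (at z)"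
    and cH: "\<And>z. z \<in> U \<Longrightarrow> continuous_on N (H z)"
    and cH': "continuous_on (U \<times> N) (\<lambda>(z, y). H' z y)"
  shows "(\<lambda>z. integral UNIV (\<lambda>y. g y * H z y)) holomorphic_on U"
proof -
  obtain a where a: "C \<subseteq> cbox (-a) a"
    using bounded_subset_cbox_symmetric[OF g(2)] by blast
  have oC: "open (- C)" using g(3) by auto
  have "(\<lambda>z. integral (cbox (-a) a) (\<lambda>y. g y * H z y)) holomorphic_on U"
  proof (rule leibniz_rule_holomorphic[where fx = "\<lambda>z y. g y * H' z y"])
    show "((\<lambda>z. g y * H z y) has_field_derivative g y * H' z y) (at z within U)" if "z \<in> U" for z y
    proof (cases "y \<in> C")
      case True
      then have "y \<in> N" using N by auto
      from DERIV_cmult[OF H[OF that this]] show ?thesis by (rule has_field_derivative_at_within)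
    qed (use g in auto)
    show "(\<lambda>y. g y * H z y) integrable_on cbox (-a) a" if "z \<in> U" for z
    proof (rule integrable_continuous)
      have "continuous_on N (\<lambda>y. g y * H z y)"
        by (intro continuous_on_mult cH[OF that] continuous_on_subset[OF g(1)]) simp
      moreover have "continuous_on (- C) (\<lambda>y. g y * H z y) \<longleftrightarrow> continuous_on (- C) (\<lambda>_. 0::complex)"
        by (intro continuous_on_cong) (use g in auto)
      ultimately have "continuous_on (N \<union> - C) (\<lambda>y. g y * H z y)"
        using N(1) oC by (intro continuous_on_open_Un) auto
      then show "continuous_on (cbox (-a) a) (\<lambda>y. g y * H z y)"
        by (rule continuous_on_subset) (use N in auto)
    qed
    show "continuous_on (U \<times> cbox (-a) a) (\<lambda>(z, y). g y * H' z y)"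
    proof -
      have "continuous_on (U \<times> N) (\<lambda>p. g (snd p) * (case p of (z, y) \<Rightarrow> H' z y))"
        by (intro continuous_on_mult cH' continuous_on_compose2[OF g(1) continuous_on_snd[OF continuous_on_id]]) auto
      then have "continuous_on (U \<times> N) (\<lambda>(z, y). g y * H' z y)" by (simp add: split_def)
      moreover have "continuous_on (U \<times> - C) (\<lambda>(z, y). g y * H' z y) \<longleftrightarrow> continuous_on (U \<times> - C) (\<lambda>_. 0::complex)"
        by (intro continuous_on_cong) (use g in auto)
      ultimately have "continuous_on (U \<times> N \<union> U \<times> - C) (\<lambda>(z, y). g y * H' z y)"
        using U N(1) oC by (intro continuous_on_open_Un open_Times) auto
      then show ?thesis
        by (rule continuous_on_subset) (use N in auto)
    qed
  qed (use U in auto)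
  moreover have "integral UNIV (\<lambda>y. g y * H z y) = integral (cbox (-a) a) (\<lambda>y. g y * H z y)" for z
  proof (rule integral_UNIV_support)
    fix y assume "y \<notin> cbox (-a) a"
    then have "y \<notin> C" using a by blast
    then show "g y * H z y = 0" using g(4) by simp
  qed
  ultimately show ?thesis by simp
qed

text \<open>The non-constant terms have modulus at most 2/3 + 1/9 < 1. This keeps the squared
  distance at a complex position off the branch cut of \<open>csqrt\<close>.\<close>

lemma Re_quadratic_pos:
  fixes z :: complex
  assumes "cmod z * B \<le> 1 / 3" "\<bar>\<alpha>\<bar> \<le> B"
  shows "Re (1 + 2 * z * of_real \<alpha> + z ^ 2 * of_real (B\<^sup>2)) > 0"
proof -
  have B: "B \<ge> 0" using assms(2) by linarith
  have "cmod (2 * z * of_real \<alpha> + z ^ 2 * of_real (B\<^sup>2)) \<le> cmod (2 * z * of_real \<alpha>) + cmod (z ^ 2 * of_real (B\<^sup>2))"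
    by (rule norm_triangle_ineq)
  also have "\<dots> = 2 * (cmod z * \<bar>\<alpha>\<bar>) + (cmod z * B)\<^sup>2"
    by (simp add: norm_mult norm_power power_mult_distrib)
  also have "\<dots> \<le> 2 * (1 / 3) + (1 / 3)\<^sup>2"
  proof (intro add_mono mult_left_mono power_mono)
    show "cmod z * \<bar>\<alpha>\<bar> \<le> 1 / 3"
      using assms by (meson mult_left_mono norm_ge_zero order_trans)
  qed (use assms B in auto)
  also have "\<dots> < 1" by (simp add: power2_eq_square)
  finally have "\<bar>Re (2 * z * of_real \<alpha> + z ^ 2 * of_real (B\<^sup>2))\<bar> < 1"
    using abs_Re_le_cmod le_less_trans by blast
  then show ?thesis by (simp add: add.assoc)
qed

lemma Re_pos_not_nonpos_Reals: "Re z > 0 \<Longrightarrow> z \<notin> \<real>\<^sub>\<le>\<^sub>0"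
  unfolding complex_nonpos_Reals_iff by simp

lemma csqrt_of_real_sq: "r \<ge> 0 \<Longrightarrow> csqrt (of_real (r\<^sup>2)) = of_real r"
  using csqrt_square[of "complex_of_real r"] by fastforce

lemma norm_line_sq:
  fixes y p d :: "'a::real_inner"
  assumes "norm d = 1"
  shows "(norm (y - (p + t *\<^sub>R d)))\<^sup>2 = t\<^sup>2 + 2 * t * - ((y - p) \<bullet> d) + (norm (y - p))\<^sup>2"
proof -
  have "d \<bullet> d = 1" using assms by (simp add: norm_eq_1)
  then show ?thesis
    unfolding power2_norm_eq_inner by (simp add: algebra_simps inner_commute power2_eq_square)
qed

text \<open>Real analyticity is encoded by local holomorphic extensions, which are what kernel
  integrals provide and what the complex identity theorem consumes.\<close>

definition analytic_line :: "(real \<Rightarrow> complex) \<Rightarrow> bool" where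
  "analytic_line u \<longleftrightarrow> (\<forall>t0. \<exists>d>0. \<exists>F. F holomorphic_on ball 0 d \<and> (\<forall>t. \<bar>t\<bar> < d \<longrightarrow> u (t0 + t) = F (of_real t)))"

lemma of_real_islimpt:
  assumes "e > 0"
  shows "complex_of_real a islimpt (of_real ` {t. \<bar>t - a\<bar> < e})"
  unfolding islimpt_approachable
proof (intro allI impI)
  fix r :: real assume "r > 0"
  then show "\<exists>x'\<in>of_real ` {t. \<bar>t - a\<bar> < e}. x' \<noteq> complex_of_real a \<and> dist x' (complex_of_real a) < r"
    using assms by (intro bexI[of _ "of_real (a + min e r / 2)"])
      (auto simp: dist_norm min_def simp flip: of_real_diff of_real_add)
qed

text \<open>The points near which u vanishes form an open set. It is also closed: at a limit point,
  the local extension vanishes on a real interval inside its disc, hence on the whole disc.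
  Connectedness of the line does the rest.\<close>

lemma analytic_line_identity:
  assumes u: "analytic_line u" and e: "e > 0" "\<And>t. \<bar>t - a\<bar> < e \<Longrightarrow> u t = 0"
  shows "u t = 0"
proof -
  define Z where "Z = {t0. \<exists>d>0. \<forall>t. \<bar>t - t0\<bar> < d \<longrightarrow> u t = 0}"
  have "open Z"
    unfolding open_dist
  proof
    fix t0 assume "t0 \<in> Z"
    then obtain d where d: "d > 0" "\<And>t. \<bar>t - t0\<bar> < d \<Longrightarrow> u t = 0" by (auto simp: Z_def)
    show "\<exists>r>0. \<forall>t1. dist t1 t0 < r \<longrightarrow> t1 \<in> Z"
    proof (intro exI[of _ "d / 2"] conjI allI impI)
      fix t1 assume "dist t1 t0 < d / 2"
      then have "\<bar>t1 - t0\<bar> < d / 2" by (simp add: dist_real_def)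
      then have "\<forall>t. \<bar>t - t1\<bar> < d / 2 \<longrightarrow> u t = 0"
        by (intro allI impI d(2)) (simp only: abs_less_iff, linarith)
      then show "t1 \<in> Z" unfolding Z_def using d(1) half_gt_zero by blast
    qed (use d in auto)
  qed
  moreover have "closed Z"
    unfolding closure_subset_eq[symmetric]
  proof
    fix t0 assume "t0 \<in> closure Z"
    then have cl: "\<forall>e>0. \<exists>y\<in>Z. dist y t0 < e" by (simp add: closure_approachable)
    obtain d F where d: "d > 0" and F: "F holomorphic_on ball 0 d"
      and uF: "\<And>t. \<bar>t\<bar> < d \<Longrightarrow> u (t0 + t) = F (of_real t)"
      using u unfolding analytic_line_def by blast
    obtain t1 where t1: "t1 \<in> Z" "\<bar>t1 - t0\<bar> < d" using cl d by (auto simp: dist_real_def)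
    obtain r where r: "r > 0" "\<And>t. \<bar>t - t1\<bar> < r \<Longrightarrow> u t = 0" using t1 by (auto simp: Z_def)
    \<comment> \<open>Short enough for the interval about t1 to lie both in the disc about t0 and in
      the zero interval.\<close>
    define q where "q = min r (d - \<bar>t1 - t0\<bar>)"
    have q: "q > 0" "q \<le> r" "q \<le> d - \<bar>t1 - t0\<bar>" using r t1 by (auto simp: q_def)
    let ?V = "complex_of_real ` {t. \<bar>t - (t1 - t0)\<bar> < q}"
    have F0: "F z = 0" if "z \<in> ball 0 d" for z
    proof (rule analytic_continuation[OF F, of ?V "of_real (t1 - t0)"])
      show "?V \<subseteq> ball 0 d" using q by (auto simp: abs_less_iff)
      show "F w = 0" if w: "w \<in> ?V" for w
      proof -
        obtain t where t: "w = of_real t" "\<bar>t - (t1 - t0)\<bar> < q" using w by auto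
        have "\<bar>t\<bar> < d" "\<bar>t0 + t - t1\<bar> < r" using t(2) q(2,3) by linarith+
        then show ?thesis using uF r(2) t(1) by metis
      qed
      show "complex_of_real (t1 - t0) islimpt ?V" by (rule of_real_islimpt[OF q(1)])
      have "norm (complex_of_real (t1 - t0)) < d" unfolding norm_of_real by (rule t1)
      then show "complex_of_real (t1 - t0) \<in> ball 0 d" by simp
    qed (use that in auto)
    have "u t = 0" if "\<bar>t - t0\<bar> < d" for t
      using uF[OF that] F0[of "of_real (t - t0)"] that by (simp del: of_real_diff)
    then show "t0 \<in> Z" using d by (auto simp: Z_def)
  qed
  moreover have "a \<in> Z" using e by (auto simp: Z_def)
  ultimately have "Z = UNIV" using clopen[of Z] by auto
  then have "t \<in> Z" by simp
  then show ?thesis by (auto simp: Z_def)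
qed

lemma holomorphic_on_ball_cnj:
  assumes "F holomorphic_on ball 0 d"
  shows "(\<lambda>z. cnj (F (cnj z))) holomorphic_on ball 0 d"
proof -
  have "cnj ` ball 0 d = ball (0::complex) d"
  proof
    show "ball 0 d \<subseteq> cnj ` ball 0 d"
    proof
      fix z :: complex assume "z \<in> ball 0 d"
      then show "z \<in> cnj ` ball 0 d" by (intro image_eqI[of _ _ "cnj z"]) auto
    qed
  qed auto
  then have "cnj \<circ> F \<circ> cnj holomorphic_on ball 0 d"
    using assms by (intro holomorphic_on_compose_cnj_cnj) auto
  then show ?thesis by (simp add: o_def)
qed

text \<open>Taking imaginary parts is not holomorphic, but on the real axis the reflection cnj (F
  (cnj z)) is the conjugate of F, so the difference quotient by 2 i extends it.\<close>

lemma analytic_line_Im: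
  assumes "analytic_line u"
  shows "analytic_line (\<lambda>t. of_real (Im (u t)))"
  unfolding analytic_line_def
proof
  fix t0
  obtain d F where d: "d > 0" and F: "F holomorphic_on ball 0 d"
    and uF: "\<And>t. \<bar>t\<bar> < d \<Longrightarrow> u (t0 + t) = F (of_real t)"
    using assms unfolding analytic_line_def by blast
  let ?G = "\<lambda>z. (F z - cnj (F (cnj z))) / (2 * \<i>)"
  have "?G holomorphic_on ball 0 d"
    using F holomorphic_on_ball_cnj[OF F] by (intro holomorphic_intros) auto
  moreover have "of_real (Im (u (t0 + t))) = ?G (of_real t)" if "\<bar>t\<bar> < d" for t
    unfolding uF[OF that] by (simp add: complex_eq_iff)
  ultimately show "\<exists>d>0. \<exists>F. F holomorphic_on ball 0 d \<and> (\<forall>t. \<bar>t\<bar> < d \<longrightarrow> of_real (Im (u (t0 + t))) = F (of_real t))"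
    using d by blast
qed

text \<open>Meant for c = pi / \<kappa>: along such a sequence exp (2 i \<kappa> s) keeps one value,
  and the points 1/s accumulate at the centre of the disc.\<close>

lemma reciprocal_islimpt_0:
  assumes "c > 0" "b \<ge> 0"
  shows "(0::complex) islimpt {of_real (1 / s) | s. s > S \<and> (\<exists>n::nat. s = c * (real n + b))}"
  unfolding islimpt_approachable
proof (intro allI impI)
  fix r :: real assume r: "r > 0"
  obtain n :: nat where n: "real n > max (max S 0 / c) (1 / (r * c))" using reals_Archimedean2 by blast
  define s where "s = c * (real n + b)"
  have "max S 0 / c < real n + b" "1 / (r * c) < real n + b" using n assms(2) by auto
  then have s: "s > max S 0" "s > 1 / r" using assms(1) r by (auto simp: s_def field_simps)
  then have s': "s > 0" "s > S" "1 / s < r" using r by (auto simp: field_simps)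
  show "\<exists>x'\<in>{of_real (1 / s) | s. s > S \<and> (\<exists>n::nat. s = c * (real n + b))}. x' \<noteq> (0::complex) \<and> dist x' 0 < r"
  proof (rule bexI[of _ "of_real (1 / s)"])
    have "dist (complex_of_real (1 / s)) 0 = \<bar>1 / s\<bar>" by (simp only: dist_norm diff_0_right norm_of_real)
    then show "complex_of_real (1 / s) \<noteq> 0 \<and> dist (complex_of_real (1 / s)) 0 < r" using s' by simp
    show "complex_of_real (1 / s) \<in> {of_real (1 / s) | s. s > S \<and> (\<exists>n::nat. s = c * (real n + b))}"
      using s'(2) s_def by blast
  qed
qed

text \<open>
  At \<open>s = n \<pi> / \<kappa>\<close> the hypothesis makes \<open>F\<close> agree with its reflection \<open>cnj F(cnj z)\<close>, and at
  \<open>s = (n + 1/2) \<pi> / \<kappa>\<close> with minus its reflection; both sets of points \<open>1 / s\<close> accumulate at \<open>0\<close>.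
\<close>

lemma real_outgoing_asymptotics_zero:
  assumes F: "F holomorphic_on ball 0 d" and d: "d > 0" and \<kappa>: "\<kappa> > 0"
    and r: "\<And>s. s > S \<Longrightarrow> Im (exp (\<i> * of_real \<kappa> * of_real s) * F (of_real (1 / s))) = 0"
    and z: "z \<in> ball 0 d"
  shows "F z = 0"
proof -
  define S' where "S' = max (max S 0) (1 / d)"
  let ?G = "\<lambda>z. cnj (F (cnj z))"
  have G: "?G holomorphic_on ball 0 d" by (rule holomorphic_on_ball_cnj[OF F])
  \<comment> \<open>At the sample points exp (2 i \<kappa> s) = 1/c, so reality of exp (i \<kappa>
    s) F says there that F is c times its reflection, and the identity theorem extends this to the
    disc. The offsets 0 and 1/2 yield c = 1 and c = -1.\<close>
  have key: "F z = c * ?G z" if c: "b \<ge> 0" "\<And>n::nat. exp (2 * \<i> * of_real (pi * (real n + b))) = 1 / c" "c \<noteq> 0" for b c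
  proof -
    have "F z - c * ?G z = 0"
    proof (rule analytic_continuation[where f = "\<lambda>z. F z - c * ?G z" and S = "ball 0 d" and \<xi> = 0 and
        U = "{of_real (1 / s) | s. s > S' \<and> (\<exists>n::nat. s = pi / \<kappa> * (real n + b))}"])
      show "(\<lambda>z. F z - c * ?G z) holomorphic_on ball 0 d" using F G by (intro holomorphic_intros)
      show "0 islimpt {complex_of_real (1 / s) | s. s > S' \<and> (\<exists>n::nat. s = pi / \<kappa> * (real n + b))}"
        using \<kappa> c(1) by (intro reciprocal_islimpt_0) auto
      show "{complex_of_real (1 / s) | s. s > S' \<and> (\<exists>n::nat. s = pi / \<kappa> * (real n + b))} \<subseteq> ball 0 d"
      proof
        fix w assume "w \<in> {complex_of_real (1 / s) | s. s > S' \<and> (\<exists>n::nat. s = pi / \<kappa> * (real n + b))}"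
        then obtain s where s: "w = of_real (1 / s)" "s > S'" by blast
        have "1 / d < s" "s > 0" using s by (auto simp: S'_def)
        then have "\<bar>1 / s\<bar> < d" using d by (simp add: field_simps)
        then have "norm w < d" unfolding s(1) norm_of_real .
        then show "w \<in> ball 0 d" by simp
      qed
    next
      fix w assume "w \<in> {complex_of_real (1 / s) | s. s > S' \<and> (\<exists>n::nat. s = pi / \<kappa> * (real n + b))}"
      then obtain s n where s: "w = of_real (1 / s)" "s > S'" "s = pi / \<kappa> * (real n + b)" by blast
      let ?E = "exp (\<i> * of_real \<kappa> * of_real s)"
      have "Im (?E * F w) = 0" using r[of s] s by (simp add: S'_def)
      then have "cnj (?E * F w) = ?E * F w" by (simp add: complex_eq_iff)
      moreover have "cnj ?E = inverse ?E" by (simp add: exp_cnj exp_minus)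
      moreover have "cnj w = w" using s by simp
      ultimately have "inverse ?E * ?G w = ?E * F w" by simp
      then have "?G w = ?E * ?E * F w" by (simp add: field_simps)
      also have "?E * ?E = exp (2 * \<i> * of_real (pi * (real n + b)))"
      proof -
        have "\<kappa> * s = pi * (real n + b)" using s(3) \<kappa> by simp
        moreover have "?E * ?E = exp (2 * \<i> * of_real (\<kappa> * s))" by (simp add: exp_add[symmetric] mult_ac)
        ultimately show ?thesis by simp
      qed
      also have "\<dots> = 1 / c" by (rule c)
      finally show "F w - c * ?G w = 0" using c(3) by simp
    qed (use d z in auto)
    then show ?thesis by simp
  qed
  have "F z = 1 * ?G z"
    by (rule key[of 0]) (auto simp: exp_eq_1 intro!: exI[of _ "of_nat _"])
  moreover have "F z = - 1 * ?G z"
  proof (rule key[of "1/2"])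
    fix n :: nat
    have "2 * \<i> * of_real (pi * (real n + 1 / 2)) = \<i> * of_real (2 * real n * pi) + \<i> * of_real pi"
      by (simp add: algebra_simps)
    then have "exp (2 * \<i> * of_real (pi * (real n + 1 / 2))) = exp (\<i> * of_real (2 * real n * pi)) * exp (\<i> * of_real pi)"
      by (simp only: exp_add)
    also have "exp (\<i> * of_real (2 * real n * pi)) = 1"
      by (auto simp: exp_eq_1 intro!: exI[of _ "int n"])
    also have "1 * exp (\<i> * of_real pi) = 1 / (- 1)" by simp
    finally show "exp (2 * \<i> * of_real (pi * (real n + 1 / 2))) = 1 / (- 1)" .
  qed auto
  ultimately show ?thesis by simp
qed

section \<open>Solutions along a line at complex parameters\<close>

context helmholtz_solution
begin

text \<open>The squared distance from y to x0 + t d is a quadratic polynomial in t, so it makes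
  sense for complex t. For y in the shell and small t its real part stays positive, and the
  principal root continues the distance in \<open>local_representation\<close>.\<close>

lemma analytic_along_line:
  assumes d: "norm d = 1" and line: "\<And>t. p + t *\<^sub>R d \<in> W"
  shows "analytic_line (\<lambda>t. \<psi> (p + t *\<^sub>R d))"
  unfolding analytic_line_def
proof
  fix t0
  define x0 where "x0 = p + t0 *\<^sub>R d"
  obtain r where r: "r > 0" "cball x0 (2 * r) \<subseteq> W"
  proof -
    obtain e where e: "e > 0" "cball x0 e \<subseteq> W"
      using open_W line[of t0] unfolding open_contains_cball x0_def by blast
    show ?thesis by (rule that[of "e / 2"]) (use e in auto)
  qed
  define g where "g = comm x0 r \<psi> p1"
  define C where "C = cball x0 (2 * r) \<inter> {y. r \<le> norm (y - x0)}"
  \<comment> \<open>An open neighbourhood of the shell. Together with the disc of radius r/4 it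
    ensures |z| <= |y - x0| / 3, which is the hypothesis of \<open>Re_quadratic_pos\<close> after
    division by the squared distance.\<close>
  define N where "N = {y. 3 / 4 * r < norm (y - x0)}"
  define q where "q z y = (norm (y - x0))\<^sup>2 + 2 * z * of_real (- ((y - x0) \<bullet> d)) + z ^ 2" for z :: complex and y
  define H where "H z y = exp (\<i> * of_real \<kappa> * csqrt (q z y)) / csqrt (q z y)" for z y
  define H' where "H' z y = (\<i> * of_real \<kappa> / csqrt (q z y) - 1 / csqrt (q z y) ^ 2) * exp (\<i> * of_real \<kappa> * csqrt (q z y)) *
     ((2 * of_real (- ((y - x0) \<bullet> d)) + 2 * z) / (2 * csqrt (q z y)))" for z y
  have g0: "g y = 0" if "y \<notin> C" for y
  proof -
    have "2 * r\<^sup>2 \<le> (norm (y - x0))\<^sup>2" if "2 * r < norm (y - x0)"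
    proof -
      have "2 * r\<^sup>2 \<le> 4 * r\<^sup>2" by (intro mult_right_mono) auto
      also have "\<dots> = (2 * r)\<^sup>2" by (simp add: power_mult_distrib)
      also have "\<dots> \<le> (norm (y - x0))\<^sup>2" using that r by (intro power_mono) auto
      finally show ?thesis .
    qed
    then show ?thesis
      using that unfolding g_def C_def by (intro comm_eq_0 r) (auto simp: dist_norm norm_minus_commute)
  qed
  have cg: "continuous_on UNIV g"
    unfolding g_def by (rule continuous_on_UNIV_compact_support[OF open_W compact_cball r(2) continuous_on_comm[OF r(1) data]])
      (use g0 in \<open>auto simp: g_def C_def\<close>)
  have clC: "closed C" unfolding C_def by (intro closed_Int closed_cball closed_Collect_le continuous_intros)
  have Re: "Re (q z y) > 0" if z: "z \<in> ball 0 (r / 4)" and y: "y \<in> N" for z y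
  proof -
    define \<rho> where "\<rho> = norm (y - x0)"
    have \<rho>: "\<rho> > 3 / 4 * r" "\<rho> > 0" using y r by (auto simp: N_def \<rho>_def)
    have "Re (1 + 2 * (z / of_real (\<rho>\<^sup>2)) * of_real (- ((y - x0) \<bullet> d)) + (z / of_real (\<rho>\<^sup>2)) ^ 2 * of_real (\<rho>\<^sup>2)) > 0"
    proof (rule Re_quadratic_pos)
      have "cmod z \<le> \<rho> / 3" using z \<rho> by simp
      then show "cmod (z / of_real (\<rho>\<^sup>2)) * \<rho> \<le> 1 / 3"
        using \<rho> unfolding norm_divide norm_of_real by (simp add: field_simps power2_eq_square)
      show "\<bar>- ((y - x0) \<bullet> d)\<bar> \<le> \<rho>"
        using Cauchy_Schwarz_ineq2[of "y - x0" d] d by (simp add: \<rho>_def)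
    qed
    moreover have "q z y = of_real (\<rho>\<^sup>2) * (1 + 2 * (z / of_real (\<rho>\<^sup>2)) * of_real (- ((y - x0) \<bullet> d)) + (z / of_real (\<rho>\<^sup>2)) ^ 2 * of_real (\<rho>\<^sup>2))"
      using \<rho> unfolding q_def \<rho>_def[symmetric] by (simp add: field_simps power2_eq_square)
    ultimately show ?thesis using \<rho> by (simp del: of_real_power)
  qed
  have nz: "csqrt (q z y) \<noteq> 0" if "z \<in> ball 0 (r / 4)" "y \<in> N" for z y
    using Re[OF that] by auto
  have cq0: "continuous_on (ball 0 (r / 4) \<times> N) (\<lambda>w. q (fst w) (snd w))"
    unfolding q_def by (intro continuous_intros)
  have cq: "continuous_on (ball 0 (r / 4) \<times> N) (\<lambda>w. csqrt (q (fst w) (snd w)))"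
    by (rule continuous_on_compose2[OF continuous_on_csqrt cq0])
      (use Re Re_pos_not_nonpos_Reals in fastforce)
  have hol: "(\<lambda>z. integral UNIV (\<lambda>y. g y * H z y)) holomorphic_on ball 0 (r / 4)"
  proof (rule holomorphic_integral_kernel[OF _ _ cg _ clC g0])
    show "bounded C" unfolding C_def by (intro bounded_Int) auto
    show "open N" unfolding N_def by (intro open_Collect_less continuous_intros)
    show "C \<subseteq> N" using r by (auto simp: C_def N_def)
    show "((\<lambda>z. H z y) has_field_derivative H' z y) (at z)" if zy: "z \<in> ball 0 (r / 4)" "y \<in> N" for z y
    proof -
      have 1: "((\<lambda>z. csqrt (q z y)) has_field_derivative
         (2 * of_real (- ((y - x0) \<bullet> d)) + 2 * z) / (2 * csqrt (q z y))) (at z)"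
        by (rule has_field_derivative_csqrt')
          (use Re_pos_not_nonpos_Reals[OF Re[OF zy]] in \<open>auto simp: q_def intro!: derivative_eq_intros\<close>)
      have 2: "((\<lambda>w. exp (\<i> * of_real \<kappa> * w) / w) has_field_derivative
         (\<i> * of_real \<kappa> / csqrt (q z y) - 1 / csqrt (q z y) ^ 2) * exp (\<i> * of_real \<kappa> * csqrt (q z y))) (at (csqrt (q z y)))"
        using nz[OF zy] by (auto intro!: derivative_eq_intros simp: field_simps power2_eq_square)
      show ?thesis using DERIV_chain2[OF 2 1] by (simp add: H_def H'_def)
    qed
    show "continuous_on N (H z)" if "z \<in> ball 0 (r / 4)" for z
    proof -
      have "continuous_on N (\<lambda>y. csqrt (q (fst (z, y)) (snd (z, y))))"
        by (rule continuous_on_compose2[OF cq]) (use that in \<open>auto intro!: continuous_intros\<close>)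
      then show ?thesis unfolding H_def[abs_def]
        using nz[OF that] by (auto intro!: continuous_intros)
    qed
    show "continuous_on (ball 0 (r / 4) \<times> N) (\<lambda>(z, y). H' z y)"
      unfolding H'_def split_def using cq cq0 nz by (auto intro!: continuous_intros)
  qed (use r in auto)
  show "\<exists>\<delta>>0. \<exists>F. F holomorphic_on ball 0 \<delta> \<and> (\<forall>t. \<bar>t\<bar> < \<delta> \<longrightarrow> \<psi> (p + (t0 + t) *\<^sub>R d) = F (of_real t))"
  proof (intro exI conjI allI impI)
    show "r / 4 > 0" using r by simp
    show "(\<lambda>z. integral UNIV (\<lambda>y. g y * H z y) / bump_mass) holomorphic_on ball 0 (r / 4)"
      using hol bump_mass_nonzero by (intro holomorphic_intros)
    fix t :: real assume t: "\<bar>t\<bar> < r / 4"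
    have eq: "p + (t0 + t) *\<^sub>R d = x0 + t *\<^sub>R d" by (simp add: x0_def algebra_simps)
    have "x0 + t *\<^sub>R d \<in> ball x0 r" using t d r by (simp add: dist_norm)
    from local_representation[OF r this]
    have "bump_mass * \<psi> (x0 + t *\<^sub>R d) = integral UNIV (\<lambda>y. out_wave \<kappa> (y - (x0 + t *\<^sub>R d)) * g y)"
      by (simp add: g_def)
    also have "(\<lambda>y. out_wave \<kappa> (y - (x0 + t *\<^sub>R d)) * g y) = (\<lambda>y. g y * H (of_real t) y)"
    proof
      fix y
      have "q (of_real t) y = of_real ((norm (y - (x0 + t *\<^sub>R d)))\<^sup>2)"
        unfolding norm_line_sq[OF d] q_def by simp
      then have "csqrt (q (of_real t) y) = of_real (norm (y - (x0 + t *\<^sub>R d)))"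
        using csqrt_of_real_sq[of "norm (y - (x0 + t *\<^sub>R d))"] by simp
      then show "out_wave \<kappa> (y - (x0 + t *\<^sub>R d)) * g y = g y * H (of_real t) y"
        by (simp add: H_def out_wave_def)
    qed
    finally show "\<psi> (p + (t0 + t) *\<^sub>R d) = integral UNIV (\<lambda>y. g y * H (of_real t) y) / bump_mass"
      using bump_mass_nonzero unfolding eq by (simp add: field_simps mult.commute)
  qed
qed

end

section \<open>Expansion at the far end of a line\<close>

context radiating_solution
begin

text \<open>
  With \<open>z = 1 / s\<close>, the distance from \<open>p + s d\<close> to \<open>y\<close> is \<open>s sqrt q\<close> with \<open>q = 1 + 2 z \<alpha> + z\<^sup>2 |y - p|\<^sup>2\<close>, and
  \<open>s (sqrt q - 1) = (q - 1) / (z (1 + sqrt q))\<close> stays holomorphic at \<open>z = 0\<close>.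
\<close>

lemma outgoing_asymptotics:
  assumes d: "norm d = 1"
  shows "\<exists>\<delta>>0. \<exists>S F. F holomorphic_on ball 0 \<delta> \<and> (\<forall>s>S. s > 0 \<and> 1 / s < \<delta> \<and>
    of_real s * \<psi> (p + s *\<^sub>R d) = exp (\<i> * of_real \<kappa> * of_real s) * F (of_real (1 / s)))"
proof -
  \<comment> \<open>Chosen so that the ball of radius B about p contains the shell; then |z| < 1/(3
    B) meets the bound 1/3 in \<open>Re_quadratic_pos\<close>.\<close>
  define B where "B = 2 * R0 + norm p + 1"
  have "norm p \<ge> 0" by simp
  then have B: "B > 0" "B \<ge> 2 * R0 + norm p" unfolding B_def using R0_pos by (linarith, simp)
  define g where "g = comm 0 R0 \<psi> p1"
  define C where "C = cball (0::real^3) (2 * R0) \<inter> {y. R0 \<le> norm y}"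
  define N where "N = ball p B"
  define \<alpha> where "\<alpha> y = - ((y - p) \<bullet> d)" for y
  define q where "q z y = 1 + 2 * z * of_real (\<alpha> y) + z ^ 2 * of_real ((norm (y - p))\<^sup>2)" for z :: complex and y
  define h where "h z y = (2 * of_real (\<alpha> y) + z * of_real ((norm (y - p))\<^sup>2)) / (1 + csqrt (q z y))" for z y
  define q' where "q' z y = (2 * of_real (\<alpha> y) + 2 * z * of_real ((norm (y - p))\<^sup>2)) / (2 * csqrt (q z y))" for z y
  define h' where "h' z y = (of_real ((norm (y - p))\<^sup>2) * (1 + csqrt (q z y)) -
      (2 * of_real (\<alpha> y) + z * of_real ((norm (y - p))\<^sup>2)) * q' z y) / (1 + csqrt (q z y)) ^ 2" for z y
  \<comment> \<open>At z = 1/s, with \<rho> the distance from y to the point of the line, this is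
    exp (i \<kappa> (\<rho> - s)) s / \<rho>: the kernel stripped of exp (i \<kappa> s) / s.\<close>
  define H where "H z y = exp (\<i> * of_real \<kappa> * h z y) / csqrt (q z y)" for z y
  define H' where "H' z y = (\<i> * of_real \<kappa> * h' z y * exp (\<i> * of_real \<kappa> * h z y) * csqrt (q z y) -
      exp (\<i> * of_real \<kappa> * h z y) * q' z y) / csqrt (q z y) ^ 2" for z y
  have g0: "g y = 0" if "y \<notin> C" for y
  proof -
    have "2 * R0\<^sup>2 \<le> (norm y)\<^sup>2" if "2 * R0 < norm y"
    proof -
      have "2 * R0\<^sup>2 \<le> 4 * R0\<^sup>2" by (intro mult_right_mono) auto
      also have "\<dots> = (2 * R0)\<^sup>2" by (simp add: power_mult_distrib)
      also have "\<dots> \<le> (norm y)\<^sup>2" using that R0_pos by (intro power_mono) auto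
      finally show ?thesis .
    qed
    then show ?thesis
      using that unfolding g_def C_def by (intro comm_eq_0 R0_pos) auto
  qed
  have clC: "closed C" unfolding C_def by (intro closed_Int closed_cball closed_Collect_le continuous_intros)
  have bC: "bounded C" unfolding C_def by (intro bounded_Int) auto
  have "compact C" using clC bC by (simp add: compact_eq_bounded_closed)
  moreover have "C \<subseteq> W" using far by (auto simp: C_def)
  ultimately have cg: "continuous_on UNIV g"
    unfolding g_def
    by (rule continuous_on_UNIV_compact_support[OF open_W _ _ continuous_on_comm[OF R0_pos data]])
      (use g0 in \<open>auto simp: g_def\<close>)
  let ?U = "ball (0::complex) (1 / (3 * B))"
  have Re: "Re (q z y) > 0" if z: "z \<in> ?U" and y: "y \<in> N" for z y
    unfolding q_def
  proof (rule Re_quadratic_pos)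
    have "norm (y - p) \<le> B" using y by (simp add: N_def dist_norm norm_minus_commute)
    then have "cmod z * norm (y - p) \<le> 1 / (3 * B) * B" using z B by (intro mult_mono) auto
    then show "cmod z * norm (y - p) \<le> 1 / 3" using B by simp
    show "\<bar>\<alpha> y\<bar> \<le> norm (y - p)"
      using Cauchy_Schwarz_ineq2[of "y - p" d] d by (simp add: \<alpha>_def)
  qed
  have nz: "q z y \<noteq> 0" if "z \<in> ?U" "y \<in> N" for z y
    using Re[OF that] by auto
  \<comment> \<open>The principal root has nonnegative real part, so the denominator of
    \<open>h\<close> has real part at least 1.\<close>
  have nz1: "1 + csqrt (q z y) \<noteq> 0" if "z \<in> ?U" "y \<in> N" for z y
  proof -
    have "Re (csqrt (q z y)) \<ge> 0" using csqrt_principal[of "q z y"] by linarith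
    then have "Re (1 + csqrt (q z y)) > 0" unfolding plus_complex.sel one_complex.sel by linarith
    then show ?thesis by (metis less_irrefl zero_complex.simps(1))
  qed
  have c\<alpha>: "continuous_on A (\<lambda>w. \<alpha> (f w))" if "continuous_on A f" for A :: "'z::topological_space set" and f
    unfolding \<alpha>_def using that by (intro continuous_intros)
  have cq0: "continuous_on (?U \<times> N) (\<lambda>w. q (fst w) (snd w))"
    unfolding q_def by (intro continuous_intros c\<alpha>)
  have cq: "continuous_on (?U \<times> N) (\<lambda>w. csqrt (q (fst w) (snd w)))"
    by (rule continuous_on_compose2[OF continuous_on_csqrt cq0])
      (use Re Re_pos_not_nonpos_Reals in fastforce)
  have cq': "continuous_on (?U \<times> N) (\<lambda>w. q' (fst w) (snd w))"
    unfolding q'_def using cq nz by (auto intro!: continuous_intros c\<alpha>)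
  have ch: "continuous_on (?U \<times> N) (\<lambda>w. h (fst w) (snd w))"
    unfolding h_def using cq nz1 by (auto intro!: continuous_intros c\<alpha>)
  have ch': "continuous_on (?U \<times> N) (\<lambda>w. h' (fst w) (snd w))"
    unfolding h'_def using cq cq' nz1 by (auto intro!: continuous_intros c\<alpha>)
  have hol: "(\<lambda>z. integral UNIV (\<lambda>y. g y * H z y)) holomorphic_on ?U"
  proof (rule holomorphic_integral_kernel[OF _ _ cg bC clC g0])
    show "open N" by (simp add: N_def)
    show "C \<subseteq> N"
    proof
      fix y assume "y \<in> C"
      then have "norm y \<le> 2 * R0" by (simp add: C_def)
      then have "norm (p - y) < B" using norm_triangle_ineq4[of p y] by (simp add: B_def)
      then show "y \<in> N" by (simp add: N_def dist_norm)
    qed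
    show "((\<lambda>z. H z y) has_field_derivative H' z y) (at z)" if zy: "z \<in> ?U" "y \<in> N" for z y
    proof -
      have 1: "((\<lambda>z. csqrt (q z y)) has_field_derivative q' z y) (at z)"
        unfolding q'_def
        by (rule has_field_derivative_csqrt')
          (use Re_pos_not_nonpos_Reals[OF Re[OF zy]] in \<open>auto simp: q_def intro!: derivative_eq_intros\<close>)
      have n: "((\<lambda>z. 2 * of_real (\<alpha> y) + z * of_real ((norm (y - p))\<^sup>2)) has_field_derivative of_real ((norm (y - p))\<^sup>2)) (at z)"
        by (auto intro!: derivative_eq_intros)
      have m: "((\<lambda>z. 1 + csqrt (q z y)) has_field_derivative q' z y) (at z)"
        using DERIV_add[OF DERIV_const 1] by simp
      have 2: "((\<lambda>z. h z y) has_field_derivative h' z y) (at z)"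
        using DERIV_divide[OF n m nz1[OF zy]] by (simp add: h_def h'_def power2_eq_square)
      have 3: "((\<lambda>z. exp (\<i> * of_real \<kappa> * h z y)) has_field_derivative
          \<i> * of_real \<kappa> * h' z y * exp (\<i> * of_real \<kappa> * h z y)) (at z)"
        by (rule DERIV_cong[OF DERIV_chain2[OF DERIV_exp DERIV_cmult[OF 2]]]) (simp only: mult_ac)
      show ?thesis
        using DERIV_divide[OF 3 1] nz[OF zy] by (simp add: H_def H'_def power2_eq_square)
    qed
    show "continuous_on N (H z)" if "z \<in> ?U" for z
    proof -
      have "continuous_on N (\<lambda>y. csqrt (q (fst (z, y)) (snd (z, y))))"
        by (rule continuous_on_compose2[OF cq]) (use that in \<open>auto intro!: continuous_intros\<close>)
      moreover have "continuous_on N (\<lambda>y. h (fst (z, y)) (snd (z, y)))"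
        by (rule continuous_on_compose2[OF ch]) (use that in \<open>auto intro!: continuous_intros\<close>)
      ultimately show ?thesis unfolding H_def[abs_def]
        using nz[OF that] by (auto intro!: continuous_intros)
    qed
    show "continuous_on (?U \<times> N) (\<lambda>(z, y). H' z y)"
      unfolding H'_def split_def using cq cq0 cq' ch ch' nz by (auto intro!: continuous_intros)
  qed auto
  let ?F = "\<lambda>z. - integral UNIV (\<lambda>y. g y * H z y) / bump_mass"
  have holF: "?F holomorphic_on ?U" using hol bump_mass_nonzero by (intro holomorphic_intros)
  \<comment> \<open>The threshold 3 B puts 1/s into the disc and the point of the line beyond 2 *
    R0, hence beyond the radius sqrt 2 * R0 asked for by
    \<open>exterior_representation\<close>.\<close>
  have eq: "of_real s * \<psi> (p + s *\<^sub>R d) = exp (\<i> * of_real \<kappa> * of_real s) * ?F (of_real (1 / s))"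
    if s: "s > 3 * B" for s
  proof -
    have s0: "s > 0" using s B by linarith
    have zU: "complex_of_real (1 / s) \<in> ?U"
    proof -
      have "\<bar>1 / s\<bar> < 1 / (3 * B)" using s s0 B by (simp add: frac_less2)
      then have "norm (complex_of_real (1 / s)) < 1 / (3 * B)" unfolding norm_of_real .
      then show ?thesis by simp
    qed
    have "2 * R0 < s - norm p" using s B norm_ge_zero[of p] by linarith
    also have "\<dots> \<le> norm (p + s *\<^sub>R d)"
      using norm_triangle_ineq2[of "s *\<^sub>R d" "- p"] d s0 by (simp add: add.commute)
    finally have n: "2 * R0 < norm (p + s *\<^sub>R d)" .
    have "2 * R0\<^sup>2 \<le> 4 * R0\<^sup>2" by (intro mult_right_mono) auto
    also have "\<dots> = (2 * R0)\<^sup>2" by (simp add: power_mult_distrib)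
    also have "\<dots> < (norm (p + s *\<^sub>R d))\<^sup>2" using n R0_pos by (intro power_strict_mono) auto
    finally have "bump_mass * \<psi> (p + s *\<^sub>R d) = - integral UNIV (\<lambda>y. out_wave \<kappa> (y - (p + s *\<^sub>R d)) * g y)"
      unfolding g_def by (rule exterior_representation)
    also have "(\<lambda>y. out_wave \<kappa> (y - (p + s *\<^sub>R d)) * g y) =
       (\<lambda>y. exp (\<i> * of_real \<kappa> * of_real s) / of_real s * (g y * H (of_real (1 / s)) y))"
    proof
      fix y
      show "out_wave \<kappa> (y - (p + s *\<^sub>R d)) * g y =
         exp (\<i> * of_real \<kappa> * of_real s) / of_real s * (g y * H (of_real (1 / s)) y)"
      proof (cases "y \<in> C")
        case True
        then have yN: "y \<in> N"
        proof -
          have "norm y \<le> 2 * R0" using True by (simp add: C_def)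
          then have "norm (p - y) < B" using norm_triangle_ineq4[of p y] by (simp add: B_def)
          then show "y \<in> N" by (simp add: N_def dist_norm)
        qed
        define \<rho> where "\<rho> = norm (y - (p + s *\<^sub>R d))"
        let ?z = "complex_of_real (1 / s)"
        have "\<rho>\<^sup>2 = s\<^sup>2 + 2 * s * \<alpha> y + (norm (y - p))\<^sup>2"
          unfolding \<rho>_def norm_line_sq[OF d] \<alpha>_def ..
        then have "(\<rho> / s)\<^sup>2 = 1 + 2 * (1 / s) * \<alpha> y + (1 / s)\<^sup>2 * (norm (y - p))\<^sup>2"
          using s0 by (simp add: field_simps power2_eq_square)
        then have qs: "q ?z y = of_real ((\<rho> / s)\<^sup>2)" unfolding q_def by simp
        then have csq: "csqrt (q ?z y) = of_real (\<rho> / s)"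
          using csqrt_of_real_sq[of "\<rho> / s"] s0 by (simp add: \<rho>_def)
        have "h ?z y = of_real s * (csqrt (q ?z y) - 1)"
        proof -
          have "(csqrt (q ?z y) - 1) * (1 + csqrt (q ?z y)) = q ?z y - 1"
            by (simp add: algebra_simps flip: power2_eq_square)
          also have "of_real s * (q ?z y - 1) = 2 * of_real (\<alpha> y) + ?z * of_real ((norm (y - p))\<^sup>2)"
            unfolding q_def using s0 by (simp add: field_simps power2_eq_square)
          finally show ?thesis unfolding h_def using nz1[OF zU yN] by (simp add: field_simps)
        qed
        also have "\<dots> = of_real (\<rho> - s)" unfolding csq using s0 by (simp add: field_simps)
        finally have h: "h ?z y = of_real \<rho> - of_real s" by simp
        have "out_wave \<kappa> (y - (p + s *\<^sub>R d)) = exp (\<i> * of_real \<kappa> * of_real s) / of_real s * H ?z y"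
          unfolding H_def h csq using s0
          by (simp add: out_wave_def \<rho>_def[symmetric] exp_diff right_diff_distrib)
        then show ?thesis by simp
      qed (use g0 in auto)
    qed
    also have "integral UNIV \<dots> = exp (\<i> * of_real \<kappa> * of_real s) / of_real s * integral UNIV (\<lambda>y. g y * H (of_real (1 / s)) y)"
      by simp
    finally show ?thesis using bump_mass_nonzero s0 by (simp add: field_simps)
  qed
  show ?thesis
  proof (intro exI conjI allI impI)
    show "1 / (3 * B) > 0" using B by simp
    show "?F holomorphic_on ?U" by (rule holF)
    fix s assume s: "s > 3 * B"
    show "s > 0" using s B by linarith
    then show "1 / s < 1 / (3 * B)" using s B by (simp add: frac_less2)
    show "of_real s * \<psi> (p + s *\<^sub>R d) = exp (\<i> * of_real \<kappa> * of_real s) * ?F (of_real (1 / s))"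
      by (rule eq[OF s])
  qed
qed

lemma zero_on_line:
  assumes d: "norm d = 1" and line: "\<And>t. p + t *\<^sub>R d \<in> W"
    and e: "e > 0" "\<And>t. \<bar>t\<bar> < e \<Longrightarrow> Im (\<psi> (p + t *\<^sub>R d)) = 0"
  shows "\<psi> (p + t *\<^sub>R d) = 0"
proof -
  have an: "analytic_line (\<lambda>t. \<psi> (p + t *\<^sub>R d))" by (rule analytic_along_line[OF d line])
  have "complex_of_real (Im (\<psi> (p + t *\<^sub>R d))) = 0" for t
    by (rule analytic_line_identity[OF analytic_line_Im[OF an] e(1), of 0]) (use e(2) in auto)
  then have Im: "Im (\<psi> (p + t *\<^sub>R d)) = 0" for t by simp
  obtain \<delta> S F where \<delta>: "\<delta> > 0" and F: "F holomorphic_on ball 0 \<delta>"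
    and asym: "\<And>s. s > S \<Longrightarrow> s > 0 \<and> 1 / s < \<delta> \<and>
      of_real s * \<psi> (p + s *\<^sub>R d) = exp (\<i> * of_real \<kappa> * of_real s) * F (of_real (1 / s))"
    using outgoing_asymptotics[OF d, of p] by blast
  have r: "Im (exp (\<i> * of_real \<kappa> * of_real s) * F (of_real (1 / s))) = 0" if "s > S" for s
  proof -
    have "exp (\<i> * of_real \<kappa> * of_real s) * F (of_real (1 / s)) = of_real s * \<psi> (p + s *\<^sub>R d)"
      using asym[OF that] by simp
    also have "Im \<dots> = 0" using Im[of s] by simp
    finally show ?thesis .
  qed
  have F0: "F z = 0" if "z \<in> ball 0 \<delta>" for z
    by (rule real_outgoing_asymptotics_zero[OF F \<delta> kappa_pos r that])
  have "\<psi> (p + s *\<^sub>R d) = 0" if "s > S" for s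
  proof -
    have "\<bar>1 / s\<bar> < \<delta>" using asym[OF that] by simp
    then have "norm (complex_of_real (1 / s)) < \<delta>" unfolding norm_of_real .
    then have F1: "F (of_real (1 / s)) = 0" by (intro F0) simp
    have "s > 0" and "of_real s * \<psi> (p + s *\<^sub>R d) = exp (\<i> * of_real \<kappa> * of_real s) * F (of_real (1 / s))"
      using asym[OF that] by blast+
    then show ?thesis unfolding F1 by simp
  qed
  \<comment> \<open>A second continuation, now of \<psi> itself, starting from the unit interval
    about S + 1 in the far part of the line.\<close>
  then show ?thesis
    by (rule analytic_line_identity[OF an zero_less_one, of "S + 1"]) auto
qed

end

section \<open>Uniqueness\<close>

lemma has_derivative_along_line:
  assumes "(f has_derivative f') (at (y + t *\<^sub>R b))"
  shows "((\<lambda>t. f (y + t *\<^sub>R b)) has_vector_derivative f' b) (at t)"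
proof -
  have "((\<lambda>t. y + t *\<^sub>R b) has_derivative (\<lambda>h. h *\<^sub>R b)) (at t)"
    by (auto intro!: derivative_eq_intros)
  from diff_chain_at[OF this assms] show ?thesis
    using has_derivative_linear[OF assms]
    by (simp add: has_vector_derivative_def o_def linear_cmul)
qed

text \<open>The complement of an exterior region is bounded, so U contains everything beyond some
  sphere. The data are coordinate components of the two derivatives in
  \<open>C2_on_closure\<close>.\<close>

lemma radiation_solution_radiating:
  assumes \<kappa>: "\<kappa> > 0" and U: "exterior_region U" and rs: "radiation_solution \<kappa> U \<psi>"
  shows "\<exists>p1 p2 R0. radiating_solution \<kappa> U \<psi> p1 p2 R0"
proof -
  obtain S where oU: "open U" and S: "bounded S" "U = outside S"
    using U by (auto simp: exterior_region_def)
  have "bounded (- U)" using cobounded_outside[OF S(1)] S(2) by simp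
  then obtain R where R: "R > 0" "- U \<subseteq> ball 0 R" using bounded_subset_ballD by blast
  have far: "{y. R \<le> norm y} \<subseteq> U"
  proof
    fix y :: "real^3" assume "y \<in> {y. R \<le> norm y}"
    then have "y \<notin> ball 0 R" by simp
    then show "y \<in> U" using R(2) by blast
  qed
  obtain Df D2f where c\<psi>: "continuous_on (closure U) \<psi>"
    and cD: "continuous_on (closure U) Df" "continuous_on (closure U) D2f"
    and D: "\<And>x. x \<in> U \<Longrightarrow> (\<psi> has_derivative blinfun_apply (Df x)) (at x)"
    and D2: "\<And>x. x \<in> U \<Longrightarrow> (Df has_derivative blinfun_apply (D2f x)) (at x)"
    using rs unfolding radiation_solution_def C2_on_closure_def by blast
  have helm: "\<And>x. x \<in> U \<Longrightarrow> - laplacian \<psi> x = of_real (\<kappa>\<^sup>2) * \<psi> x"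
    and som: "sommerfeld_radiation \<kappa> \<psi>"
    using rs by (auto simp: radiation_solution_def)
  note sub = continuous_on_subset[OF _ closure_subset]
  define p1 where "p1 b y = blinfun_apply (Df y) b" for b y
  define p2 where "p2 b y = blinfun_apply (blinfun_apply (D2f y) b) b" for b y
  have dp1: "(p1 b has_derivative (\<lambda>h. blinfun_apply (blinfun_apply (D2f y) h) b)) (at y)" if "y \<in> U" for b y
    unfolding p1_def[abs_def]
    by (rule bounded_linear.has_derivative[OF blinfun.bounded_linear_left D2[OF that]])
  have lap: "laplacian \<psi> x = (\<Sum>b\<in>Basis. p2 b x)" if x: "x \<in> U" for x
    unfolding laplacian_def
  proof (rule sum.cong[OF refl])
    fix b :: "real^3"
    have "((\<lambda>y. frechet_derivative \<psi> (at y) b) has_derivative (\<lambda>h. blinfun_apply (blinfun_apply (D2f x) h) b)) (at x)"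
    \<comment> \<open>The inner derivative in \<open>laplacian\<close> agrees with
      \<open>p1 b\<close> throughout the open set U, so the two have the same derivative at
      x.\<close>
    proof (rule has_derivative_transform_within_open[OF dp1[OF x] oU x])
      show "p1 b y = frechet_derivative \<psi> (at y) b" if "y \<in> U" for y
        unfolding p1_def frechet_derivative_at[OF D[OF that]] ..
    qed
    from frechet_derivative_at[OF this]
    show "frechet_derivative (\<lambda>y. frechet_derivative \<psi> (at y) b) (at x) b = p2 b x"
      unfolding p2_def by metis
  qed
  have eu: "euler p1 y = blinfun_apply (Df y) y" for y
  proof -
    have "blinfun_apply (Df y) y = blinfun_apply (Df y) (\<Sum>b\<in>Basis. (y \<bullet> b) *\<^sub>R b)"
      by (simp add: euclidean_representation)
    also have "\<dots> = euler p1 y"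
      unfolding blinfun.sum_right blinfun.scaleR_right euler_def p1_def by (simp only: scaleR_conv_of_real)
    finally show ?thesis by simp
  qed
  have "radiating_solution \<kappa> U \<psi> p1 p2 R"
  proof
    show "C2_data U \<psi> p1 p2"
      unfolding C2_data_def
    proof (intro conjI ballI)
      show "continuous_on U \<psi>" by (rule sub[OF c\<psi>])
      fix b :: "real^3" assume "b \<in> Basis"
      show "continuous_on U (p1 b)" "continuous_on U (p2 b)"
        unfolding p1_def[abs_def] p2_def[abs_def]
        by (intro continuous_intros sub[OF cD(1)] sub[OF cD(2)])+
      fix y assume y: "y \<in> U"
      show "((\<lambda>t. \<psi> (y + t *\<^sub>R b)) has_vector_derivative p1 b y) (at 0)"
        unfolding p1_def using D[OF y] by (intro has_derivative_along_line) simp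
      show "((\<lambda>t. p1 b (y + t *\<^sub>R b)) has_vector_derivative p2 b y) (at 0)"
        unfolding p2_def using has_derivative_along_line[where f = "p1 b" and y = y and t = 0 and b = b] dp1[OF y, of b] by simp
    qed
    show "(\<Sum>b\<in>Basis. p2 b y) + (complex_of_real \<kappa>)\<^sup>2 * \<psi> y = 0" if "y \<in> U" for y
      using helm[OF that] unfolding lap[OF that] by (metis neg_eq_iff_add_eq_0 of_real_power)
    show "((\<lambda>r. \<psi> (r *\<^sub>R y)) has_vector_derivative euler p1 y) (at 1)" if "y \<in> U" for y
      using has_derivative_along_line[where f = \<psi> and y = 0 and t = 1 and b = y] D[OF that]
      unfolding eu by simp
    fix d :: real assume "d > 0"
    then have "\<forall>\<^sub>F r in at_top. \<forall>\<theta>\<in>sphere 0 1. dist (of_real r * (radial_derivative \<psi> (r *\<^sub>R \<theta>) - \<i> * of_real \<kappa> * \<psi> (r *\<^sub>R \<theta>))) 0 < d"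
      using som unfolding sommerfeld_radiation_def uniform_limit_iff by blast
    then obtain T where T0: "\<forall>r\<ge>T. \<forall>\<theta>\<in>sphere 0 1.
        dist (of_real r * (radial_derivative \<psi> (r *\<^sub>R \<theta>) - \<i> * of_real \<kappa> * \<psi> (r *\<^sub>R \<theta>))) 0 < d"
      unfolding eventually_at_top_linorder by blast
    have T: "norm (of_real r * (radial_derivative \<psi> (r *\<^sub>R \<theta>) - \<i> * of_real \<kappa> * \<psi> (r *\<^sub>R \<theta>))) < d"
      if "T \<le> r" "norm \<theta> = 1" for r \<theta>
    proof -
      have "\<theta> \<in> sphere 0 1" using that by simp
      then show ?thesis using T0 that(1) by (metis dist_0_norm dist_commute)
    qed
    show "\<exists>T. \<forall>y. T \<le> norm y \<longrightarrow> norm (euler p1 y - \<i> * of_real \<kappa> * of_real (norm y) * \<psi> y) < d"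
    \<comment> \<open>From the radius R > 0 on, y lies in U and is nonzero, so the chain rule
      identifies the radial derivative at y.\<close>
    proof (intro exI[of _ "max T R"] allI impI)
      fix y :: "real^3" assume y: "max T R \<le> norm y"
      then have yU: "y \<in> U" and y0: "y \<noteq> 0" using far R(1) by auto
      have ys: "norm y *\<^sub>R sgn y = y" using y0 by (simp add: sgn_div_norm)
      have "((\<lambda>r. \<psi> (0 + r *\<^sub>R sgn y)) has_vector_derivative blinfun_apply (Df y) (sgn y)) (at (norm y))"
        by (rule has_derivative_along_line) (use D[OF yU] ys in simp)
      then have "radial_derivative \<psi> y = blinfun_apply (Df y) (sgn y)"
        unfolding radial_derivative_def by (simp add: vector_derivative_at)
      moreover have "euler p1 y = of_real (norm y) * blinfun_apply (Df y) (sgn y)"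
        unfolding eu by (metis blinfun.scaleR_right scaleR_conv_of_real ys)
      ultimately have "euler p1 y - \<i> * of_real \<kappa> * of_real (norm y) * \<psi> y =
          of_real (norm y) * (radial_derivative \<psi> y - \<i> * of_real \<kappa> * \<psi> y)"
        by (simp add: algebra_simps)
      then show "norm (euler p1 y - \<i> * of_real \<kappa> * of_real (norm y) * \<psi> y) < d"
        using T[of "norm y" "sgn y"] y y0 by (simp add: ys norm_sgn)
    qed
  qed (use oU \<kappa> R far in auto)
  then show ?thesis by blast
qed

text \<open>All the conditions are linear; this reduces uniqueness to one solution whose imaginary
  part vanishes on D.\<close>

lemma radiating_solution_diff:
  assumes "radiating_solution \<kappa> W \<psi> p1 p2 R" "radiating_solution \<kappa> W \<phi> q1 q2 R'"
  shows "radiating_solution \<kappa> W (\<lambda>y. \<psi> y - \<phi> y) (\<lambda>b y. p1 b y - q1 b y) (\<lambda>b y. p2 b y - q2 b y) R"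
proof -
  interpret a: radiating_solution \<kappa> W \<psi> p1 p2 R by fact
  interpret b: radiating_solution \<kappa> W \<phi> q1 q2 R' by fact
  have eu: "euler (\<lambda>b y. p1 b y - q1 b y) y = euler p1 y - euler q1 y" for y
    by (simp add: euler_def right_diff_distrib sum_subtractf)
  show ?thesis
  proof
    show "C2_data W (\<lambda>y. \<psi> y - \<phi> y) (\<lambda>b y. p1 b y - q1 b y) (\<lambda>b y. p2 b y - q2 b y)"
      unfolding C2_data_def using C2_dataD[OF a.data] C2_dataD[OF b.data]
      by (auto intro!: continuous_intros has_vector_derivative_diff)
    show "(\<Sum>b\<in>Basis. p2 b y - q2 b y) + (complex_of_real \<kappa>)\<^sup>2 * (\<psi> y - \<phi> y) = 0" if "y \<in> W" for y
    proof -
      have "(\<Sum>b\<in>Basis. p2 b y - q2 b y) + (complex_of_real \<kappa>)\<^sup>2 * (\<psi> y - \<phi> y) =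
         ((\<Sum>b\<in>Basis. p2 b y) + (complex_of_real \<kappa>)\<^sup>2 * \<psi> y) - ((\<Sum>b\<in>Basis. q2 b y) + (complex_of_real \<kappa>)\<^sup>2 * \<phi> y)"
        by (simp add: sum_subtractf algebra_simps)
      then show ?thesis using a.helmholtz[OF that] b.helmholtz[OF that] by simp
    qed
    show "((\<lambda>r. \<psi> (r *\<^sub>R y) - \<phi> (r *\<^sub>R y)) has_vector_derivative euler (\<lambda>b y. p1 b y - q1 b y) y) (at 1)"
      if "y \<in> W" for y
      unfolding eu by (intro has_vector_derivative_diff a.euler b.euler that)
    fix d :: real assume "d > 0"
    then have d2: "d / 2 > 0" by simp
    obtain T1 T2 where
      T1: "\<And>y. T1 \<le> norm y \<Longrightarrow> norm (euler p1 y - \<i> * of_real \<kappa> * of_real (norm y) * \<psi> y) < d / 2" and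
      T2: "\<And>y. T2 \<le> norm y \<Longrightarrow> norm (euler q1 y - \<i> * of_real \<kappa> * of_real (norm y) * \<phi> y) < d / 2"
      using a.radiation[OF d2] b.radiation[OF d2] by blast
    show "\<exists>T. \<forall>y. T \<le> norm y \<longrightarrow>
      norm (euler (\<lambda>b y. p1 b y - q1 b y) y - \<i> * of_real \<kappa> * of_real (norm y) * (\<psi> y - \<phi> y)) < d"
    proof (intro exI[of _ "max T1 T2"] allI impI)
      fix y :: "real^3" assume y: "max T1 T2 \<le> norm y"
      then have y12: "T1 \<le> norm y" "T2 \<le> norm y" by auto
      have eq: "euler (\<lambda>b y. p1 b y - q1 b y) y - \<i> * of_real \<kappa> * of_real (norm y) * (\<psi> y - \<phi> y) =
        (euler p1 y - \<i> * of_real \<kappa> * of_real (norm y) * \<psi> y) - (euler q1 y - \<i> * of_real \<kappa> * of_real (norm y) * \<phi> y)"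
        unfolding eu by (simp add: algebra_simps)
      show "norm (euler (\<lambda>b y. p1 b y - q1 b y) y - \<i> * of_real \<kappa> * of_real (norm y) * (\<psi> y - \<phi> y)) < d"
        unfolding eq using norm_triangle_ineq4[of "euler p1 y - \<i> * of_real \<kappa> * of_real (norm y) * \<psi> y"
            "euler q1 y - \<i> * of_real \<kappa> * of_real (norm y) * \<phi> y"] T1[OF y12(1)] T2[OF y12(2)]
        by linarith
    qed
  qed (use a.open_W a.kappa_pos a.R0_pos a.far in auto)
qed

theorem theorem2:
  fixes \<kappa> :: real and U X D :: "(real^3) set" and \<psi>\<^sub>1 \<psi>\<^sub>2 :: "real^3 \<Rightarrow> complex"
  assumes "\<kappa> > 0"
    and "exterior_region U"
    and "affine X" and "aff_dim X = 2" and "X \<subseteq> U"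
    and "openin (top_of_set X) D" and "D \<noteq> {}"
    and "radiation_solution \<kappa> U \<psi>\<^sub>1"
    and "radiation_solution \<kappa> U \<psi>\<^sub>2"
    and "\<forall>x\<in>D. Im (\<psi>\<^sub>1 x) = Im (\<psi>\<^sub>2 x)"
  shows "\<forall>x\<in>X. \<psi>\<^sub>1 x = \<psi>\<^sub>2 x"
proof
  fix x assume x: "x \<in> X"
  obtain p1 p2 R q1 q2 R' where
    "radiating_solution \<kappa> U \<psi>\<^sub>1 p1 p2 R" "radiating_solution \<kappa> U \<psi>\<^sub>2 q1 q2 R'"
    using radiation_solution_radiating[OF assms(1,2,8)] radiation_solution_radiating[OF assms(1,2,9)] by blast
  then interpret radiating_solution \<kappa> U "\<lambda>y. \<psi>\<^sub>1 y - \<psi>\<^sub>2 y" "\<lambda>b y. p1 b y - q1 b y" "\<lambda>b y. p2 b y - q2 b y" R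
    by (rule radiating_solution_diff)
  obtain p where p: "p \<in> D" using assms(7) by blast
  obtain e where e: "e > 0" "ball p e \<inter> X \<subseteq> D"
    using assms(6) p unfolding openin_contains_ball by blast
  have pX: "p \<in> X" using p assms(6) openin_subset by fastforce
  \<comment> \<open>For x = p any other point of the plane serves to fix a line through p; one
    exists because a set of dimension 2 is not a single point.\<close>
  obtain x' where x': "x' \<in> X" "x' \<noteq> p" "x \<noteq> p \<Longrightarrow> x' = x"
  proof (cases "x = p")
    case True
    have "X \<noteq> {p}" using assms(4) by auto
    then obtain x' where "x' \<in> X" "x' \<noteq> p" using pX by blast
    then show ?thesis using that True by blast
  qed (use x that in blast)
  define d where "d = sgn (x' - p)"
  have d: "norm d = 1" using x'(2) by (simp add: d_def norm_sgn)
  have line: "p + t *\<^sub>R d \<in> X" for t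
  proof -
    have "(1 - t / norm (x' - p)) *\<^sub>R p + (t / norm (x' - p)) *\<^sub>R x' \<in> X"
      using assms(3) pX x'(1) by (intro mem_affine) auto
    then show ?thesis by (simp add: d_def sgn_div_norm algebra_simps divide_inverse)
  qed
  have zero: "\<psi>\<^sub>1 (p + t *\<^sub>R d) - \<psi>\<^sub>2 (p + t *\<^sub>R d) = 0" for t
  proof (rule zero_on_line[OF d _ e(1)])
    show "p + t *\<^sub>R d \<in> U" for t using line assms(5) by blast
    fix t :: real assume "\<bar>t\<bar> < e"
    then have "p + t *\<^sub>R d \<in> ball p e" using d by (simp add: dist_norm)
    then have "p + t *\<^sub>R d \<in> D" using e(2) line by blast
    then show "Im (\<psi>\<^sub>1 (p + t *\<^sub>R d) - \<psi>\<^sub>2 (p + t *\<^sub>R d)) = 0" using assms(10) by simp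
  qed
  have "\<exists>t. x = p + t *\<^sub>R d"
  proof (cases "x = p")
    case False
    then have "x = p + norm (x - p) *\<^sub>R d"
      using x'(3) by (simp add: d_def sgn_div_norm)
    then show ?thesis by blast
  qed (auto intro: exI[of _ 0])
  then obtain t where "x = p + t *\<^sub>R d" by blast
  then show "\<psi>\<^sub>1 x = \<psi>\<^sub>2 x" using zero[of t] by simp
qed

end
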